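(* Let $U\neq\emptyset$ be a connected open set in $\mathbb{R}^d$, $d\ge 2$. Then, for all $n\in\mathbb{N}$ (with $n\ge 1$) and all $\delta>0$, there is a champagne subregion $U\setminus A$ of $U$, with set of centers $X_A$ and radii $r_x$, $x\in X_A$, such that $A$ is unavoidable and $$\sum_{x\in X_A}\Bigl(\log\frac1{r_x}\Bigr)^{-1}\Bigl(\log^{(n+1)}\frac1{r_x}\Bigr)^{-1}<\delta,\qquad\text{if } d=2,$$ $$\sum_{x\in X_A} r_x^{d-2}\Bigl(\log^{(n)}\frac1{r_x}\Bigr)^{-1}<\delta,\qquad\text{if } d\ge 3,$$ where all the iterated logarithms occurring in these sums are well defined and strictly positive.
   Context: $B(x,r)$ and $\overline B(x,r)$ denote the open and closed Euclidean balls of center $x$ and radius $r$ in $\mathbb{R}^d$. The iterated logarithm is defined recursively by $\log^{(1)}:=\log$ and $\log^{(n+1)}:=\log\log^{(n)}$. Champagne subregion: Let $X$ be a countable set in $U$ having no accumulation point in $U$, and let $r_x\in(0,1)$, $x\in X$, be such that the closed balls $\overline B(x,r_x)$, $x\in X$ (the bubbles), are pairwise disjoint, $\sup_{x\in X} r_x/\mathrm{dist}(x,\partial U)<1$ (with $\mathrm{dist}(x,\emptyset)=\infty$, so the quotient is $0$ if $U=\mathbb{R}^d$) and, if $U$ is unbounded, $r_x\to 0$ as $x\to\infty$. Then the union $A$ of all $\overline B(x,r_x)$, $x\in X$, is relatively closed in $U$, and $U\setminus A$ is called a champagne subregion of $U$. One writes $X_A:=X$ for the set of centers of the bubbles forming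 $A$; $r_x$ is the radius of the bubble centered at $x\in X_A$. Unavoidable: For an open set $W$ and $y\in W$, $\mu_y^W$ denotes the harmonic measure at $y$ with respect to $W$ (the distribution of the point in $\partial W\subset\mathbb{R}^d$ at which Brownian motion started at $y$ exits $W$; its total mass may be less than $1$ if $W$ is unbounded). A relatively closed subset $A$ of $U$ is unavoidable (in $U$) if $\mu_y^{U\setminus A}(A)=1$ for every $y\in U\setminus A$; equivalently, Brownian motion starting in $U\setminus A$ and killed when leaving $U$ hits $A$ almost surely. *)

theory Defs
  imports "HOL-Probability.Probability"
begin

section \<open>Brownian motion and harmonic measure\<close>

text \<open>
  Standard Brownian motion with index set \<open>{0..}\<close>, started at \<open>y\<close>: the values \<open>B t\<close> for
  \<open>t < 0\<close> are irrelevant.  The density below is that of the centred Gaussian law with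
  covariance \<open>(t - s)\<close> times the identity, so the generator is half the Laplacian.
\<close>

definition brownian_motion ::
    "'a::euclidean_space \<Rightarrow> 'w measure \<Rightarrow> (real \<Rightarrow> 'w \<Rightarrow> 'a) \<Rightarrow> bool" where
  "brownian_motion y M B \<longleftrightarrow>
     prob_space M \<and>
     (\<forall>t\<ge>0. B t \<in> borel_measurable M) \<and>
     (\<forall>\<omega>\<in>space M. B 0 \<omega> = y) \<and>
     (\<forall>\<omega>\<in>space M. continuous_on {0..} (\<lambda>t. B t \<omega>)) \<and>
     (\<forall>s t. 0 \<le> s \<longrightarrow> s < t \<longrightarrow>
        distributed M lborel (\<lambda>\<omega>. B t \<omega> - B s \<omega>)
          (\<lambda>x. ennreal (\<Prod>b\<in>Basis. normal_density 0 (sqrt (t - s)) (x \<bullet> b)))) \<and>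
     (\<forall>(\<tau> :: nat \<Rightarrow> real) n. 0 \<le> \<tau> 0 \<longrightarrow> strict_mono \<tau> \<longrightarrow>
        prob_space.indep_vars M (\<lambda>_. borel) (\<lambda>i \<omega>. B (\<tau> (Suc i)) \<omega> - B (\<tau> i) \<omega>) {..<n})"

definition exit_time :: "'a set \<Rightarrow> (real \<Rightarrow> 'a) \<Rightarrow> real" where
  "exit_time W \<gamma> = Inf {t. 0 \<le> t \<and> \<gamma> t \<notin> W}"

text \<open>
  The harmonic measure with respect to \<open>W\<close> at the starting point of the Brownian motion \<open>B\<close>:
  the law of the exit point, carried only by those outcomes for which \<open>B\<close> leaves \<open>W\<close> in finite
  time.  It depends on \<open>M\<close> and \<open>B\<close> only through the starting point.
\<close>

definition harmonic_measure ::
    "'w measure \<Rightarrow> (real \<Rightarrow> 'w \<Rightarrow> 'a::euclidean_space) \<Rightarrow> 'a set \<Rightarrow> 'a measure" where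
  "harmonic_measure M B W =
     distr (restrict_space M {\<omega> \<in> space M. \<exists>t\<ge>0. B t \<omega> \<notin> W}) borel
       (\<lambda>\<omega>. B (exit_time W (\<lambda>t. B t \<omega>)) \<omega>)"

text \<open>
  The sample space is taken inside the path type \<^typ>\<open>real \<Rightarrow> 'a\<close>, on which Wiener measure with
  the coordinate process realises a Brownian motion from every starting point.  As all Brownian
  motions from \<open>y\<close> yield the same harmonic measure, the quantifier over \<open>M\<close> and \<open>B\<close> only
  avoids singling out one of them.
\<close>

definition unavoidable :: "'a::euclidean_space set \<Rightarrow> 'a set \<Rightarrow> bool" where
  "unavoidable U A \<longleftrightarrow>
     closedin (top_of_set U) A \<and>
     (\<forall>y\<in>U - A. \<forall>(M :: (real \<Rightarrow> 'a) measure) B. brownian_motion y M B \<longrightarrow>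
        measure (harmonic_measure M B (U - A)) A = 1)"

section \<open>Champagne subregions\<close>

definition bubbles :: "'a::euclidean_space set \<Rightarrow> ('a \<Rightarrow> real) \<Rightarrow> 'a set" where
  "bubbles X r = (\<Union>x\<in>X. cball x (r x))"

text \<open>
  \<open>U - bubbles X r\<close> is a champagne subregion of \<open>U\<close> with set of centres \<open>X\<close> and radii \<open>r x\<close>;
  the values of \<open>r\<close> off \<open>X\<close> are irrelevant.  The infimum is the distance of \<open>x\<close> to the
  boundary of \<open>U\<close>; in the extended reals it is \<open>\<infinity>\<close> for an empty boundary, and then the
  quotient is \<open>0\<close>.
\<close>

definition champagne_subregion :: "'a::euclidean_space set \<Rightarrow> 'a set \<Rightarrow> ('a \<Rightarrow> real) \<Rightarrow> bool" where
  "champagne_subregion U X r \<longleftrightarrow>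
     countable X \<and> X \<subseteq> U \<and> (\<forall>z\<in>U. \<not> z islimpt X) \<and>
     (\<forall>x\<in>X. 0 < r x \<and> r x < 1) \<and>
     disjoint_family_on (\<lambda>x. cball x (r x)) X \<and>
     (SUP x\<in>X. ereal (r x) / (INF z\<in>frontier U. ereal (dist x z))) < 1 \<and>
     (\<not> bounded U \<longrightarrow> (r \<longlongrightarrow> 0) (inf at_infinity (principal X)))"

end

theory Submission imports Defs begin

text \<open>
  Exhaust \<open>U\<close> by bounded open sets \<open>V m\<close> and put finitely many bubbles of one common radius
  close to each \<open>frontier (V m)\<close>, so densely that Brownian motion reaches \<open>frontier (V m)\<close> before
  hitting the \<open>m\<close>-th layer with probability at most \<open>2\<^sup>-\<^sup>m\<close>.  Since Brownian motion leaves every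
  \<open>V m\<close>, it almost surely hits some layer before leaving \<open>U\<close>.

  The probability is bounded by a function \<open>f \<ge> 0\<close> that is superharmonic off the layer, at least 1
  near \<open>frontier (V m)\<close> and at most \<open>2\<^sup>-\<^sup>m\<close> far from it: \<open>f\<close> is a constant plus a bump function plus
  a sum of radial functions, one per bubble, whose negative Laplacian on a ball of radius \<open>s\<close> around
  the bubble absorbs the Laplacian of the bump.  Balancing the depth of these functions at the bubble
  boundary against the constant fixes the ratio of the capacity of a bubble to \<open>s ^ d\<close>, hence the
  total capacity of a layer stays bounded as \<open>s \<rightarrow> 0\<close>, and any additional factor tending to 0 with
  the radius makes the sum over the layer as small as desired.

  Stochastic calculus is avoided by observing the motion on a grid of mesh \<open>h\<close> only: there \<open>f\<close> is a
  supermartingale up to an error of order \<open>h powr (3 / 2)\<close> per step, and \<open>h\<close> tends to 0 at the end.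
\<close>

section \<open>Gaussian increments\<close>

text \<open>Hence everything except the radius is fixed first, and the radius is then taken so small
  that the extra factor beats this constant. Of the iterated logarithm only its divergence and its
  positivity at small radii are used, so every \<open>n\<close> is treated alike. The comparison
  function is truncated and not twice differentiable. Only upper bounds for its mean after a
  Gaussian step are needed, so one-sided Taylor inequalities suffice: cutting off with
  \<open>min\<close> is harmless, and the single kink of the wrong sign, from the \<open>max\<close>
  in \<open>sink\<close>, is hidden inside the bubble, where nothing is claimed. The Taylor
  remainder has to be cubic: up to time \<open>T\<close> there are about \<open>T / h\<close> steps,
  so an error of order \<open>h powr (3 / 2)\<close> per step adds up to \<open>T * sqrt h\<close>,
  whereas an error of order \<open>h\<close> would not vanish in the limit.\<close>

definition gauss :: "real \<Rightarrow> 'a::euclidean_space measure" where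
  "gauss h = density lborel (\<lambda>x. ennreal (\<Prod>b\<in>Basis. normal_density 0 (sqrt h) (x \<bullet> b)))"

lemma sets_gauss [simp, measurable_cong]: "sets (gauss h) = sets borel"
  and space_gauss [simp]: "space (gauss h) = UNIV"
  by (simp_all add: gauss_def)

text \<open>Tonelli in coordinates; it reduces the total mass and the even moments to
  one-dimensional normal integrals.\<close>

lemma nn_integral_gauss_prod:
  fixes f :: "'a::euclidean_space \<Rightarrow> real \<Rightarrow> real"
  assumes [measurable]: "\<And>b. f b \<in> borel_measurable borel" and nn: "\<And>b x. 0 \<le> f b x"
  shows "(\<integral>\<^sup>+x. (\<Prod>b\<in>Basis. f b (x \<bullet> b)) \<partial>(gauss h :: 'a measure)) =
    (\<Prod>b\<in>Basis. \<integral>\<^sup>+x. ennreal (normal_density 0 (sqrt h) x * f b x) \<partial>lborel)"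
proof -
  have "(\<integral>\<^sup>+x. (\<Prod>b\<in>Basis. f b (x \<bullet> b)) \<partial>(gauss h :: 'a measure)) =
     (\<integral>\<^sup>+x. (\<Prod>b\<in>Basis. ennreal (normal_density 0 (sqrt h) (x \<bullet> b) * f b (x \<bullet> b))) \<partial>(lborel :: 'a measure))"
    unfolding gauss_def
    by (subst nn_integral_density)
       (auto intro!: nn_integral_cong simp: prod.distrib prod_ennreal nn prod_nonneg ennreal_mult[symmetric])
  also have "\<dots> = (\<Prod>b\<in>Basis. \<integral>\<^sup>+x. ennreal (normal_density 0 (sqrt h) x * f b x) \<partial>lborel)"
    using nn_integral_lborel_prod[where f = "\<lambda>b x. ennreal (normal_density 0 (sqrt h) x * f b x)"]
    by simp
  finally show ?thesis .
qed

lemma prob_space_gauss: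
  assumes "h > 0" shows "prob_space (gauss h :: 'a::euclidean_space measure)"
proof
  have *: "(\<integral>\<^sup>+x. ennreal (normal_density 0 (sqrt h) x) \<partial>lborel) = 1"
    using assms by (subst nn_integral_eq_integral) auto
  have "emeasure (gauss h :: 'a measure) (space (gauss h)) = (\<integral>\<^sup>+x. 1 \<partial>(gauss h :: 'a measure))" by simp
  also have "\<dots> = (\<integral>\<^sup>+x. ennreal (\<Prod>b\<in>Basis. (\<lambda>_ _. 1) b (x \<bullet> b)) \<partial>(gauss h :: 'a measure))" by simp
  also have "\<dots> = 1" using nn_integral_gauss_prod[of "\<lambda>(_::'a) _. 1" h] by (simp add: *)
  finally show "emeasure (gauss h :: 'a measure) (space (gauss h)) = 1" .
qed

text \<open>Coordinate reflections preserve both Lebesgue measure and the density. This symmetry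
  removes first moments and mixed second moments without computing them.\<close>

lemma gauss_flip:
  fixes c :: "'a::euclidean_space \<Rightarrow> real"
  assumes c: "\<And>b. c b = 1 \<or> c b = -1"
  shows "distr (gauss h) borel (\<lambda>x::'a. \<Sum>b\<in>Basis. (c b * (x \<bullet> b)) *\<^sub>R b) = gauss h"
proof -
  let ?T = "\<lambda>x::'a. \<Sum>b\<in>Basis. (c b * (x \<bullet> b)) *\<^sub>R b"
  let ?g = "\<lambda>x::'a. ennreal (\<Prod>b\<in>Basis. normal_density 0 (sqrt h) (x \<bullet> b))"
  have T[measurable]: "?T \<in> borel \<rightarrow>\<^sub>M borel" by simp
  have nz: "c b \<noteq> 0" and ab: "\<bar>c b\<bar> = 1" for b using c[of b] by auto
  have inner: "?T x \<bullet> b = c b * (x \<bullet> b)" if "b \<in> Basis" for x b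
    using that by (rule inner_sum_left_Basis)
  have lb: "lborel = distr lborel borel ?T"
    using lborel_affine_euclidean[of c 0] nz by (simp add: ab density_1)
  have sq: "(c b * y)\<^sup>2 = y\<^sup>2" for b y using c[of b] by auto
  have g: "?g (?T x) = ?g x" for x
    by (rule arg_cong[where f=ennreal], rule prod.cong)
       (auto simp: inner normal_density_def sq)
  have "gauss h = density (distr lborel borel ?T) ?g"
    unfolding gauss_def using lb by simp
  also have "\<dots> = distr (density lborel (\<lambda>x. ?g (?T x))) borel ?T"
    by (subst density_distr) auto
  also have "density lborel (\<lambda>x. ?g (?T x)) = gauss h"
    unfolding gauss_def g ..
  finally show ?thesis by simp
qed

lemma integral_gauss_odd:
  fixes c :: "'a::euclidean_space \<Rightarrow> real" and f :: "'a \<Rightarrow> real"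
  assumes c: "\<And>b. c b = 1 \<or> c b = -1" and [measurable]: "f \<in> borel_measurable borel"
    and f: "\<And>x. f (\<Sum>b\<in>Basis. (c b * (x \<bullet> b)) *\<^sub>R b) = - f x"
  shows "integral\<^sup>L (gauss h) f = 0"
proof -
  have "integral\<^sup>L (gauss h) f = (\<integral>x. f (\<Sum>b\<in>Basis. (c b * (x \<bullet> b)) *\<^sub>R b) \<partial>gauss h)"
    using gauss_flip[of c h, OF c, symmetric] by (subst (1) gauss_flip[of c h, OF c, symmetric], subst integral_distr) auto
  also have "\<dots> = - integral\<^sup>L (gauss h) f" by (simp add: f)
  finally show ?thesis by simp
qed

lemma gauss_moment:
  fixes b :: "'a::euclidean_space"
  assumes h: "h > 0" and b: "b \<in> Basis"
  shows "has_bochner_integral (gauss h) (\<lambda>x. (x \<bullet> b) ^ (2 * k)) (fact (2 * k) / ((2 / h) ^ k * fact k))"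
proof (rule has_bochner_integral_nn_integral)
  let ?f = "\<lambda>c x. if c = b then x ^ (2 * k) else (1::real)"
  have 1: "(\<integral>\<^sup>+x. ennreal (normal_density 0 (sqrt h) x) \<partial>lborel) = 1"
    using h by (subst nn_integral_eq_integral) auto
  have 2: "(\<integral>\<^sup>+x. ennreal (normal_density 0 (sqrt h) x * x ^ (2 * k)) \<partial>lborel)
      = ennreal (fact (2 * k) / ((2 / h) ^ k * fact k))"
    using has_bochner_integral_integral_eq[OF normal_moment_even[of "sqrt h" 0 k]]
      has_bochner_integral_integrable integrable.intros[OF normal_moment_even[of "sqrt h" 0 k]] h
    by (subst nn_integral_eq_integral) auto
  have "(\<integral>\<^sup>+x. ennreal ((x \<bullet> b) ^ (2 * k)) \<partial>gauss h) =
    (\<integral>\<^sup>+x. ennreal (\<Prod>c\<in>Basis. ?f c (x \<bullet> c)) \<partial>(gauss h :: 'a measure))"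
    using b by (intro nn_integral_cong) simp
  also have "\<dots> = (\<Prod>c\<in>Basis. \<integral>\<^sup>+x. ennreal (normal_density 0 (sqrt h) x * ?f c x) \<partial>lborel)"
    by (rule nn_integral_gauss_prod) auto
  also have "\<dots> = (\<Prod>c\<in>Basis. if c = b then ennreal (fact (2 * k) / ((2 / h) ^ k * fact k)) else 1)"
    by (rule prod.cong) (auto simp: 1 2)
  finally show "(\<integral>\<^sup>+x. ennreal ((x \<bullet> b) ^ (2 * k)) \<partial>gauss h) = ennreal (fact (2 * k) / ((2 / h) ^ k * fact k))"
    using b by simp
qed (use h in auto)

lemma norm_power2_eq_sum: "(norm (x::'a::euclidean_space))\<^sup>2 = (\<Sum>b\<in>Basis. (x \<bullet> b)\<^sup>2)"
  by (subst power2_norm_eq_inner, subst euclidean_inner, simp add: power2_eq_square)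

lemma
  fixes b :: "'a::euclidean_space"
  assumes h: "h > 0" and b: "b \<in> Basis"
  shows integrable_gauss_inner: "integrable (gauss h) (\<lambda>x. x \<bullet> b)"
    and integrable_gauss_inner2: "integrable (gauss h) (\<lambda>x. (x \<bullet> b)\<^sup>2)"
    and integral_gauss_inner2: "(\<integral>x. (x \<bullet> b)\<^sup>2 \<partial>gauss h) = h"
    and integrable_gauss_inner4: "integrable (gauss h) (\<lambda>x. (x \<bullet> b) ^ 4)"
    and integral_gauss_inner4: "(\<integral>x. (x \<bullet> b) ^ 4 \<partial>gauss h) = 3 * h\<^sup>2"
proof -
  interpret prob_space "gauss h :: 'a measure" by (rule prob_space_gauss[OF h])
  note m1 = gauss_moment[OF h b, of 1] and m2 = gauss_moment[OF h b, of 2]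
  show i2: "integrable (gauss h) (\<lambda>x. (x \<bullet> b)\<^sup>2)" using integrable.intros[OF m1] by simp
  show "(\<integral>x. (x \<bullet> b)\<^sup>2 \<partial>gauss h) = h"
    using has_bochner_integral_integral_eq[OF m1] by simp
  show "integrable (gauss h) (\<lambda>x. (x \<bullet> b) ^ 4)" using integrable.intros[OF m2] by simp
  have f4: "fact 4 = (24::real)" by (simp add: fact_numeral)
  show "(\<integral>x. (x \<bullet> b) ^ 4 \<partial>gauss h) = 3 * h\<^sup>2"
    using has_bochner_integral_integral_eq[OF m2] h by (simp add: f4 power2_eq_square)
  show "integrable (gauss h) (\<lambda>x. x \<bullet> b)"
  proof (rule Bochner_Integration.integrable_bound[of _ "\<lambda>x. 1 + (x \<bullet> b)\<^sup>2"])
    have "\<bar>y\<bar> \<le> 1 + y\<^sup>2" for y :: real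
    proof -
      have "0 \<le> (\<bar>y\<bar> - 1)\<^sup>2" by simp
      also have "\<dots> = 1 + y\<^sup>2 - 2 * \<bar>y\<bar>" by (simp add: power2_diff)
      finally show ?thesis by linarith
    qed
    then show "AE x in gauss h. norm (x \<bullet> b) \<le> norm (1 + (x \<bullet> b)\<^sup>2)" by (simp add: add_nonneg_nonneg)
  qed (use i2 in auto)
qed

lemma
  fixes b c :: "'a::euclidean_space"
  assumes h: "h > 0" and b: "b \<in> Basis" and c: "c \<in> Basis"
  shows integrable_gauss_inner_mult: "integrable (gauss h) (\<lambda>x. (x \<bullet> b) * (x \<bullet> c))"
    and integral_gauss_inner_mult: "(\<integral>x. (x \<bullet> b) * (x \<bullet> c) \<partial>gauss h) = (if b = c then h else 0)"
proof -
  show "integrable (gauss h) (\<lambda>x. (x \<bullet> b) * (x \<bullet> c))"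
  proof (rule Bochner_Integration.integrable_bound[of _ "\<lambda>x. (x \<bullet> b)\<^sup>2 + (x \<bullet> c)\<^sup>2"])
    have "\<bar>y * z\<bar> \<le> y\<^sup>2 + z\<^sup>2" for y z :: real
    proof -
      have "0 \<le> (\<bar>y\<bar> - \<bar>z\<bar>)\<^sup>2" by simp
      also have "\<dots> = y\<^sup>2 + z\<^sup>2 - 2 * \<bar>y * z\<bar>" by (simp add: power2_diff abs_mult)
      finally show ?thesis by linarith
    qed
    then show "AE x in gauss h. norm ((x \<bullet> b) * (x \<bullet> c)) \<le> norm ((x \<bullet> b)\<^sup>2 + (x \<bullet> c)\<^sup>2)"
      by (simp add: add_nonneg_nonneg)
  qed (use b c in \<open>auto intro!: Bochner_Integration.integrable_add integrable_gauss_inner2[OF h]\<close>)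
  show "(\<integral>x. (x \<bullet> b) * (x \<bullet> c) \<partial>gauss h) = (if b = c then h else 0)"
  proof (cases "b = c")
    case True then show ?thesis using integral_gauss_inner2[OF h b] by (simp add: power2_eq_square)
  next
    case False
    \<comment> \<open>Flipping the sign of the coordinate \<open>b\<close> alone makes the product
      of two different coordinates odd.\<close>
    let ?s = "\<lambda>d. if d = b then -1 else (1::real)"
    have inner: "(\<Sum>b\<in>Basis. (?s b * (x \<bullet> b)) *\<^sub>R b) \<bullet> d = ?s d * (x \<bullet> d)" if "d \<in> Basis" for x d :: 'a
      using that by (rule inner_sum_left_Basis)
    have "(\<integral>x. (x \<bullet> b) * (x \<bullet> c) \<partial>gauss h) = 0"
      by (rule integral_gauss_odd[of ?s]) (use b c False in \<open>auto simp only: inner\<close>, auto)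
    then show ?thesis using False by simp
  qed
qed

lemma
  fixes z :: "'a::euclidean_space" and h :: real
  assumes h: "h > 0"
  shows integrable_gauss_linear: "integrable (gauss h) (\<lambda>x. z \<bullet> x)"
    and integral_gauss_linear: "(\<integral>x. z \<bullet> x \<partial>gauss h) = 0"
    and integrable_gauss_norm2: "integrable (gauss h) (\<lambda>x::'a. (norm x)\<^sup>2)"
    and integral_gauss_norm2: "(\<integral>x. (norm (x::'a))\<^sup>2 \<partial>gauss h) = DIM('a) * h"
    and integrable_gauss_linear2: "integrable (gauss h) (\<lambda>x. (z \<bullet> x)\<^sup>2)"
    and integral_gauss_linear2: "(\<integral>x. (z \<bullet> x)\<^sup>2 \<partial>gauss h) = h * (norm z)\<^sup>2"
proof -
  have e: "(\<lambda>x. z \<bullet> x) = (\<lambda>x. \<Sum>b\<in>Basis. (z \<bullet> b) * (x \<bullet> b))" by (rule ext, rule euclidean_inner)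
  show "integrable (gauss h) (\<lambda>x. z \<bullet> x)"
    by (subst e, intro Bochner_Integration.integrable_sum integrable_mult_right integrable_gauss_inner[OF h])
  show "(\<integral>x. z \<bullet> x \<partial>gauss h) = 0"
    by (rule integral_gauss_odd[of "\<lambda>_. -1"]) (auto simp: sum_negf euclidean_representation)
  show "integrable (gauss h) (\<lambda>x::'a. (norm x)\<^sup>2)"
    unfolding norm_power2_eq_sum by (intro Bochner_Integration.integrable_sum integrable_gauss_inner2[OF h])
  show "(\<integral>x. (norm (x::'a))\<^sup>2 \<partial>gauss h) = DIM('a) * h"
    unfolding norm_power2_eq_sum
    by (subst Bochner_Integration.integral_sum) (auto simp: integral_gauss_inner2[OF h] integrable_gauss_inner2[OF h])
  have e2: "(z \<bullet> x)\<^sup>2 = (\<Sum>b\<in>Basis. \<Sum>c\<in>Basis. ((z \<bullet> b) * (z \<bullet> c)) * ((x \<bullet> b) * (x \<bullet> c)))" for x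
  proof -
    have "(z \<bullet> x)\<^sup>2 = (\<Sum>b\<in>Basis. (z \<bullet> b) * (x \<bullet> b)) * (\<Sum>b\<in>Basis. (z \<bullet> b) * (x \<bullet> b))"
      using fun_cong[OF e, of x] by (simp only: power2_eq_square)
    then show ?thesis by (simp add: sum_product ac_simps)
  qed
  show "integrable (gauss h) (\<lambda>x. (z \<bullet> x)\<^sup>2)"
    unfolding e2 by (intro Bochner_Integration.integrable_sum integrable_mult_right integrable_gauss_inner_mult[OF h])
  have "(\<integral>x. (z \<bullet> x)\<^sup>2 \<partial>gauss h) = (\<Sum>b\<in>Basis. \<Sum>c\<in>Basis. ((z \<bullet> b) * (z \<bullet> c)) * (if b = c then h else 0))"
    unfolding e2
    by (subst Bochner_Integration.integral_sum, intro Bochner_Integration.integrable_sum integrable_mult_right integrable_gauss_inner_mult[OF h], assumption+,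
       intro sum.cong refl, subst Bochner_Integration.integral_sum, intro integrable_mult_right integrable_gauss_inner_mult[OF h], assumption+,
       intro sum.cong refl, subst integral_mult_right_zero, subst integral_gauss_inner_mult[OF h], assumption+, rule refl)
  also have "\<dots> = (\<Sum>b\<in>Basis. (z \<bullet> b)\<^sup>2 * h)"
    by (intro sum.cong refl) (simp add: if_distrib[of "\<lambda>u. _ * u"] power2_eq_square cong: if_cong)
  finally show "(\<integral>x. (z \<bullet> x)\<^sup>2 \<partial>gauss h) = h * (norm z)\<^sup>2"
    by (simp add: norm_power2_eq_sum sum_distrib_left mult.commute)
qed

text \<open>The odd power is interpolated between the second and the fourth moment:
  \<open>2 * n ^ 3 \<le> sqrt h * n ^ 2 + n ^ 4 / sqrt h\<close>. The weight \<open>sqrt h\<close>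
  balances the two terms, both becoming of order \<open>h * sqrt h\<close>.\<close>

lemma gauss_third_moment:
  fixes h :: real
  assumes h: "h > 0"
  shows "integrable (gauss h) (\<lambda>x::'a::euclidean_space. norm x ^ 3)"
    and "(\<integral>x. norm (x::'a) ^ 3 \<partial>gauss h) \<le> 2 * (real DIM('a))\<^sup>2 * h * sqrt h"
proof -
  let ?d = "real DIM('a)"
  have d1: "?d \<ge> 1" by simp
  let ?g = "\<lambda>x::'a. (sqrt h * (norm x)\<^sup>2 + ?d * (\<Sum>b\<in>Basis. (x \<bullet> b) ^ 4) / sqrt h) / 2"
  have ig: "integrable (gauss h) ?g"
    by (intro integrable_divide Bochner_Integration.integrable_add integrable_mult_right Bochner_Integration.integrable_sum
          integrable_gauss_norm2[OF h] integrable_gauss_inner4[OF h]) auto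
  have n4: "norm x ^ 4 \<le> ?d * (\<Sum>b\<in>Basis. (x \<bullet> b) ^ 4)" for x :: 'a
  proof -
    have "norm x ^ 4 = (\<Sum>b\<in>Basis. 1 * (x \<bullet> b)\<^sup>2)\<^sup>2"
      by (simp add: norm_power2_eq_sum[symmetric] del: power_mult flip: power_mult)
    also have "\<dots> \<le> (\<Sum>b\<in>(Basis::'a set). 1\<^sup>2) * (\<Sum>b\<in>Basis. ((x \<bullet> b)\<^sup>2)\<^sup>2)"
      by (rule Cauchy_Schwarz_ineq_sum)
    also have "\<dots> = ?d * (\<Sum>b\<in>Basis. (x \<bullet> b) ^ 4)" by (simp flip: power_mult)
    finally show ?thesis .
  qed
  have bd: "norm x ^ 3 \<le> ?g x" for x :: 'a
  proof -
    let ?s = "sqrt h"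
    have s: "?s > 0" using h by simp
    have "0 \<le> norm x ^ 2 * (?s - norm x)\<^sup>2 / ?s" using s by (simp add: zero_le_mult_iff)
    also have "\<dots> = ?s * (norm x)\<^sup>2 + norm x ^ 4 / ?s - 2 * norm x ^ 3"
      using s by (simp add: field_simps power2_eq_square power3_eq_cube power4_eq_xxxx)
    finally have "2 * norm x ^ 3 \<le> ?s * (norm x)\<^sup>2 + norm x ^ 4 / ?s" by simp
    also have "\<dots> \<le> ?s * (norm x)\<^sup>2 + ?d * (\<Sum>b\<in>Basis. (x \<bullet> b) ^ 4) / ?s"
      using n4[of x] s by (simp add: divide_right_mono)
    finally show ?thesis by simp
  qed
  show i3: "integrable (gauss h) (\<lambda>x::'a::euclidean_space. norm x ^ 3)"
  proof (rule Bochner_Integration.integrable_bound[OF ig])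
    have "norm (norm x ^ 3) \<le> norm (?g x)" for x :: 'a
    proof -
      have "norm (norm x ^ 3) = norm x ^ 3" by simp
      also note bd
      also have "?g x \<le> norm (?g x)" by (simp only: real_norm_def abs_ge_self)
      finally show ?thesis .
    qed
    then show "AE x in gauss h. norm (norm (x::'a) ^ 3) \<le> norm (?g x)" by (rule AE_I2)
  qed simp
  have "(\<integral>x. norm (x::'a) ^ 3 \<partial>gauss h) \<le> integral\<^sup>L (gauss h) ?g"
    by (intro integral_mono i3 ig bd)
  also have "\<dots> = (sqrt h * (?d * h) + ?d * (?d * (3 * h\<^sup>2)) / sqrt h) / 2"
    using integrable_gauss_norm2[OF h, where 'a='a] integrable_gauss_inner4[OF h, where 'a='a]
    by (simp add: integral_gauss_norm2[OF h] integral_gauss_inner4[OF h] Bochner_Integration.integral_sum)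
  also have "?d * (?d * (3 * h\<^sup>2)) / sqrt h = 3 * ?d\<^sup>2 * h * sqrt h"
  proof -
    have "h = sqrt h * sqrt h" using h by simp
    then have "h\<^sup>2 / sqrt h = h * sqrt h" using h
      by (simp add: power2_eq_square divide_simps) 
    moreover have "?d * (?d * (3 * h\<^sup>2)) / sqrt h = 3 * ?d\<^sup>2 * (h\<^sup>2 / sqrt h)"
      by (simp add: power2_eq_square)
    ultimately show ?thesis by simp
  qed
  also have "(sqrt h * (?d * h) + 3 * ?d\<^sup>2 * h * sqrt h) / 2 \<le> 2 * ?d\<^sup>2 * h * sqrt h"
  proof -
    have "?d * (h * sqrt h) \<le> ?d\<^sup>2 * (h * sqrt h)"
      using h d1 by (intro mult_right_mono) (simp_all add: power2_eq_square)
    then show ?thesis by (simp add: algebra_simps)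
  qed
  finally show "(\<integral>x. norm (x::'a) ^ 3 \<partial>gauss h) \<le> 2 * (real DIM('a))\<^sup>2 * h * sqrt h" by simp
qed

text \<open>
  The generator inequality \<open>\<Delta> f x / 2 \<le> L\<close> in integrated form.  Unlike a pointwise inequality for
  second derivatives it needs no regularity of \<open>f\<close> away from \<open>x\<close>.
\<close>

definition step_le :: "('a::euclidean_space \<Rightarrow> real) \<Rightarrow> 'a \<Rightarrow> real \<Rightarrow> real \<Rightarrow> bool" where
  "step_le f x L C \<longleftrightarrow> (\<forall>h>0. (\<integral>w. f (x + w) \<partial>gauss h) \<le> f x + h * L + C * h * sqrt h)"

lemma integrable_gauss_bounded:
  fixes f :: "'a::euclidean_space \<Rightarrow> real"
  assumes h: "h > 0" and [measurable]: "f \<in> borel_measurable borel" and "\<And>x. \<bar>f x\<bar> \<le> B"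
  shows "integrable (gauss h) (\<lambda>w. f (x + w))"
proof -
  interpret prob_space "gauss h :: 'a measure" by (rule prob_space_gauss[OF h])
  show ?thesis by (rule integrable_const_bound[where B=B]) (use assms in auto)
qed

text \<open>Under the Gaussian mean the linear term vanishes and the two quadratic terms give
  \<open>h\<close> times a trace. A multiple of the identity plus a rank-one form is exactly the
  Hessian of a radial function, the only case needed.\<close>

lemma step_le_taylor:
  fixes f :: "'a::euclidean_space \<Rightarrow> real" and a b C :: real
  assumes [measurable]: "f \<in> borel_measurable borel" and B: "\<And>x. \<bar>f x\<bar> \<le> B" and C: "C \<ge> 0"
    and T: "\<And>w. f (x + w) \<le> f x + g \<bullet> w + a * (norm w)\<^sup>2 + b * (z \<bullet> w)\<^sup>2 + C * norm w ^ 3"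
  shows "step_le f x (DIM('a) * a + b * (norm z)\<^sup>2) (C * 2 * (real DIM('a))\<^sup>2)"
  unfolding step_le_def
proof (intro allI impI)
  fix h :: real assume h: "h > 0"
  interpret prob_space "gauss h :: 'a measure" by (rule prob_space_gauss[OF h])
  let ?t = "\<lambda>w. f x + g \<bullet> w + a * (norm w)\<^sup>2 + b * (z \<bullet> w)\<^sup>2 + C * norm w ^ 3"
  note i = integrable_gauss_linear[OF h, of g] integrable_gauss_norm2[OF h, where 'a='a]
     integrable_gauss_linear2[OF h, of z] gauss_third_moment(1)[OF h, where 'a='a]
  have "(\<integral>w. f (x + w) \<partial>gauss h) \<le> integral\<^sup>L (gauss h) ?t"
    by (intro integral_mono integrable_gauss_bounded[OF h _ B] T) (use i in auto)
  also have "\<dots> = f x + a * (DIM('a) * h) + b * (h * (norm z)\<^sup>2) + C * (\<integral>x. norm (x::'a) ^ 3 \<partial>gauss h)"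
    using i by (simp add: integral_gauss_linear[OF h] integral_gauss_norm2[OF h] integral_gauss_linear2[OF h] prob_space[simplified])
  also have "\<dots> \<le> f x + a * (DIM('a) * h) + b * (h * (norm z)\<^sup>2) + C * (2 * (real DIM('a))\<^sup>2 * h * sqrt h)"
    by (intro add_left_mono mult_left_mono gauss_third_moment(2) h C)
  finally show "(\<integral>w. f (x + w) \<partial>gauss h) \<le> f x + h * (DIM('a) * a + b * (norm z)\<^sup>2) + (C * 2 * (real DIM('a))\<^sup>2) * h * sqrt h"
    by (simp add: algebra_simps)
qed

lemma step_le_mono: "step_le f x L C \<Longrightarrow> L \<le> L' \<Longrightarrow> C \<le> C' \<Longrightarrow> step_le f x L' C'"
  unfolding step_le_def
  by (meson add_mono mult_left_mono mult_right_mono order_refl order_trans less_imp_le real_sqrt_ge_zero)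

lemma step_le_add:
  fixes f g :: "'a::euclidean_space \<Rightarrow> real"
  assumes "step_le f x L C" "step_le g x L' C'"
    and "f \<in> borel_measurable borel" "\<And>x. \<bar>f x\<bar> \<le> B" "g \<in> borel_measurable borel" "\<And>x. \<bar>g x\<bar> \<le> B'"
  shows "step_le (\<lambda>x. f x + g x) x (L + L') (C + C')"
  unfolding step_le_def
proof (intro allI impI)
  fix h :: real assume h: "h > 0"
  have "(\<integral>w. f (x + w) + g (x + w) \<partial>gauss h) = (\<integral>w. f (x + w) \<partial>gauss h) + (\<integral>w. g (x + w) \<partial>gauss h)"
    using assms h by (intro Bochner_Integration.integral_add integrable_gauss_bounded) auto
  also have "\<dots> \<le> (f x + h * L + C * h * sqrt h) + (g x + h * L' + C' * h * sqrt h)"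
    using assms(1,2) h unfolding step_le_def by (intro add_mono) auto
  finally show "(\<integral>w. f (x + w) + g (x + w) \<partial>gauss h) \<le> f x + g x + h * (L + L') + (C + C') * h * sqrt h"
    by (simp add: algebra_simps)
qed

lemma step_le_const: "step_le (\<lambda>_. c) (x::'a::euclidean_space) 0 0"
proof -
  have "measure (gauss h :: 'a measure) UNIV = 1" if "h > 0" for h
    using prob_space.prob_space[OF prob_space_gauss[OF that]] by (metis space_gauss)
  then show ?thesis by (simp add: step_le_def)
qed

lemma step_le_cmult:
  assumes "step_le f x L C" "0 \<le> k" shows "step_le (\<lambda>x. k * f x) x (k * L) (k * C)"
  unfolding step_le_def
proof (intro allI impI)
  fix h :: real assume "h > 0"
  then have "k * (\<integral>w. f (x + w) \<partial>gauss h) \<le> k * (f x + h * L + C * h * sqrt h)"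
    using assms unfolding step_le_def by (intro mult_left_mono) auto
  then show "(\<integral>w. k * f (x + w) \<partial>gauss h) \<le> k * f x + h * (k * L) + k * C * h * sqrt h"
    by (simp add: algebra_simps)
qed

lemma step_le_sum:
  fixes f :: "'i \<Rightarrow> 'a::euclidean_space \<Rightarrow> real"
  assumes "finite I" and s: "\<And>i. i \<in> I \<Longrightarrow> step_le (f i) x (L i) (C i)"
    and m: "\<And>i. i \<in> I \<Longrightarrow> f i \<in> borel_measurable borel" and B: "\<And>i x. i \<in> I \<Longrightarrow> \<bar>f i x\<bar> \<le> B i"
  shows "step_le (\<lambda>x. \<Sum>i\<in>I. f i x) x (\<Sum>i\<in>I. L i) (\<Sum>i\<in>I. C i)"
  using assms
proof (induction I rule: finite_induct)
  case empty then show ?case by (simp add: step_le_const)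
next
  case (insert i I)
  have "step_le (\<lambda>x. f i x + (\<Sum>i\<in>I. f i x)) x (L i + (\<Sum>i\<in>I. L i)) (C i + (\<Sum>i\<in>I. C i))"
    by (rule step_le_add[where B="B i" and B'="\<Sum>i\<in>I. B i"])
      (use insert in \<open>auto intro!: order_trans[OF sum_abs] sum_mono borel_measurable_sum\<close>)
  then show ?case using insert by simp
qed

section \<open>Brownian motion on a grid\<close>

lemma brownian_motionD:
  assumes "brownian_motion y M B"
  shows "prob_space M"
    and "\<And>t. 0 \<le> t \<Longrightarrow> B t \<in> borel_measurable M"
    and "\<And>\<omega>. \<omega> \<in> space M \<Longrightarrow> B 0 \<omega> = y"
    and "\<And>\<omega>. \<omega> \<in> space M \<Longrightarrow> continuous_on {0..} (\<lambda>t. B t \<omega>)"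
  using assms unfolding brownian_motion_def by blast+

lemma distr_increment:
  assumes bm: "brownian_motion y M (B :: real \<Rightarrow> 'w \<Rightarrow> 'a::euclidean_space)" and st: "0 \<le> s" "s < t"
  shows "distr M borel (\<lambda>\<omega>. B t \<omega> - B s \<omega>) = gauss (t - s)"
proof -
  have "distributed M lborel (\<lambda>\<omega>. B t \<omega> - B s \<omega>)
          (\<lambda>x. ennreal (\<Prod>b\<in>Basis. normal_density 0 (sqrt (t - s)) (x \<bullet> b)))"
    using bm st unfolding brownian_motion_def by blast
  then have "distr M lborel (\<lambda>\<omega>. B t \<omega> - B s \<omega>) = gauss (t - s)"
    unfolding distributed_def gauss_def by blast
  moreover have "distr M lborel (\<lambda>\<omega>. B t \<omega> - B s \<omega>) = distr M borel (\<lambda>\<omega>. B t \<omega> - B s \<omega>)"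
    by (rule distr_cong) auto
  ultimately show ?thesis by simp
qed

text \<open>The Markov property at time \<open>k * h\<close>, on the event that the walk has stayed
  in \<open>G\<close>. Brownian motion is given only through independent increments, so positions
  are rewritten as functions \<open>pos\<close> of the past increments; Fubini for the joint law of
  past and next increment then allows \<open>step\<close> to be applied with the past
  frozen.\<close>

lemma grid_markov:
  fixes f :: "'a::euclidean_space \<Rightarrow> real"
  assumes bm: "brownian_motion y M B" and h: "h > 0"
    and [measurable]: "f \<in> borel_measurable borel" "G \<in> sets borel"
    and step: "\<And>x. x \<in> G \<Longrightarrow> (\<integral>\<^sup>+w. ennreal (f (x + w)) \<partial>gauss h) \<le> ennreal (f x) + e"
  shows "(\<integral>\<^sup>+\<omega>. ennreal (f (B (real (Suc k) * h) \<omega>)) * indicator {\<omega>. \<forall>i\<le>k. B (real i * h) \<omega> \<in> G} \<omega> \<partial>M)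
    \<le> (\<integral>\<^sup>+\<omega>. (ennreal (f (B (real k * h) \<omega>)) + e) * indicator {\<omega>. \<forall>i\<le>k. B (real i * h) \<omega> \<in> G} \<omega> \<partial>M)"
proof -
  interpret prob_space M by (rule brownian_motionD[OF bm])
  let ?inc = "\<lambda>i \<omega>. B (real (Suc i) * h) \<omega> - B (real i * h) \<omega>"
  let ?P = "PiM {..<k} (\<lambda>_. borel :: 'a measure)"
  \<comment> \<open>\<open>X\<close> collects the past increments and \<open>W\<close> the next one.
    The latter is kept as a function on \<open>{k}\<close> because \<open>indep_var_restrict\<close>
    yields independence of two restrictions of the index set.\<close>
  define X where "X = (\<lambda>\<omega>. restrict (\<lambda>i. ?inc i \<omega>) {..<k})"
  let ?P1 = "PiM {k} (\<lambda>_. borel :: 'a measure)"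
  define W where "W = (\<lambda>\<omega>. restrict (\<lambda>i. ?inc i \<omega>) {k})"
  define pos where "pos p j = y + (\<Sum>i<j. p i)" for p :: "nat \<Rightarrow> 'a" and j
  have "indep_vars (\<lambda>_. borel) ?inc {..<Suc k}"
  proof -
    have "strict_mono (\<lambda>i. real i * h)" using h by (auto simp: strict_mono_def)
    moreover have "(0::real) \<le> real 0 * h" by simp
    moreover have "\<forall>(\<tau> :: nat \<Rightarrow> real) n. 0 \<le> \<tau> 0 \<longrightarrow> strict_mono \<tau> \<longrightarrow>
        indep_vars (\<lambda>_. borel) (\<lambda>i \<omega>. B (\<tau> (Suc i)) \<omega> - B (\<tau> i) \<omega>) {..<n}"
      using bm unfolding brownian_motion_def by (elim conjE)
    ultimately show ?thesis by (elim allE[of _ "\<lambda>i. real i * h"] allE[of _ "Suc k"] impE)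
  qed
  then have "indep_var ?P (\<lambda>\<omega>. restrict (\<lambda>i. ?inc i \<omega>) {..<k})
     (PiM {k} (\<lambda>_. borel :: 'a measure)) (\<lambda>\<omega>. restrict (\<lambda>i. ?inc i \<omega>) {k})"
    by (rule indep_var_restrict) auto
  then have ind: "indep_var ?P X ?P1 W" unfolding X_def W_def .
  then have X[measurable]: "X \<in> measurable M ?P" and W[measurable]: "W \<in> measurable M ?P1"
    by (blast dest: indep_var_rv1 indep_var_rv2)+
  have joint: "distr M ?P X \<Otimes>\<^sub>M distr M ?P1 W = distr M (?P \<Otimes>\<^sub>M ?P1) (\<lambda>\<omega>. (X \<omega>, W \<omega>))"
    using ind unfolding indep_var_distribution_eq by blast
  have inc[measurable]: "?inc k \<in> borel_measurable M"
    using brownian_motionD(2)[OF bm] h by (intro borel_measurable_diff) auto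
  have dinc: "distr M borel (?inc k) = gauss h"
    using distr_increment[OF bm, of "real k * h" "real (Suc k) * h"] h by (simp add: algebra_simps)
  have pos: "B (real j * h) \<omega> = pos (X \<omega>) j" if "\<omega> \<in> space M" "j \<le> k" for j \<omega>
    using that(2)
  proof (induction j)
    case 0 then show ?case using brownian_motionD(3)[OF bm that(1)] by (simp add: pos_def)
  next
    case (Suc j) 
    then show ?case by (simp add: pos_def X_def algebra_simps)
  qed
  let ?D = "\<lambda>p. \<forall>i\<le>k. pos p i \<in> G"
  have pm[measurable]: "(\<lambda>p. pos p j) \<in> measurable ?P borel" if "j \<le> k" for j
    unfolding pos_def by (intro borel_measurable_add borel_measurable_sum borel_measurable_const
       measurable_component_singleton) (use that in auto)
  have [measurable]: "Measurable.pred ?P ?D"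
    by (intro pred_intros_countable pred_intros_imp') (auto intro!: pred_sets2[OF \<open>G \<in> sets borel\<close>] pm)
  have pk[measurable]: "(\<lambda>p. pos p k) \<in> measurable ?P borel" by simp
  let ?F = "\<lambda>(p, w). ennreal (f (pos p k + w k)) * indicator {p. ?D p} p"
  have [measurable]: "(\<lambda>w. w k) \<in> measurable ?P1 borel" by (rule measurable_component_singleton) simp
  have Fm: "?F \<in> borel_measurable (?P \<Otimes>\<^sub>M ?P1)" by measurable
  interpret W: prob_space "distr M ?P1 W" by (rule prob_space_distr) (rule W)
  have inner: "(\<integral>\<^sup>+w. ?F (p, w) \<partial>distr M ?P1 W) \<le> (ennreal (f (pos p k)) + e) * indicator {p. ?D p} p" for p
  proof (cases "?D p")
    case True
    have "(\<integral>\<^sup>+w. ?F (p, w) \<partial>distr M ?P1 W) = (\<integral>\<^sup>+\<omega>. ennreal (f (pos p k + ?inc k \<omega>)) \<partial>M)"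
      using True by (subst nn_integral_distr[OF W]) (auto simp: W_def[THEN fun_cong])
    also have "\<dots> = (\<integral>\<^sup>+w. ennreal (f (pos p k + w)) \<partial>gauss h)"
      unfolding dinc[symmetric] by (subst nn_integral_distr[OF inc]) auto
    also have "\<dots> \<le> ennreal (f (pos p k)) + e" using True by (intro step) auto
    finally show ?thesis using True by simp
  qed simp
  have "(\<integral>\<^sup>+\<omega>. ennreal (f (B (real (Suc k) * h) \<omega>)) * indicator {\<omega>. \<forall>i\<le>k. B (real i * h) \<omega> \<in> G} \<omega> \<partial>M)
     = (\<integral>\<^sup>+\<omega>. ?F (X \<omega>, W \<omega>) \<partial>M)"
    by (intro nn_integral_cong) (simp add: pos[symmetric] indicator_def W_def)
  also have "\<dots> = (\<integral>\<^sup>+z. ?F z \<partial>(distr M ?P X \<Otimes>\<^sub>M distr M ?P1 W))"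
    unfolding joint by (subst nn_integral_distr) (auto simp: Fm)
  also have "\<dots> = (\<integral>\<^sup>+p. \<integral>\<^sup>+w. ?F (p, w) \<partial>distr M ?P1 W \<partial>distr M ?P X)"
  proof (rule W.nn_integral_fst[symmetric])
    have "borel_measurable (distr M ?P X \<Otimes>\<^sub>M distr M ?P1 W) = (borel_measurable (?P \<Otimes>\<^sub>M ?P1) :: (_ \<Rightarrow> ennreal) set)"
      by (intro measurable_cong_sets sets_pair_measure_cong) auto
    then show "?F \<in> borel_measurable (distr M ?P X \<Otimes>\<^sub>M distr M ?P1 W)" using Fm by blast
  qed
  also have "\<dots> \<le> (\<integral>\<^sup>+p. (ennreal (f (pos p k)) + e) * indicator {p. ?D p} p \<partial>distr M ?P X)"
    by (intro nn_integral_mono inner)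
  also have "\<dots> = (\<integral>\<^sup>+\<omega>. (ennreal (f (pos (X \<omega>) k)) + e) * indicator {p. ?D p} (X \<omega>) \<partial>M)"
    by (subst nn_integral_distr) auto
  also have "\<dots> = (\<integral>\<^sup>+\<omega>. (ennreal (f (B (real k * h) \<omega>)) + e) * indicator {\<omega>. \<forall>i\<le>k. B (real i * h) \<omega> \<in> G} \<omega> \<partial>M)"
    by (intro nn_integral_cong) (simp add: pos[symmetric] indicator_def)
  finally show ?thesis .
qed

text \<open>The maximal inequality for a nonnegative supermartingale with drift error, for the walk
  stopped on entering \<open>A\<close> or \<open>S\<close>: since \<open>f\<close> is at least 1 on
  \<open>S\<close>, each first arrival in \<open>S\<close> is paid for by the mean of
  \<open>f\<close>.\<close>

lemma grid_hit_bound: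
  fixes f :: "'a::euclidean_space \<Rightarrow> real"
  assumes bm: "brownian_motion y M B" and h: "h > 0"
    and f[measurable]: "f \<in> borel_measurable borel" and AS[measurable]: "A \<in> sets borel" "S \<in> sets borel"
    and f0: "\<And>x. 0 \<le> f x" and fB: "\<And>x. f x \<le> b" and C: "C \<ge> 0"
    and step: "\<And>x. x \<notin> A \<Longrightarrow> step_le f x 0 C"
    and f1: "\<And>x. x \<in> S \<Longrightarrow> 1 \<le> f x"
  shows "emeasure M {\<omega> \<in> space M. \<exists>k<K. B (real k * h) \<omega> \<in> S \<and> (\<forall>i<k. B (real i * h) \<omega> \<notin> A)}
    \<le> ennreal (f y + real K * (C * h * sqrt h))"
proof -
  interpret prob_space M by (rule brownian_motionD[OF bm])
  have Bm[measurable]: "B (real k * h) \<in> borel_measurable M" for k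
    using brownian_motionD(2)[OF bm] h by simp
  define G where "G = - (A \<union> S)"
  have G[measurable]: "G \<in> sets borel" unfolding G_def using AS by auto
  define e where "e = C * h * sqrt h"
  have e0: "e \<ge> 0" unfolding e_def using C h by simp
  have st: "(\<integral>\<^sup>+w. ennreal (f (x + w)) \<partial>gauss h) \<le> ennreal (f x) + ennreal e" if "x \<in> G" for x
  proof -
    have "(\<integral>\<^sup>+w. ennreal (f (x + w)) \<partial>gauss h) = ennreal (\<integral>w. f (x + w) \<partial>gauss h)"
      by (intro nn_integral_eq_integral integrable_gauss_bounded[OF h f, of b]) (use f0 fB in \<open>auto simp: abs_of_nonneg\<close>)
    also have "\<dots> \<le> ennreal (f x + e)"
      using step[of x] that h unfolding step_le_def G_def e_def by (intro ennreal_leI) auto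
    finally show ?thesis using f0 e0 by simp
  qed
  define D where "D k = {\<omega> \<in> space M. \<forall>i<k. B (real i * h) \<omega> \<in> G}" for k :: nat
  define Q where "Q k = D k \<inter> {\<omega> \<in> space M. B (real k * h) \<omega> \<in> S}" for k :: nat
  define H where "H K = (\<Union>k<K. Q k)" for K :: nat
  define R where "R k = (\<integral>\<^sup>+\<omega>. ennreal (f (B (real k * h) \<omega>)) * indicator (D k) \<omega> \<partial>M)" for k :: nat
  have [measurable]: "D k \<in> sets M" for k unfolding D_def by measurable
  have [measurable]: "Q k \<in> sets M" for k unfolding Q_def by measurable
  have [measurable]: "H k \<in> sets M" for k unfolding H_def by measurable
  \<comment> \<open>The invariant: the probability of having reached \<open>S\<close>, plus the mean
    of \<open>f\<close> over the paths not stopped before step \<open>K\<close>, increases by at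
    most \<open>e\<close> per step.\<close>
  have main: "emeasure M (H K) + R K \<le> ennreal (f y + real K * e)" for K
  proof (induction K)
    case 0
    have "R 0 = (\<integral>\<^sup>+\<omega>. ennreal (f y) \<partial>M)"
      unfolding R_def by (intro nn_integral_cong) (simp add: D_def brownian_motionD(3)[OF bm])
    then show ?case by (simp add: H_def emeasure_space_1)
  next
    case (Suc K)
    let ?I = "\<integral>\<^sup>+\<omega>. ennreal (f (B (real K * h) \<omega>)) * indicator (D (Suc K)) \<omega> \<partial>M"
    have DS: "\<omega> \<in> D (Suc K) \<longleftrightarrow> \<omega> \<in> {\<omega>. \<forall>i\<le>K. B (real i * h) \<omega> \<in> G}" if "\<omega> \<in> space M" for \<omega>
      using that by (auto simp: D_def less_Suc_eq_le)
    have "R (Suc K) = (\<integral>\<^sup>+\<omega>. ennreal (f (B (real (Suc K) * h) \<omega>)) * indicator {\<omega>. \<forall>i\<le>K. B (real i * h) \<omega> \<in> G} \<omega> \<partial>M)"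
      unfolding R_def by (intro nn_integral_cong) (simp add: DS indicator_def)
    also have "\<dots> \<le> (\<integral>\<^sup>+\<omega>. (ennreal (f (B (real K * h) \<omega>)) + ennreal e) * indicator {\<omega>. \<forall>i\<le>K. B (real i * h) \<omega> \<in> G} \<omega> \<partial>M)"
      by (rule grid_markov[OF bm h f G st])
    also have "\<dots> \<le> (\<integral>\<^sup>+\<omega>. ennreal (f (B (real K * h) \<omega>)) * indicator (D (Suc K)) \<omega> + ennreal e \<partial>M)"
      by (intro nn_integral_mono) (auto simp: DS indicator_def)
    also have "\<dots> = ?I + ennreal e"
      by (subst nn_integral_add) (auto simp: emeasure_space_1)
    finally have 1: "R (Suc K) \<le> ?I + ennreal e" .
    have "emeasure M (Q K) + ?I = (\<integral>\<^sup>+\<omega>. indicator (Q K) \<omega> + ennreal (f (B (real K * h) \<omega>)) * indicator (D (Suc K)) \<omega> \<partial>M)"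
      by (subst nn_integral_add) auto
    also have "\<dots> \<le> R K"
      unfolding R_def
    proof (intro nn_integral_mono)
      fix \<omega> assume "\<omega> \<in> space M"
      show "indicator (Q K) \<omega> + ennreal (f (B (real K * h) \<omega>)) * indicator (D (Suc K)) \<omega>
        \<le> ennreal (f (B (real K * h) \<omega>)) * indicator (D K) \<omega>"
        using f1[of "B (real K * h) \<omega>"] by (auto simp: indicator_def Q_def D_def G_def less_Suc_eq)
    qed
    finally have 2: "emeasure M (Q K) + ?I \<le> R K" .
    have "H (Suc K) = H K \<union> Q K" unfolding H_def by (auto simp: less_Suc_eq)
    then have "emeasure M (H (Suc K)) \<le> emeasure M (H K) + emeasure M (Q K)"
      by (simp add: emeasure_subadditive)
    then have "emeasure M (H (Suc K)) + R (Suc K) \<le> (emeasure M (H K) + emeasure M (Q K)) + (?I + ennreal e)"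
      using 1 by (rule add_mono)
    also have "\<dots> = emeasure M (H K) + (emeasure M (Q K) + ?I) + ennreal e" by (simp add: ac_simps)
    also have "\<dots> \<le> emeasure M (H K) + R K + ennreal e" by (intro add_mono 2 order_refl)
    also have "\<dots> \<le> ennreal (f y + real K * e) + ennreal e" by (intro add_mono Suc.IH order_refl)
    also have "\<dots> = ennreal (f y + real (Suc K) * e)"
      using f0 e0 by (simp flip: ennreal_plus add: algebra_simps)
    finally show ?case .
  qed
  have "{\<omega> \<in> space M. \<exists>k<K. B (real k * h) \<omega> \<in> S \<and> (\<forall>i<k. B (real i * h) \<omega> \<notin> A)} \<subseteq> H K"
  proof clarsimp
    fix \<omega> k assume w: "\<omega> \<in> space M" "k < K" "B (real k * h) \<omega> \<in> S" "\<forall>i<k. B (real i * h) \<omega> \<notin> A"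
    \<comment> \<open>The sets \<open>Q\<close> record first visits to \<open>S\<close>, so the
      given visit at \<open>k\<close> is replaced by the earliest one.\<close>
    define l where "l = (LEAST l. B (real l * h) \<omega> \<in> S)"
    have l: "B (real l * h) \<omega> \<in> S" "l \<le> k" unfolding l_def using w(3) by (auto intro: LeastI Least_le)
    have "B (real i * h) \<omega> \<notin> S" if "i < l" for i using that not_less_Least unfolding l_def by blast
    then have "\<omega> \<in> Q l" using l w unfolding Q_def D_def G_def by auto
    then show "\<omega> \<in> H K" unfolding H_def using l w by auto
  qed
  then have "emeasure M {\<omega> \<in> space M. \<exists>k<K. B (real k * h) \<omega> \<in> S \<and> (\<forall>i<k. B (real i * h) \<omega> \<notin> A)} \<le> emeasure M (H K)"
    by (intro emeasure_mono) auto
  also have "\<dots> \<le> emeasure M (H K) + R K" by simp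
  also note main[of K]
  finally show ?thesis by (simp add: e_def)
qed

text \<open>Up to a fixed time the accumulated grid error is of order \<open>sqrt (h i)\<close> and
  disappears in the limit. A path that reaches the open set \<open>S\<close> while avoiding the
  closed set \<open>A\<close> stays in \<open>S - A\<close> for a short while longer, so every
  sufficiently fine grid notices it. A measurable \<open>N\<close> containing all such paths is
  produced, which avoids proving that the continuous-time event itself is measurable.\<close>

lemma hit_before_bound:
  fixes f :: "'a::euclidean_space \<Rightarrow> real"
  assumes bm: "brownian_motion y M B"
    and f: "f \<in> borel_measurable borel" and A: "closed A" and S: "open S"
    and f0: "\<And>x. 0 \<le> f x" and fB: "\<And>x. f x \<le> b" and C: "C \<ge> 0"
    and step: "\<And>x. x \<notin> A \<Longrightarrow> step_le f x 0 C"
    and f1: "\<And>x. x \<in> S \<Longrightarrow> 1 \<le> f x"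
  shows "\<exists>N\<in>sets M. emeasure M N \<le> ennreal (f y) \<and>
    (\<forall>\<omega>\<in>space M. \<forall>t\<ge>0. B t \<omega> \<in> S \<longrightarrow> (\<forall>s\<in>{0..t}. B s \<omega> \<notin> A) \<longrightarrow> \<omega> \<in> N)"
proof -
  interpret prob_space M by (rule brownian_motionD[OF bm])
  define h where "h i = 1 / real (Suc i)" for i
  have h: "h i > 0" for i unfolding h_def by simp
  have AS[measurable]: "A \<in> sets borel" "S \<in> sets borel" using A S by auto
  have Bm[measurable]: "B (real k * h i) \<in> borel_measurable M" for k i
    using brownian_motionD(2)[OF bm] h[of i] by simp
  define H where "H i T = {\<omega> \<in> space M. \<exists>k<T * Suc i. B (real k * h i) \<omega> \<in> S \<and> (\<forall>j<k. B (real j * h i) \<omega> \<notin> A)}" for i T :: nat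
  have Hm[measurable]: "H i T \<in> sets M" for i T unfolding H_def by measurable
  have Hle: "emeasure M (H i T) \<le> ennreal (f y + real T * C * sqrt (h i))" for i T
  proof -
    have "real (T * Suc i) * (C * h i * sqrt (h i)) = real T * C * sqrt (h i)"
      by (simp add: h_def field_simps)
    then show ?thesis
      using grid_hit_bound[where K="T * Suc i", OF bm h[of i] f AS f0 fB C step f1]
      unfolding H_def by metis
  qed
  have Hmono: "H i T \<subseteq> H i T'" if "T \<le> T'" for i T T'
    using mult_le_mono1[OF that, of "Suc i"] unfolding H_def by (blast intro: less_le_trans)
  \<comment> \<open>The index \<open>n\<close> is both the time horizon and the first grid
    considered. Thus \<open>N\<close> is increasing, while each \<open>N n\<close> is contained in
    infinitely many grid events with the same horizon, whose bounds tend to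
    \<open>f y\<close>.\<close>
  define N where "N n = (\<Inter>i\<in>{n..}. H i n)" for n
  have Nm[measurable]: "N n \<in> sets M" for n unfolding N_def by (intro sets.countable_INT') auto
  have Nle: "emeasure M (N n) \<le> ennreal (f y)" for n
  proof (rule LIMSEQ_le_const)
    have "(\<lambda>i. sqrt (h i)) \<longlonglongrightarrow> sqrt 0"
      unfolding h_def by (intro tendsto_intros LIMSEQ_Suc[OF lim_1_over_n])
    then have "(\<lambda>i. f y + real n * C * sqrt (h i)) \<longlonglongrightarrow> f y + real n * C * sqrt 0"
      by (rule tendsto_add[OF tendsto_const tendsto_mult[OF tendsto_const]])
    then show "(\<lambda>i. ennreal (f y + real n * C * sqrt (h i))) \<longlonglongrightarrow> ennreal (f y)"
      by (intro tendsto_ennrealI) simp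
    have "emeasure M (N n) \<le> emeasure M (H i n)" if "i \<ge> n" for i
      using that by (intro emeasure_mono) (auto simp: N_def)
    then show "\<exists>k. \<forall>i\<ge>k. emeasure M (N n) \<le> ennreal (f y + real n * C * sqrt (h i))"
      using Hle order_trans by blast
  qed
  have inc: "incseq N"
  proof (rule incseq_SucI)
    fix n show "N n \<subseteq> N (Suc n)" unfolding N_def using Hmono[of n "Suc n"] by fastforce
  qed
  have "emeasure M (\<Union>n. N n) = (SUP n. emeasure M (N n))"
    using inc by (subst SUP_emeasure_incseq) auto
  also have "\<dots> \<le> ennreal (f y)" by (rule SUP_least) (rule Nle)
  finally have le: "emeasure M (\<Union>n. N n) \<le> ennreal (f y)" .
  moreover have "\<omega> \<in> (\<Union>n. N n)" if w: "\<omega> \<in> space M" and t: "0 \<le> t" "B t \<omega> \<in> S" "\<forall>s\<in>{0..t}. B s \<omega> \<notin> A" for \<omega> t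
  proof -
    have "continuous (at t within {0..}) (\<lambda>t. B t \<omega>)"
      using brownian_motionD(4)[OF bm w] t(1) by (simp add: continuous_on_eq_continuous_within)
    moreover have "open (S - A)" using S A by auto
    moreover have "B t \<omega> \<in> S - A" using t by auto
    ultimately have "\<forall>\<^sub>F s in at t within {0..}. B s \<omega> \<in> S - A"
      unfolding continuous_within by (rule topological_tendstoD)
    then obtain e where e: "e > 0" "\<And>s. s \<in> {0..} \<Longrightarrow> s \<noteq> t \<Longrightarrow> dist s t < e \<Longrightarrow> B s \<omega> \<in> S - A"
      unfolding eventually_at by blast
    have e': "B s \<omega> \<in> S - A" if "t \<le> s" "s < t + e" for s
      using that e t by (cases "s = t") (auto simp: dist_real_def)
    obtain n where n: "real n > max (1 / e) (t + e)" using reals_Archimedean2 by blast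
    have "\<omega> \<in> H i n" if "i \<ge> n" for i
    proof -
      have "1 / e < real (Suc i)" using n that by simp
      then have hi: "h i < e" using e(1) unfolding h_def by (simp add: field_simps)
      \<comment> \<open>The first grid time at or after \<open>t\<close>. As the mesh is below
        \<open>e\<close>, it lies before \<open>t + e\<close>, where the path is still in
        \<open>S - A\<close>.\<close>
      define k where "k = nat \<lceil>t / h i\<rceil>"
      have "t / h i \<le> real k" unfolding k_def by (rule real_nat_ceiling_ge)
      then have k1: "real k * h i \<ge> t"
        using h[of i] by (simp add: pos_divide_le_eq)
      have "real k < t / h i + 1" using t(1) h[of i] unfolding k_def
        by (simp add: ceiling_correct) linarith
      then have k2: "real k * h i < t + e" using h[of i] hi by (simp add: field_simps)
      have "real k * h i < real n" using k2 n by simp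
      then have "k < n * Suc i" unfolding h_def by (simp add: field_simps flip: of_nat_mult of_nat_Suc of_nat_add)
      moreover have "B (real j * h i) \<omega> \<notin> A" if "j < k" for j
      proof (cases "real j * h i \<le> t")
        case True then show ?thesis using t(3) h[of i] by simp
      next
        case False
        have "real j * h i \<le> real k * h i" using that h[of i] by (intro mult_right_mono) auto
        then show ?thesis using False k2 e'[of "real j * h i"] by simp
      qed
      ultimately show ?thesis using w e'[OF k1 k2] unfolding H_def by blast
    qed
    then show ?thesis unfolding N_def by blast
  qed
  ultimately show ?thesis by (intro bexI[of _ "\<Union>n. N n"]) auto
qed

section \<open>Radial functions\<close>

text \<open>With \<open>p = (x - c) \<bullet> w\<close> the argument of \<psi> changes by
  \<open>2 * p + (norm w)\<^sup>2\<close>. For \<open>norm w \<le> 1\<close> the terms beyond second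
  order in \<open>w\<close> are cubic, with constant \<open>?C1\<close>. For
  \<open>norm w > 1\<close> every term is dominated by \<open>norm w ^ 3\<close>, and the bound
  \<open>M\<close> on \<psi> leads to \<open>?C2\<close>.\<close>

lemma radial_taylor:
  fixes x c w :: "'a::euclidean_space" and \<psi> :: "real \<Rightarrow> real" and a b \<rho> M D K :: real
  defines "u \<equiv> (norm (x - c))\<^sup>2"
  assumes \<rho>: "norm (x - c) \<le> \<rho>" and M: "\<And>v. \<bar>\<psi> v\<bar> \<le> M" and D: "\<bar>a\<bar> \<le> D" "\<bar>b\<bar> \<le> D" and K: "0 \<le> K"
    and T: "\<And>v. 0 \<le> v \<Longrightarrow> \<psi> v \<le> \<psi> u + a * (v - u) + b / 2 * (v - u)\<^sup>2 + K * \<bar>v - u\<bar> ^ 3"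
  shows "\<psi> ((norm (x + w - c))\<^sup>2) \<le> \<psi> u + (2 * a) *\<^sub>R (x - c) \<bullet> w + a * (norm w)\<^sup>2 + (2 * b) * ((x - c) \<bullet> w)\<^sup>2
     + (K * (2 * \<rho> + 1) ^ 3 + D * (2 * \<rho> + 1) + (2 * M + 2 * D * \<rho> + D + 2 * D * \<rho>\<^sup>2)) * norm w ^ 3"
    (is "_ \<le> _ + (?C1 + ?C2) * _")
proof -
  let ?n = "norm w"
  define p where "p = (x - c) \<bullet> w"
  have \<rho>0: "0 \<le> \<rho>" using \<rho> norm_ge_zero order_trans by blast
  have D0: "0 \<le> D" using D(1) by linarith
  have M0: "0 \<le> M" using M[of 0] by linarith
  have p: "\<bar>p\<bar> \<le> \<rho> * ?n"
    unfolding p_def by (rule order_trans[OF Cauchy_Schwarz_ineq2]) (intro mult_right_mono \<rho> norm_ge_zero)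
  have v: "(norm (x + w - c))\<^sup>2 - u = 2 * p + ?n\<^sup>2"
    unfolding u_def p_def power2_norm_eq_inner by (simp add: inner_add_left inner_add_right inner_diff_left inner_diff_right inner_commute)
  let ?v = "(norm (x + w - c))\<^sup>2"
  have C1: "0 \<le> ?C1" using K D0 \<rho>0 by simp
  have C2: "0 \<le> ?C2" using M0 D0 \<rho>0 by simp
  have g: "(2 * a) *\<^sub>R (x - c) \<bullet> w = 2 * a * p" by (simp add: p_def)
  show ?thesis
  proof (cases "?n \<le> 1")
    case True
    have n2: "?n\<^sup>2 \<le> ?n" using True by (simp add: power2_eq_square mult_left_le)
    have n43: "?n ^ 4 \<le> ?n ^ 3" using True by (simp add: power_decreasing)
    have "\<bar>?v - u\<bar> \<le> (2 * \<rho> + 1) * ?n"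
    proof -
      have "\<bar>?v - u\<bar> \<le> 2 * \<bar>p\<bar> + ?n\<^sup>2"
        unfolding v using abs_triangle_ineq[of "2 * p" "?n\<^sup>2"] by (simp add: abs_mult)
      also have "\<dots> \<le> 2 * (\<rho> * ?n) + ?n" using p n2 by linarith
      finally show ?thesis by (simp add: algebra_simps)
    qed
    then have "\<bar>?v - u\<bar> ^ 3 \<le> ((2 * \<rho> + 1) * ?n) ^ 3" by (intro power_mono) auto
    then have k3: "K * \<bar>?v - u\<bar> ^ 3 \<le> K * (2 * \<rho> + 1) ^ 3 * ?n ^ 3"
      using K by (simp add: power_mult_distrib mult_left_mono mult.assoc)
    have "b / 2 * (?v - u)\<^sup>2 = 2 * b * p\<^sup>2 + b * (2 * p * ?n\<^sup>2 + ?n ^ 4 / 2)"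
      unfolding v by (simp add: power2_eq_square power4_eq_xxxx algebra_simps)
    also have "b * (2 * p * ?n\<^sup>2 + ?n ^ 4 / 2) \<le> \<bar>b\<bar> * \<bar>2 * p * ?n\<^sup>2 + ?n ^ 4 / 2\<bar>"
      by (metis abs_ge_self abs_mult)
    also have "\<dots> \<le> D * (2 * (\<rho> * ?n) * ?n\<^sup>2 + ?n ^ 3)"
    proof (intro mult_mono D(2))
      have "\<bar>2 * p * ?n\<^sup>2 + ?n ^ 4 / 2\<bar> \<le> \<bar>2 * p * ?n\<^sup>2\<bar> + \<bar>?n ^ 4 / 2\<bar>" by (rule abs_triangle_ineq)
      also have "\<dots> = 2 * \<bar>p\<bar> * ?n\<^sup>2 + ?n ^ 4 / 2" by (simp add: abs_mult)
      also have "\<dots> \<le> 2 * (\<rho> * ?n) * ?n\<^sup>2 + ?n ^ 3"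
      proof (intro add_mono mult_right_mono mult_left_mono p)
        have "0 \<le> ?n ^ 4" by simp
        then show "?n ^ 4 / 2 \<le> ?n ^ 3" using n43 by linarith
      qed auto
      finally show "\<bar>2 * p * ?n\<^sup>2 + ?n ^ 4 / 2\<bar> \<le> 2 * (\<rho> * ?n) * ?n\<^sup>2 + ?n ^ 3" .
    qed (use D0 in auto)
    also have "\<dots> = D * (2 * \<rho> + 1) * ?n ^ 3" by (simp add: power2_eq_square power3_eq_cube algebra_simps)
    finally have q: "b / 2 * (?v - u)\<^sup>2 \<le> 2 * b * p\<^sup>2 + D * (2 * \<rho> + 1) * ?n ^ 3" by simp
    have "\<psi> ?v \<le> \<psi> u + a * (?v - u) + b / 2 * (?v - u)\<^sup>2 + K * \<bar>?v - u\<bar> ^ 3" by (rule T) simp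
    also have "\<dots> \<le> \<psi> u + a * (?v - u) + (2 * b * p\<^sup>2 + D * (2 * \<rho> + 1) * ?n ^ 3) + K * (2 * \<rho> + 1) ^ 3 * ?n ^ 3"
      by (intro add_mono q k3 order_refl)
    also have "\<dots> = \<psi> u + 2 * a * p + a * ?n\<^sup>2 + 2 * b * p\<^sup>2 + ?C1 * ?n ^ 3"
      unfolding v by (simp add: algebra_simps)
    also have "\<dots> \<le> \<psi> u + 2 * a * p + a * ?n\<^sup>2 + 2 * b * p\<^sup>2 + (?C1 + ?C2) * ?n ^ 3"
      using C2 by (intro add_left_mono mult_right_mono) auto
    finally show ?thesis unfolding g p_def .
  next
    case False
    then have n1: "1 \<le> ?n" by simp
    have n3: "1 \<le> ?n ^ 3" "?n \<le> ?n ^ 3" "?n\<^sup>2 \<le> ?n ^ 3"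
      using n1 power_increasing[of 1 3 ?n] power_increasing[of 2 3 ?n] one_le_power[of ?n 3] by auto
    have 1: "- (2 * D * \<rho> * ?n ^ 3) \<le> 2 * a * p"
    proof -
      have "- (2 * a * p) \<le> 2 * (\<bar>a\<bar> * \<bar>p\<bar>)" using abs_ge_minus_self[of "a * p"] by (simp add: abs_mult)
      also have "\<dots> \<le> 2 * (D * (\<rho> * ?n ^ 3))"
      proof (intro mult_left_mono mult_mono D)
        show "\<bar>p\<bar> \<le> \<rho> * ?n ^ 3" using p mult_left_mono[OF n3(2) \<rho>0] by linarith
      qed (use D0 in auto)
      finally have "- (2 * a * p) \<le> 2 * D * \<rho> * ?n ^ 3" by (simp only: mult.assoc)
      then show ?thesis by linarith
    qed
    have 2: "- (D * ?n ^ 3) \<le> a * ?n\<^sup>2"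
    proof -
      have "- (a * ?n\<^sup>2) \<le> \<bar>a\<bar> * ?n\<^sup>2" using abs_ge_minus_self[of "a * ?n\<^sup>2"] by (simp add: abs_mult)
      also have "\<dots> \<le> D * ?n ^ 3" using n3 D0 by (intro mult_mono D) auto
      finally show ?thesis by simp
    qed
    have 3: "- (2 * D * \<rho>\<^sup>2 * ?n ^ 3) \<le> 2 * b * p\<^sup>2"
    proof -
      have "\<bar>p\<bar>\<^sup>2 \<le> (\<rho> * ?n)\<^sup>2" using p by (intro power_mono) auto
      also have "\<dots> \<le> \<rho>\<^sup>2 * ?n ^ 3" using n3 by (simp add: power_mult_distrib mult_left_mono)
      finally have pp: "p\<^sup>2 \<le> \<rho>\<^sup>2 * ?n ^ 3" by simp
      have "- (2 * b * p\<^sup>2) \<le> 2 * (\<bar>b\<bar> * p\<^sup>2)" using abs_ge_minus_self[of "b * p\<^sup>2"] by (simp add: abs_mult)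
      also have "\<dots> \<le> 2 * (D * (\<rho>\<^sup>2 * ?n ^ 3))" using pp D0 by (intro mult_left_mono mult_mono D) auto
      finally have "- (2 * b * p\<^sup>2) \<le> 2 * D * \<rho>\<^sup>2 * ?n ^ 3" by (simp only: mult.assoc)
      then show ?thesis by linarith
    qed
    have 4: "M * 1 \<le> M * ?n ^ 3" using M0 n3 by (intro mult_left_mono) auto
    have 5: "\<psi> ?v \<le> \<psi> u + 2 * M" using M[of ?v] M[of u] by linarith
    have 6: "0 \<le> ?C1 * ?n ^ 3" using C1 by simp
    have "\<psi> ?v \<le> \<psi> u + 2 * a * p + a * ?n\<^sup>2 + 2 * b * p\<^sup>2 + (?C1 + ?C2) * ?n ^ 3"
      using 1 2 3 4 5 6 unfolding distrib_right by linarith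
    then show ?thesis unfolding g p_def .
  qed
qed

text \<open>If \<open>a\<close> and \<open>b\<close> are the first two derivatives of \<psi> at the
  squared distance, the resulting coefficient is half the Laplacian of the radial function. The
  error constant depends on \<open>x\<close> and \<open>c\<close> only through the bound \<rho>,
  hence is uniform.\<close>

lemma step_le_radial:
  fixes c x :: "'a::euclidean_space" and a b \<rho> M D K :: real
  assumes m: "\<psi> \<in> borel_measurable borel"
    and \<rho>: "norm (x - c) \<le> \<rho>" and M: "\<And>v. \<bar>\<psi> v\<bar> \<le> M" and D: "\<bar>a\<bar> \<le> D" "\<bar>b\<bar> \<le> D" and K: "0 \<le> K"
    and T: "\<And>v. 0 \<le> v \<Longrightarrow> \<psi> v \<le> \<psi> ((norm (x - c))\<^sup>2) + a * (v - (norm (x - c))\<^sup>2)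
       + b / 2 * (v - (norm (x - c))\<^sup>2)\<^sup>2 + K * \<bar>v - (norm (x - c))\<^sup>2\<bar> ^ 3"
  shows "step_le (\<lambda>x. \<psi> ((norm (x - c))\<^sup>2)) x (DIM('a) * a + 2 * (norm (x - c))\<^sup>2 * b)
    ((K * (2 * \<rho> + 1) ^ 3 + D * (2 * \<rho> + 1) + (2 * M + 2 * D * \<rho> + D + 2 * D * \<rho>\<^sup>2)) * 2 * (real DIM('a))\<^sup>2)"
proof -
  have t: "\<psi> ((norm (x + w - c))\<^sup>2) \<le> \<psi> ((norm (x - c))\<^sup>2) + (2 * a) *\<^sub>R (x - c) \<bullet> w + a * (norm w)\<^sup>2
     + (2 * b) * ((x - c) \<bullet> w)\<^sup>2
     + (K * (2 * \<rho> + 1) ^ 3 + D * (2 * \<rho> + 1) + (2 * M + 2 * D * \<rho> + D + 2 * D * \<rho>\<^sup>2)) * norm w ^ 3" for w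
    by (rule radial_taylor[OF \<rho> M D K]) (rule T)
  have "0 \<le> \<rho>" using \<rho> norm_ge_zero order_trans by blast
  moreover have "0 \<le> D" using D(1) by linarith
  moreover have "0 \<le> M" using M[of 0] by linarith
  ultimately have C: "0 \<le> K * (2 * \<rho> + 1) ^ 3 + D * (2 * \<rho> + 1) + (2 * M + 2 * D * \<rho> + D + 2 * D * \<rho>\<^sup>2)"
    using K by simp
  have meas: "(\<lambda>x. \<psi> ((norm (x - c))\<^sup>2)) \<in> borel_measurable borel"
    using m by simp
  have "step_le (\<lambda>x. \<psi> ((norm (x - c))\<^sup>2)) x (DIM('a) * a + 2 * b * (norm (x - c))\<^sup>2)
    ((K * (2 * \<rho> + 1) ^ 3 + D * (2 * \<rho> + 1) + (2 * M + 2 * D * \<rho> + D + 2 * D * \<rho>\<^sup>2)) * 2 * (real DIM('a))\<^sup>2)"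
    by (rule step_le_taylor[OF meas M C t])
  moreover have "2 * b * (norm (x - c))\<^sup>2 = 2 * (norm (x - c))\<^sup>2 * b" by simp
  ultimately show ?thesis by (simp only:)
qed

text \<open>Meant for points where the radial functions vanish: with \<open>C = 0\<close> outside
  the support of a sink, which is nowhere positive, and with \<open>C > 0\<close> outside a bump,
  which grows at most cubically from its zero set.\<close>

lemma step_le_trivial:
  fixes f :: "'a::euclidean_space \<Rightarrow> real"
  assumes "f \<in> borel_measurable borel" "\<And>x. \<bar>f x\<bar> \<le> B" "0 \<le> C" "\<And>w. f (x + w) \<le> f x + C * norm w ^ 3"
  shows "step_le f x 0 (C * 2 * (real DIM('a))\<^sup>2)"
  using step_le_taylor[of f B C x 0 0 0 0] assms by simp

text \<open>Three is the least integer exponent for which the positive part has a Lipschitz second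
  derivative, as a cubic Taylor remainder requires.\<close>

definition cubic_bump :: "real \<Rightarrow> real \<Rightarrow> real" where
  "cubic_bump R u = (max 0 (R - u)) ^ 3"

lemma cubic_bump_measurable [measurable]: "cubic_bump R \<in> borel_measurable borel"
  unfolding cubic_bump_def[abs_def] by measurable

text \<open>One copy of the cube of \<open>\<bar>v - u\<bar>\<close> is the remainder of the exact
  cubic expansion. The second pays for the cut-off beyond \<open>R\<close>, where the polynomial has
  become negative.\<close>

lemma cubic_bump_taylor:
  "cubic_bump R v \<le> cubic_bump R u + (- 3 * (max 0 (R - u))\<^sup>2) * (v - u) + (6 * max 0 (R - u)) / 2 * (v - u)\<^sup>2 + 2 * \<bar>v - u\<bar> ^ 3"
proof (cases "u \<le> R")
  case True
  have e: "(R - v) ^ 3 = (R - u) ^ 3 + (- 3 * (R - u)\<^sup>2) * (v - u) + 3 * (R - u) * (v - u)\<^sup>2 - (v - u) ^ 3"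
    by (simp add: power2_eq_square power3_eq_cube algebra_simps)
  have a: "- ((v - u) ^ 3) \<le> \<bar>v - u\<bar> ^ 3" by (metis abs_ge_minus_self power_abs)
  have m: "max 0 (R - u) = R - u" using True by simp
  have f: "6 * (R - u) / 2 * (v - u)\<^sup>2 = 3 * (R - u) * (v - u)\<^sup>2" by simp
  show ?thesis
    unfolding cubic_bump_def m f
  proof (cases "v \<le> R")
    case True
    have "0 \<le> \<bar>v - u\<bar> ^ 3" by simp
    moreover have "max 0 (R - v) = R - v" using True by simp
    ultimately show "max 0 (R - v) ^ 3 \<le> (R - u) ^ 3 + - 3 * (R - u)\<^sup>2 * (v - u) + 3 * (R - u) * (v - u)\<^sup>2 + 2 * \<bar>v - u\<bar> ^ 3"
      using e a by (simp only:)
  next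
    case False
    have "(v - R) ^ 3 \<le> \<bar>v - u\<bar> ^ 3" using False \<open>u \<le> R\<close> by (intro power_mono) auto
    moreover have "(v - R) ^ 3 = - ((R - v) ^ 3)" by (simp add: power3_eq_cube algebra_simps)
    moreover have "max 0 (R - v) = 0" using False by simp
    ultimately show "max 0 (R - v) ^ 3 \<le> (R - u) ^ 3 + - 3 * (R - u)\<^sup>2 * (v - u) + 3 * (R - u) * (v - u)\<^sup>2 + 2 * \<bar>v - u\<bar> ^ 3"
      using e a by (simp only: power3_eq_cube[of 0] mult_zero_left)
  qed
next
  case False
  have "(max 0 (R - v)) ^ 3 \<le> \<bar>v - u\<bar> ^ 3" using False by (intro power_mono) auto
  moreover have "0 \<le> \<bar>v - u\<bar> ^ 3" by simp
  ultimately have "(max 0 (R - v)) ^ 3 \<le> 2 * \<bar>v - u\<bar> ^ 3" by linarith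
  then show ?thesis using False by (simp add: cubic_bump_def)
qed

text \<open>Inside the support the contribution of the first derivative is negative and is dropped;
  that of the second is \<open>2 * u * 6 * (R - u)\<close>, at most \<open>12 * R\<^sup>2\<close>.
  Outside, the new value is at most \<open>(2 * sqrt R * norm w) ^ 3\<close>, so no drift
  arises.\<close>

lemma step_le_cubic_bump:
  assumes R: "0 < R"
  shows "\<exists>C\<ge>0. \<forall>x c :: 'a::euclidean_space. step_le (\<lambda>x. min (cubic_bump R ((norm (x - c))\<^sup>2)) (R ^ 3)) x (if (norm (x - c))\<^sup>2 < R then 12 * R\<^sup>2 else 0) C"
proof -
  \<comment> \<open>The \<open>min\<close> changes nothing for \<open>u \<ge> 0\<close>; it only
    makes the profile bounded on the whole line, as \<open>step_le_radial\<close> demands.\<close>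
  let ?f = "\<lambda>u. min (cubic_bump R u) (R ^ 3)"
  have meas: "?f \<in> borel_measurable borel" by measurable
  have bound: "\<bar>?f u\<bar> \<le> R ^ 3" for u using R by (auto simp: cubic_bump_def)
  have eq: "?f u = cubic_bump R u" if "0 \<le> u" for u
    using that R by (auto simp: cubic_bump_def intro!: power_mono min_absorb1)
  define D where "D = 3 * R\<^sup>2 + 6 * R"
  define \<rho> where "\<rho> = sqrt R"
  define C1 where "C1 = (2 * (2 * \<rho> + 1) ^ 3 + D * (2 * \<rho> + 1) + (2 * R ^ 3 + 2 * D * \<rho> + D + 2 * D * \<rho>\<^sup>2)) * 2 * (real DIM('a))\<^sup>2"
  define C2 where "C2 = (2 * \<rho>) ^ 3 * 2 * (real DIM('a))\<^sup>2"
  have pos: "0 \<le> C1" "0 \<le> C2" unfolding C1_def C2_def D_def \<rho>_def using R by auto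
  have "step_le (\<lambda>x. ?f ((norm (x - c))\<^sup>2)) x (if (norm (x - c))\<^sup>2 < R then 12 * R\<^sup>2 else 0) (C1 + C2)" for x c :: 'a
  proof (cases "(norm (x - c))\<^sup>2 < R")
    case True
    let ?u = "(norm (x - c))\<^sup>2"
    let ?a = "- 3 * (max 0 (R - ?u))\<^sup>2" and ?b = "6 * max 0 (R - ?u)"
    have u0: "0 \<le> ?u" by simp
    have m: "max 0 (R - ?u) = R - ?u" "0 \<le> R - ?u" "R - ?u \<le> R" using True u0 by (simp_all only: max_def) auto
    have m2: "(R - ?u)\<^sup>2 \<le> R\<^sup>2" using m by (intro power_mono) auto
    have "\<bar>?a\<bar> \<le> D" unfolding m D_def using m2 R by simp
    moreover have "\<bar>?b\<bar> \<le> D"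
    proof -
      have "\<bar>6 * (R - ?u)\<bar> = 6 * (R - ?u)" using m(2) by simp
      also have "\<dots> \<le> 6 * R" using m(3) by (intro mult_left_mono) auto
      also have "\<dots> \<le> D" unfolding D_def by simp
      finally show ?thesis unfolding m .
    qed
    moreover have "norm (x - c) \<le> \<rho>" unfolding \<rho>_def using True by (simp add: real_le_rsqrt)
    moreover have "?f v \<le> ?f ?u + ?a * (v - ?u) + ?b / 2 * (v - ?u)\<^sup>2 + 2 * \<bar>v - ?u\<bar> ^ 3" if "0 \<le> v" for v
      unfolding eq[OF that] eq[OF u0] by (rule cubic_bump_taylor)
    ultimately have "step_le (\<lambda>x. ?f ((norm (x - c))\<^sup>2)) x (DIM('a) * ?a + 2 * ?u * ?b) C1"
      unfolding C1_def by (intro step_le_radial[OF meas _ bound]) auto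
    moreover have "DIM('a) * ?a + 2 * ?u * ?b \<le> 12 * R\<^sup>2"
    proof -
      have "2 * ?u * ?b \<le> 12 * (R * R)"
        using mult_mono[of ?u R "R - ?u" R] m True u0 R unfolding m by (simp add: algebra_simps)
      moreover have "DIM('a) * ?a \<le> 0" by (simp add: mult_nonneg_nonpos)
      ultimately show ?thesis unfolding power2_eq_square[of R] by linarith
    qed
    ultimately have "step_le (\<lambda>x. ?f ((norm (x - c))\<^sup>2)) x (12 * R\<^sup>2) (C1 + C2)"
      using pos by (elim step_le_mono) auto
    then show ?thesis using True by simp
  next
    case False
    have "step_le (\<lambda>x. ?f ((norm (x - c))\<^sup>2)) x 0 C2"
      unfolding C2_def
    proof (rule step_le_trivial)
      fix w
      let ?n = "norm (x + w - c)"
      have fx: "?f ((norm (x - c))\<^sup>2) = 0" using False R by (simp add: cubic_bump_def)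
      have rx: "\<rho> \<le> norm (x - c)" unfolding \<rho>_def using False by (simp add: real_le_lsqrt not_less)
      have "max 0 (R - ?n\<^sup>2) \<le> 2 * \<rho> * norm w"
      proof (cases "?n \<le> \<rho>")
        case True
        have "norm (x - c) \<le> ?n + norm w" using norm_triangle_ineq4[of "x + w - c" w] by (simp add: algebra_simps)
        then have "\<rho> - ?n \<le> norm w" using rx by simp
        moreover have "R - ?n\<^sup>2 = (\<rho> + ?n) * (\<rho> - ?n)" unfolding \<rho>_def using R by (simp add: power2_eq_square algebra_simps)
        moreover have "(\<rho> + ?n) * (\<rho> - ?n) \<le> (2 * \<rho>) * norm w"
          using True calculation(1) rx by (intro mult_mono) (auto simp: \<rho>_def R less_imp_le)
        ultimately show ?thesis using R by (auto simp: \<rho>_def)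
      next
        case False
        then have "R \<le> ?n\<^sup>2" unfolding \<rho>_def using R by (metis less_imp_le linorder_not_le real_sqrt_le_iff real_sqrt_abs abs_norm_cancel)
        then show ?thesis using R by (auto simp: \<rho>_def)
      qed
      then have "(max 0 (R - ?n\<^sup>2)) ^ 3 \<le> (2 * \<rho> * norm w) ^ 3" by (intro power_mono) auto
      then show "?f ((norm (x + w - c))\<^sup>2) \<le> ?f ((norm (x - c))\<^sup>2) + (2 * \<rho>) ^ 3 * norm w ^ 3"
        unfolding fx by (auto simp: cubic_bump_def power_mult_distrib min_le_iff_disj)
    qed (use meas bound R in \<open>auto simp: \<rho>_def\<close>)
    then show ?thesis using False pos by (simp add: step_le_mono)
  qed
  then show ?thesis using pos by (intro exI[of _ "C1 + C2"]) auto
qed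

section \<open>The profile of a single bubble\<close>

text \<open>
  For \<open>q = d / 2\<close> and \<open>u\<close> the squared distance to the centre of the bubble, \<open>sink_base q u\<close> is a
  harmonic function with derivative \<open>u powr - q\<close>.  The primitive \<open>sink_prim\<close> has derivative
  \<open>u powr - q * (1 - (u / R) powr q)\<^sup>2\<close>, whose double zero at \<open>R\<close> makes the truncation in
  \<open>sink\<close> smooth enough from above; the truncation at \<open>u0\<close> happens strictly inside the bubble.
\<close>

definition sink_base :: "real \<Rightarrow> real \<Rightarrow> real" where
  "sink_base q u = (if q = 1 then ln u else - (u powr (1 - q) / (q - 1)))"

definition sink_prim :: "real \<Rightarrow> real \<Rightarrow> real \<Rightarrow> real" where
  "sink_prim q R u = sink_base q u - 2 * u * R powr - q + u powr (q + 1) / (q + 1) * R powr (- 2 * q)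
     - (sink_base q R - 2 * R powr (1 - q) + R powr (1 - q) / (q + 1))"

definition sink1 :: "real \<Rightarrow> real \<Rightarrow> real \<Rightarrow> real" where
  "sink1 q R u = u powr - q - 2 * R powr - q + u powr q * R powr (- 2 * q)"

definition sink2 :: "real \<Rightarrow> real \<Rightarrow> real \<Rightarrow> real" where
  "sink2 q R u = - q * u powr (- q - 1) + q * u powr (q - 1) * R powr (- 2 * q)"

definition sink3 :: "real \<Rightarrow> real \<Rightarrow> real \<Rightarrow> real" where
  "sink3 q R u = q * (q + 1) * u powr (- q - 2) + q * (q - 1) * u powr (q - 2) * R powr (- 2 * q)"

definition sink :: "real \<Rightarrow> real \<Rightarrow> real \<Rightarrow> real \<Rightarrow> real" where
  "sink q R u0 u = min (sink_prim q R (max u u0)) 0"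

lemma sink_base_deriv: "0 < u \<Longrightarrow> (sink_base q has_real_derivative u powr - q) (at u)"
proof (cases "q = 1")
  case True
  assume "0 < u"
  then have "(ln has_real_derivative u powr - 1) (at u)"
    by (auto intro!: derivative_eq_intros simp: powr_minus_divide)
  then show ?thesis using True by (simp add: sink_base_def[abs_def])
next
  case False
  assume u: "0 < u"
  have "((\<lambda>u. - (u powr (1 - q) / (q - 1))) has_real_derivative - ((1 - q) * u powr (1 - q - 1) / (q - 1))) (at u)"
    using u by (intro DERIV_minus DERIV_cdivide has_real_derivative_powr)
  moreover have "- ((1 - q) * u powr (1 - q - 1) / (q - 1)) = u powr - q" using False by (simp add: field_simps)
  ultimately show ?thesis using False by (simp add: sink_base_def[abs_def])
qed

lemma sink_prim_deriv:
  assumes u: "0 < u" and q: "1 \<le> q"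
  shows "(sink_prim q R has_real_derivative sink1 q R u) (at u)"
proof -
  have "((\<lambda>u. sink_base q u - 2 * u * R powr - q + u powr (q + 1) / (q + 1) * R powr (- 2 * q)
     - (sink_base q R - 2 * R powr (1 - q) + R powr (1 - q) / (q + 1))) has_real_derivative
     u powr - q - 2 * R powr - q + (q + 1) * u powr (q + 1 - 1) / (q + 1) * R powr (- 2 * q) - 0) (at u)"
    using u by (intro DERIV_diff DERIV_add sink_base_deriv DERIV_const)
      (auto intro!: derivative_eq_intros)
  then show ?thesis using q by (simp add: sink_prim_def[abs_def] sink1_def)
qed

lemma sink1_deriv: "0 < u \<Longrightarrow> (sink1 q R has_real_derivative sink2 q R u) (at u)"
  unfolding sink1_def[abs_def] sink2_def
  by (auto intro!: derivative_eq_intros simp: powr_diff field_simps)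

lemma sink2_deriv: "0 < u \<Longrightarrow> (sink2 q R has_real_derivative sink3 q R u) (at u)"
  unfolding sink2_def[abs_def] sink3_def
  by (auto intro!: derivative_eq_intros simp: algebra_simps)

lemma sink1_eq:
  assumes "0 < u" "0 < R" shows "sink1 q R u = u powr - q * (1 - (u / R) powr q)\<^sup>2"
proof -
  have "u powr - q * u powr q = 1" using assms by (simp add: powr_minus)
  moreover have "R powr - q * R powr q = 1" using assms by (simp add: powr_minus)
  moreover have "R powr (- 2 * q) = R powr - q * R powr - q" by (simp flip: powr_add)
  moreover have "(u / R) powr q = u powr q * R powr - q" using assms by (simp add: powr_divide powr_minus_divide)
  ultimately show ?thesis unfolding sink1_def power2_eq_square by algebra
qed

text \<open>For \<open>2 * q\<close> equal to the dimension the left side is half the Laplacian. The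
  singular part \<open>u powr - q\<close> belongs to a harmonic function and cancels, so the drift
  is bounded by a multiple of \<open>R powr - q\<close>, no matter how small the bubble is.\<close>

lemma sink_generator_eq:
  assumes u: "0 < u" "0 < R" shows "2 * q * sink1 q R u + 2 * u * sink2 q R u = - 4 * q * R powr - q * (1 - (u / R) powr q)"
proof -
  have "u * u powr (- q - 1) = u powr - q" using u by (simp add: powr_diff)
  moreover have "u * u powr (q - 1) = u powr q" using u by (simp add: powr_diff)
  moreover have "R powr (- 2 * q) = R powr - q * R powr - q" by (simp flip: powr_add)
  moreover have "(u / R) powr q = u powr q * R powr - q" using assms by (simp add: powr_divide powr_minus_divide)
  ultimately have e: "u * u powr (- q - 1) = u powr - q" "u * u powr (q - 1) = u powr q"
    "R powr (- 2 * q) = R powr - q * R powr - q" "(u / R) powr q = u powr q * R powr - q" by auto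
  have "2 * q * sink1 q R u + 2 * u * sink2 q R u =
     2 * q * (u powr - q - 2 * R powr - q + u powr q * R powr (- 2 * q)) +
     2 * q * (u * u powr (q - 1) * R powr (- 2 * q) - u * u powr (- q - 1))"
    unfolding sink1_def sink2_def by (simp add: algebra_simps)
  then show ?thesis unfolding e by (simp add: algebra_simps)
qed

lemma sink_prim_mono:
  assumes "0 < u" "u \<le> v" "0 < R" "1 \<le> q" shows "sink_prim q R u \<le> sink_prim q R v"
proof (rule DERIV_nonneg_imp_nondecreasing[OF assms(2)])
  fix x assume "u \<le> x" "x \<le> v"
  then show "\<exists>y. (sink_prim q R has_real_derivative y) (at x) \<and> 0 \<le> y"
    using assms sink_prim_deriv[of x q R] sink1_eq[of x R q] by (intro exI[of _ "sink1 q R x"]) auto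
qed

lemma sink_prim_zero: 
  assumes "0 < R" shows "sink_prim q R R = 0"
proof -
  have "R * R powr - q = R powr (1 - q)" using assms by (simp add: powr_diff powr_minus divide_inverse)
  moreover have "R powr (q + 1) * R powr (- 2 * q) = R powr (1 - q)" by (simp flip: powr_add)
  ultimately show ?thesis unfolding sink_prim_def by (simp add: mult.assoc)
qed

lemma sink_measurable [measurable]: "sink q R u0 \<in> borel_measurable borel"
  unfolding sink_def[abs_def] sink_prim_def sink_base_def by measurable

lemma sink_bounds:
  assumes "0 < u0" "0 < R" "1 \<le> q" "u0 \<le> R"
  shows "sink_prim q R u0 \<le> sink q R u0 u" "sink q R u0 u \<le> 0" "R \<le> u \<Longrightarrow> sink q R u0 u = 0"
    "u0 \<le> u \<Longrightarrow> u \<le> R \<Longrightarrow> sink q R u0 u = sink_prim q R u"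
proof -
  have z: "sink_prim q R u0 \<le> 0" using sink_prim_mono[of u0 R R q] sink_prim_zero[of R q] assms by simp
  have m: "sink_prim q R u0 \<le> sink_prim q R (max u u0)" using sink_prim_mono[of u0 "max u u0" R q] assms by simp
  show "sink_prim q R u0 \<le> sink q R u0 u" "sink q R u0 u \<le> 0" using z m by (auto simp: sink_def)
  show "sink q R u0 u = 0" if "R \<le> u"
    using sink_prim_mono[of R "max u u0" R q] sink_prim_zero[of R q] assms that by (simp add: sink_def)
  show "sink q R u0 u = sink_prim q R u" if "u0 \<le> u" "u \<le> R"
    using sink_prim_mono[of u R R q] sink_prim_zero[of R q] assms that by (simp add: sink_def)
qed

text \<open>For \<open>q > 1\<close> the term \<open>- sink_base q R\<close> is positive and absorbs
  the remaining normalising constants. In the logarithmic case this fails, and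
  \<open>ln R + 1\<close> is left over.\<close>

lemma sink_prim_lower:
  assumes "0 < u0" "u0 \<le> R" "1 \<le> q"
  shows "sink_base q u0 - (if q = 1 then ln R + 1 else 0) \<le> sink_prim q R u0"
proof -
  have R: "0 < R" using assms by simp
  have 1: "u0 * R powr - q \<le> R powr (1 - q)"
  proof -
    have "R powr (1 - q) = R * R powr - q" using R by (simp add: powr_diff powr_minus divide_inverse)
    then show ?thesis using assms by (simp add: mult_right_mono)
  qed
  have 2: "0 \<le> u0 powr (q + 1) / (q + 1) * R powr (- 2 * q)" using assms by simp
  show ?thesis
  proof (cases "q = 1")
    case True
    have e: "R powr (1 - q) = 1" "q + 1 = 2" using R True by simp_all
    show ?thesis
      using 1 2 unfolding sink_prim_def sink_base_def if_P[OF True] e by linarith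
  next
    case False
    then have q: "1 < q" using assms by simp
    have "R powr (1 - q) / (q + 1) \<le> R powr (1 - q) / (q - 1)"
      using q by (intro divide_left_mono) auto
    then show ?thesis using 1 2 False unfolding sink_prim_def sink_base_def by simp
  qed
qed

text \<open>For \<open>u \<ge> R\<close> the profile has its maximal value 0 and
  \<open>a = b = 0\<close> works. For \<open>u < R\<close> Taylor's theorem applies to
  \<open>sink_prim\<close> on \<open>{u0..2 * R}\<close>, and the profile lies below
  \<open>sink_prim\<close> there. The margin between \<open>u0\<close> and \<open>4 * u0\<close>
  keeps \<open>D\<close> and \<open>K\<close> uniform in \<open>u\<close>. If
  \<open>4 * u \<le> R\<close>, then \<open>(u / R) powr q \<le> 1 / 4\<close>, which leaves three
  quarters of the drift in \<open>sink_generator_eq\<close>.\<close>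

lemma sink_taylor:
  assumes u0: "0 < u0" "4 * u0 < R" and q: "1 \<le> q"
  shows "\<exists>D\<ge>0. \<exists>K\<ge>0. \<forall>u\<ge>4 * u0. \<exists>a b. \<bar>a\<bar> \<le> D \<and> \<bar>b\<bar> \<le> D \<and> (R \<le> u \<longrightarrow> a = 0 \<and> b = 0) \<and>
    2 * q * a + 2 * u * b \<le> 0 \<and> (4 * u \<le> R \<longrightarrow> 2 * q * a + 2 * u * b \<le> - 3 * q * R powr - q) \<and>
    (\<forall>v\<ge>0. sink q R u0 v \<le> sink q R u0 u + a * (v - u) + b / 2 * (v - u)\<^sup>2 + K * \<bar>v - u\<bar> ^ 3)"
proof -
  have R: "0 < R" "u0 \<le> R" using u0 by auto
  have bdd: "\<exists>B\<ge>0. \<forall>x\<in>{u0..2 * R}. \<bar>f x\<bar> \<le> B" if "continuous_on {u0..2 * R} f" for f :: "real \<Rightarrow> real"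
  proof -
    have "bounded (f ` {u0..2 * R})" using that compact_continuous_image compact_imp_bounded compact_Icc by blast
    then obtain B where B: "0 < B" "\<forall>x\<in>f ` {u0..2 * R}. norm x \<le> B" using bounded_pos by blast
    then show ?thesis by (intro exI[of _ B]) auto
  qed
  have "continuous_on {u0..2 * R} (sink_prim q R)" 
    by (rule continuous_at_imp_continuous_on) (use u0 q in \<open>auto intro!: DERIV_isCont sink_prim_deriv\<close>)
  from bdd[OF this] obtain D0 where D0: "0 \<le> D0" "\<And>x. x \<in> {u0..2 * R} \<Longrightarrow> \<bar>sink_prim q R x\<bar> \<le> D0" by blast
  have "continuous_on {u0..2 * R} (sink1 q R)" 
    by (rule continuous_at_imp_continuous_on) (use u0 q in \<open>auto intro!: DERIV_isCont sink1_deriv\<close>)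
  from bdd[OF this] obtain D1 where D1: "0 \<le> D1" "\<And>x. x \<in> {u0..2 * R} \<Longrightarrow> \<bar>sink1 q R x\<bar> \<le> D1" by blast
  have "continuous_on {u0..2 * R} (sink2 q R)" 
    by (rule continuous_at_imp_continuous_on) (use u0 q in \<open>auto intro!: DERIV_isCont sink2_deriv\<close>)
  from bdd[OF this] obtain D2 where D2: "0 \<le> D2" "\<And>x. x \<in> {u0..2 * R} \<Longrightarrow> \<bar>sink2 q R x\<bar> \<le> D2" by blast
  have "continuous_on {u0..2 * R} (sink3 q R)" 
    unfolding sink3_def[abs_def] using u0 by (intro continuous_intros) auto
  from bdd[OF this] obtain D3 where D3: "0 \<le> D3" "\<And>x. x \<in> {u0..2 * R} \<Longrightarrow> \<bar>sink3 q R x\<bar> \<le> D3" by blast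
  have tay: "sink_prim q R v \<le> sink_prim q R u + sink1 q R u * (v - u) + sink2 q R u / 2 * (v - u)\<^sup>2 + D3 * \<bar>v - u\<bar> ^ 3"
    if u: "u \<in> {u0..2 * R}" and v: "v \<in> {u0..2 * R}" for u v
  proof (cases "v = u")
    case True then show ?thesis by simp
  next
    case False
    define df where "df = (\<lambda>m::nat. if m = 0 then sink_prim q R else if m = 1 then sink1 q R else if m = 2 then sink2 q R else sink3 q R)"
    have "\<exists>t. (if v < u then v < t \<and> t < u else u < t \<and> t < v) \<and>
      sink_prim q R v = (\<Sum>m<3. df m u / fact m * (v - u) ^ m) + df 3 t / fact 3 * (v - u) ^ 3"
    proof (rule Taylor[where a=u0 and b="2 * R"])
      show "\<forall>m t. m < 3 \<and> u0 \<le> t \<and> t \<le> 2 * R \<longrightarrow> (df m has_real_derivative df (Suc m) t) (at t)"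
      proof (intro allI impI)
        fix m :: nat and t assume *: "m < 3 \<and> u0 \<le> t \<and> t \<le> 2 * R"
        then have t: "0 < t" using u0 by simp
        consider "m = 0" | "m = 1" | "m = 2" using * by linarith
        then show "(df m has_real_derivative df (Suc m) t) (at t)"
          by cases (simp_all add: df_def sink_prim_deriv sink1_deriv sink2_deriv t q)
      qed
    qed (use u v False in \<open>auto simp: df_def\<close>)
    then obtain t where t: "if v < u then v < t \<and> t < u else u < t \<and> t < v"
      and e: "sink_prim q R v = (\<Sum>m<3. df m u / fact m * (v - u) ^ m) + df 3 t / fact 3 * (v - u) ^ 3" by blast
    have "t \<in> {u0..2 * R}" using t u v by (auto split: if_splits)
    from D3(2)[OF this] have "\<bar>sink3 q R t / 6 * (v - u) ^ 3\<bar> \<le> D3 * \<bar>v - u\<bar> ^ 3"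
      unfolding abs_mult power_abs by (intro mult_right_mono) auto
    then have "sink3 q R t / 6 * (v - u) ^ 3 \<le> D3 * \<bar>v - u\<bar> ^ 3" by linarith
    moreover have "sink_prim q R v = sink_prim q R u + sink1 q R u * (v - u) + sink2 q R u / 2 * (v - u)\<^sup>2 + sink3 q R t / 6 * (v - u) ^ 3"
      unfolding e by (simp add: df_def eval_nat_numeral fact_numeral)
    ultimately show ?thesis by simp
  qed
  \<comment> \<open>A lower bound for \<open>\<bar>v - u\<bar>\<close> when \<open>v\<close> leaves
    \<open>{u0..2 * R}\<close> and \<open>4 * u0 \<le> u < R\<close>: below by more than
    \<open>3 * u0\<close>, above by more than \<open>R\<close>. Dividing by powers of
    \<open>m\<close> turns crude bounds into cubic ones.\<close>
  define m where "m = min R (3 * u0)"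
  have m: "0 < m" unfolding m_def using R u0 by simp
  define D where "D = D1 + D2"
  define K where "K = D3 + (D0 / m ^ 3 + D / m\<^sup>2 + D / m)"
  have D: "0 \<le> D" unfolding D_def using D1 D2 by simp
  have K3: "0 \<le> D0 / m ^ 3 + D / m\<^sup>2 + D / m" using D0 D m by simp
  have K: "0 \<le> K" unfolding K_def using D3 K3 by simp
  have "\<exists>a b. \<bar>a\<bar> \<le> D \<and> \<bar>b\<bar> \<le> D \<and> (R \<le> u \<longrightarrow> a = 0 \<and> b = 0) \<and>
    2 * q * a + 2 * u * b \<le> 0 \<and> (4 * u \<le> R \<longrightarrow> 2 * q * a + 2 * u * b \<le> - 3 * q * R powr - q) \<and>
    (\<forall>v\<ge>0. sink q R u0 v \<le> sink q R u0 u + a * (v - u) + b / 2 * (v - u)\<^sup>2 + K * \<bar>v - u\<bar> ^ 3)" if u: "4 * u0 \<le> u" for u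
  proof (cases "R \<le> u")
    case True
    then show ?thesis
      using sink_bounds(2)[of u0 R q] sink_bounds(3)[of u0 R q u] R u0 q K D
      by (intro exI[of _ 0]) (auto intro!: order_trans[OF sink_bounds(2)])
  next
    case False
    have up: "0 < u" "u0 \<le> u" using u u0 by auto
    have uI: "u \<in> {u0..2 * R}" using u False up R by auto
    let ?a = "sink1 q R u" and ?b = "sink2 q R u"
    have su: "sink q R u0 u = sink_prim q R u" using sink_bounds(4)[of u0 R q u] R u0 q up False by simp
    have a: "\<bar>?a\<bar> \<le> D" and b: "\<bar>?b\<bar> \<le> D" unfolding D_def using D1 D2 uI by (force+)
    have pw: "(u / R) powr q \<le> u / R"
      using powr_mono'[of 1 q "u / R"] q up False R by (simp add: divide_le_eq)
    have L: "2 * q * ?a + 2 * u * ?b = - 4 * q * R powr - q * (1 - (u / R) powr q)"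
      by (rule sink_generator_eq) (use up R in auto)
    have L1: "2 * q * ?a + 2 * u * ?b \<le> 0"
    proof -
      have "(u / R) powr q \<le> 1" using pw False R by (simp add: divide_le_eq order_trans[OF pw])
      then have "0 \<le> 4 * q * R powr - q * (1 - (u / R) powr q)" using q by (intro mult_nonneg_nonneg) auto
      then show ?thesis unfolding L by linarith
    qed
    have L2: "2 * q * ?a + 2 * u * ?b \<le> - 3 * q * R powr - q" if "4 * u \<le> R"
    proof -
      have "u / R \<le> 1 / 4" using that R by (simp add: divide_le_eq)
      then have "3 / 4 \<le> 1 - (u / R) powr q" using pw by linarith
      then have "4 * q * R powr - q * (3 / 4) \<le> 4 * q * R powr - q * (1 - (u / R) powr q)"
        using q by (intro mult_left_mono) auto
      then show ?thesis unfolding L by linarith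
    qed
    have "sink q R u0 v \<le> sink_prim q R u + ?a * (v - u) + ?b / 2 * (v - u)\<^sup>2 + K * \<bar>v - u\<bar> ^ 3" if v: "0 \<le> v" for v
    proof (cases "v \<in> {u0..2 * R}")
      case True
      have "max v u0 = v" using True by simp
      then have "sink q R u0 v \<le> sink_prim q R v" by (simp add: sink_def)
      also have "\<dots> \<le> sink_prim q R u + ?a * (v - u) + ?b / 2 * (v - u)\<^sup>2 + D3 * \<bar>v - u\<bar> ^ 3" by (rule tay[OF uI True])
      also have "D3 * \<bar>v - u\<bar> ^ 3 \<le> K * \<bar>v - u\<bar> ^ 3" unfolding K_def using K3 by (intro mult_right_mono) auto
      finally show ?thesis by simp
    next
      case out: False
      let ?d = "\<bar>v - u\<bar>"
      have d: "m \<le> ?d" using out u False unfolding m_def by auto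
      have dp: "0 < ?d" using d m by linarith
      have "D0 * 1 \<le> D0 * (?d ^ 3 / m ^ 3)" using d m D0
        by (intro mult_left_mono) (auto simp: power_mono)
      then have 1: "D0 \<le> D0 / m ^ 3 * ?d ^ 3" by simp
      have d2: "?d * 1 \<le> ?d * (?d\<^sup>2 / m\<^sup>2)" using d m by (intro mult_left_mono) (auto simp: power_mono[of m ?d 2, simplified])
      have "\<bar>?a * (v - u)\<bar> \<le> D * ?d" unfolding abs_mult by (intro mult_right_mono a) auto
      also have "\<dots> \<le> D * (?d * (?d\<^sup>2 / m\<^sup>2))" using d2 D by (intro mult_left_mono) auto
      also have "\<dots> = D / m\<^sup>2 * ?d ^ 3" by (simp add: power2_eq_square power3_eq_cube)
      finally have 2: "- (D / m\<^sup>2 * ?d ^ 3) \<le> ?a * (v - u)" by linarith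
      have d3: "?d\<^sup>2 * 1 \<le> ?d\<^sup>2 * (?d / m)" using d m by (intro mult_left_mono) auto
      have "\<bar>?b / 2 * (v - u)\<^sup>2\<bar> = \<bar>?b\<bar> / 2 * ?d\<^sup>2" by (simp add: abs_mult)
      also have "\<dots> \<le> D * ?d\<^sup>2" using b D by (intro mult_right_mono) auto
      also have "\<dots> \<le> D * (?d\<^sup>2 * (?d / m))" using d3 D by (intro mult_left_mono) auto
      also have "\<dots> = D / m * ?d ^ 3" by (simp add: power2_eq_square power3_eq_cube)
      finally have 3: "- (D / m * ?d ^ 3) \<le> ?b / 2 * (v - u)\<^sup>2" by linarith
      have "0 \<le> D3 * ?d ^ 3" using D3 by simp
      moreover have "- D0 \<le> sink_prim q R u" using D0(2)[OF uI] by linarith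
      moreover have "sink q R u0 v \<le> 0" by (simp add: sink_def)
      ultimately show ?thesis using 1 2 3 unfolding K_def distrib_right by linarith
    qed
    then show ?thesis using a b L1 L2 False unfolding su by (intro exI[of _ ?a] exI[of _ ?b]) auto
  qed
  then show ?thesis using D K by blast
qed

text \<open>In squared distance, \<open>4 * s\<^sup>2\<close> ends the sink at radius
  \<open>2 * s\<close> and \<open>r\<^sup>2 / 4\<close> truncates it at \<open>r / 2\<close>, well
  inside the bubble. Full strength is claimed only up to radius \<open>s\<close>, because centres
  will form a net of that mesh.\<close>

lemma step_le_sink:
  defines "q \<equiv> real DIM('a) / 2"
  assumes d: "DIM('a::euclidean_space) \<ge> 2" and r: "0 < r" "r < s"
  shows "\<exists>C\<ge>0. \<forall>x c :: 'a. r \<le> norm (x - c) \<longrightarrow>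
    step_le (\<lambda>x. sink q (4 * s\<^sup>2) (r\<^sup>2 / 4) ((norm (x - c))\<^sup>2)) x (if norm (x - c) \<le> s then - ((2 * s) powr - DIM('a)) else 0) C"
proof -
  let ?R = "4 * s\<^sup>2" and ?inner = "r\<^sup>2 / 4"
  let ?f = "sink q ?R ?inner"
  have q: "1 \<le> q" unfolding q_def using d by simp
  have s: "0 < s" using r by simp
  have rs: "r\<^sup>2 < s\<^sup>2" using r by (intro power_strict_mono) auto
  have u0: "0 < ?inner" "4 * ?inner < ?R" using r rs zero_le_power2[of s] by (simp, linarith)
  obtain D K where DK: "0 \<le> D" "0 \<le> K" and ab: "\<And>u. u \<ge> 4 * ?inner \<Longrightarrow> \<exists>a b. \<bar>a\<bar> \<le> D \<and> \<bar>b\<bar> \<le> D \<and> (?R \<le> u \<longrightarrow> a = 0 \<and> b = 0) \<and>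
    2 * q * a + 2 * u * b \<le> 0 \<and> (4 * u \<le> ?R \<longrightarrow> 2 * q * a + 2 * u * b \<le> - 3 * q * ?R powr - q) \<and>
    (\<forall>v\<ge>0. ?f v \<le> ?f u + a * (v - u) + b / 2 * (v - u)\<^sup>2 + K * \<bar>v - u\<bar> ^ 3)"
    using sink_taylor[OF u0 q] by blast
  define M where "M = - sink_prim q ?R ?inner"
  have u0R: "0 < ?R" "?inner \<le> ?R" using u0 by linarith+
  have bound: "\<bar>?f u\<bar> \<le> M" for u
    using sink_bounds(1,2)[OF u0(1) u0R(1) q u0R(2), of u] unfolding M_def by linarith
  have M: "0 \<le> M" using bound[of 0] by linarith
  have meas: "?f \<in> borel_measurable borel" by measurable
  define C where "C = (K * (2 * (2 * s) + 1) ^ 3 + D * (2 * (2 * s) + 1) + (2 * M + 2 * D * (2 * s) + D + 2 * D * (2 * s)\<^sup>2)) * 2 * (real DIM('a))\<^sup>2"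
  have C: "0 \<le> C" unfolding C_def using DK M s by simp
  have "step_le (\<lambda>x. ?f ((norm (x - c))\<^sup>2)) x (if norm (x - c) \<le> s then - ((2 * s) powr - DIM('a)) else 0) C"
    if x: "r \<le> norm (x - c)" for x c :: 'a
  proof -
    let ?u = "(norm (x - c))\<^sup>2"
    have "r\<^sup>2 \<le> ?u" using x r by (intro power_mono) auto
    then have u: "?u \<ge> 4 * ?inner" by linarith
    obtain a b where a: "\<bar>a\<bar> \<le> D" "\<bar>b\<bar> \<le> D" and z: "?R \<le> ?u \<longrightarrow> a = 0 \<and> b = 0"
      and L: "2 * q * a + 2 * ?u * b \<le> 0" "4 * ?u \<le> ?R \<longrightarrow> 2 * q * a + 2 * ?u * b \<le> - 3 * q * ?R powr - q"
      and T: "\<forall>v\<ge>0. ?f v \<le> ?f ?u + a * (v - ?u) + b / 2 * (v - ?u)\<^sup>2 + K * \<bar>v - ?u\<bar> ^ 3"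
      using ab[OF u] by blast
    have dq: "2 * q = DIM('a)" by (simp add: q_def)
    have "step_le (\<lambda>x. ?f ((norm (x - c))\<^sup>2)) x (2 * q * a + 2 * ?u * b) C"
    proof (cases "norm (x - c) \<le> 2 * s")
      case True
      show ?thesis unfolding dq C_def
        by (rule step_le_radial[OF meas True bound a DK(2)]) (use T in auto)
    next
      case False
      then have "(2 * s)\<^sup>2 \<le> ?u" using s by (intro power_mono) auto
      then have Ru: "?R \<le> ?u" by (simp add: power_mult_distrib)
      have f0: "?f ?u = 0" using sink_bounds(3)[OF u0(1) u0R(1) q u0R(2) Ru] .
      have "step_le (\<lambda>x. ?f ((norm (x - c))\<^sup>2)) x 0 (0 * 2 * (real DIM('a))\<^sup>2)"
      proof (rule step_le_trivial[where B=M])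
        show "(\<lambda>x. ?f ((norm (x - c))\<^sup>2)) \<in> borel_measurable borel" using meas by measurable
        show "?f ((norm (x + w - c))\<^sup>2) \<le> ?f ?u + 0 * norm w ^ 3" for w
          unfolding f0 using sink_bounds(2)[OF u0(1) u0R(1) q u0R(2)] by simp
      qed (use bound in auto)
      then show ?thesis using z Ru C by (simp add: step_le_mono)
    qed
    moreover have "2 * q * a + 2 * ?u * b \<le> (if norm (x - c) \<le> s then - ((2 * s) powr - DIM('a)) else 0)"
    proof (cases "norm (x - c) \<le> s")
      case True
      then have "4 * ?u \<le> ?R" by (simp add: power_mono)
      then have "2 * q * a + 2 * ?u * b \<le> - 3 * q * ?R powr - q" using L(2) by simp
      also have "?R powr - q = (2 * s) powr - DIM('a)"
      proof -
        have "?R = (2 * s) powr 2" using s by (simp add: power_mult_distrib)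
        then show ?thesis by (simp only: powr_powr) (simp add: q_def)
      qed
      also have "- 3 * q * (2 * s) powr - DIM('a) \<le> - 1 * (2 * s) powr - DIM('a)"
        using q by (intro mult_right_mono) auto
      finally show ?thesis using True by simp
    qed (use L in simp)
    ultimately show ?thesis by (rule step_le_mono) simp
  qed
  then show ?thesis using C by blast
qed

section \<open>Packing and choice of scales\<close>

text \<open>Volume comparison: the balls of radius \<open>s / 2\<close> are disjoint and lie in the
  ball of radius \<open>R + s / 2\<close>.\<close>

lemma card_separated_le:
  fixes P :: "'a::euclidean_space set"
  assumes fin: "finite P" and sub: "P \<subseteq> cball z R" and R: "0 \<le> R" and s: "0 < s"
    and sep: "\<And>x y. x \<in> P \<Longrightarrow> y \<in> P \<Longrightarrow> x \<noteq> y \<Longrightarrow> s \<le> dist x y"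
  shows "real (card P) * s ^ DIM('a) \<le> (2 * R + s) ^ DIM('a)"
proof -
  define v where "v = unit_ball_vol (real DIM('a))"
  have v: "0 < v" unfolding v_def by simp
  have "real (card P) * (v * (s / 2) ^ DIM('a)) = (\<Sum>x\<in>P. measure lborel (ball x (s / 2)))"
    using s by (simp add: content_ball v_def)
  also have "\<dots> = measure lborel (\<Union>x\<in>P. ball x (s / 2))"
  proof (rule measure_finite_Union[symmetric])
    show "disjoint_family_on (\<lambda>x. ball x (s / 2)) P"
      unfolding disjoint_family_on_def
    proof (intro ballI impI)
      fix x y assume "x \<in> P" "y \<in> P" "x \<noteq> y"
      then have "s \<le> dist x y" by (rule sep)
      then show "ball x (s / 2) \<inter> ball y (s / 2) = {}" by (intro disjoint_ballI) simp
    qed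
  qed (use fin emeasure_bounded_finite[OF bounded_ball] in \<open>auto simp: less_top\<close>)
  also have "\<dots> \<le> measure lborel (cball z (R + s / 2))"
  proof (rule measure_mono_fmeasurable)
    show "(\<Union>x\<in>P. ball x (s / 2)) \<subseteq> cball z (R + s / 2)"
    proof clarsimp
      fix x y assume "x \<in> P" "dist x y * 2 < s"
      moreover have "dist z x \<le> R" using sub \<open>x \<in> P\<close> by auto
      ultimately show "dist z y \<le> R + s / 2" using dist_triangle[of z y x] by linarith
    qed
    show "(\<Union>x\<in>P. ball x (s / 2)) \<in> sets lborel" by (simp add: borel_open open_UN)
    show "cball z (R + s / 2) \<in> fmeasurable lborel"
      using emeasure_bounded_finite[OF bounded_cball] by (intro fmeasurableI) auto
  qed
  also have "\<dots> = v * (R + s / 2) ^ DIM('a)" using R s by (simp add: content_cball v_def)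
  finally have "real (card P) * (s / 2) ^ DIM('a) \<le> (R + s / 2) ^ DIM('a)"
    using v by (simp add: mult.left_commute)
  then have "real (card P) * (s / 2) ^ DIM('a) * 2 ^ DIM('a) \<le> (R + s / 2) ^ DIM('a) * 2 ^ DIM('a)"
    by (intro mult_right_mono) auto
  then show ?thesis by (simp add: mult.assoc flip: power_mult_distrib) (simp add: algebra_simps)
qed

text \<open>The packing bound limits the cardinality of separated sets, so one of largest
  cardinality exists; a point of \<open>L\<close> not covered by it could be added.\<close>

lemma exists_maximal_separated:
  fixes L :: "'a::euclidean_space set"
  assumes L: "bounded L" and s: "0 < s"
  obtains X where "finite X" "X \<subseteq> L" "\<And>x y. x \<in> X \<Longrightarrow> y \<in> X \<Longrightarrow> x \<noteq> y \<Longrightarrow> s \<le> dist x y"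
    "\<And>x. x \<in> L \<Longrightarrow> \<exists>p\<in>X. dist x p < s"
proof -
  obtain R where R: "0 < R" "L \<subseteq> cball 0 R" using bounded_subset_ballD[OF L, of 0] ball_subset_cball by blast
  define sp where "sp X \<longleftrightarrow> finite X \<and> X \<subseteq> L \<and> (\<forall>x\<in>X. \<forall>y\<in>X. x \<noteq> y \<longrightarrow> s \<le> dist x y)" for X
  define N where "N = nat \<lceil>(2 * R + s) ^ DIM('a) / s ^ DIM('a)\<rceil>"
  have bd: "card X \<le> N" if "sp X" for X
  proof -
    have "real (card X) * s ^ DIM('a) \<le> (2 * R + s) ^ DIM('a)"
      using that R s by (intro card_separated_le[of X 0]) (auto simp: sp_def)
    then have "real (card X) \<le> (2 * R + s) ^ DIM('a) / s ^ DIM('a)" using s by (simp add: pos_le_divide_eq)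
    also have "\<dots> \<le> real N" unfolding N_def by (rule real_nat_ceiling_ge)
    finally show ?thesis by simp
  qed
  have "sp {}" by (simp add: sp_def)
  from ex_has_greatest_nat[of sp, OF this, of card "Suc N"]
  obtain X where X: "sp X" and mx: "\<And>Y. sp Y \<Longrightarrow> card Y \<le> card X" using bd by (auto simp: less_Suc_eq_le)
  have "\<exists>p\<in>X. dist x p < s" if x: "x \<in> L" for x
  proof (rule ccontr)
    assume n: "\<not> (\<exists>p\<in>X. dist x p < s)"
    then have "x \<notin> X" using s by force
    moreover have "sp (insert x X)" using X n x unfolding sp_def by (auto simp: not_less dist_commute)
    ultimately show False using mx[of "insert x X"] X by (simp add: sp_def)
  qed
  then show ?thesis using X that unfolding sp_def by blast
qed

text \<open>Up to a constant the capacity of a ball of radius \<open>r\<close>; it is the summand of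
  the theorem without the iterated logarithm.\<close>

definition cap :: "nat \<Rightarrow> real \<Rightarrow> real" where
  "cap d r = (if d = 2 then inverse (ln (1 / r)) else r ^ (d - 2))"

lemma cap_pos: "0 < r \<Longrightarrow> r < 1 \<Longrightarrow> 0 < cap d r"
  by (auto simp: cap_def)

lemma cap_tendsto: "2 \<le> d \<Longrightarrow> (cap d \<longlongrightarrow> 0) (at_right 0)"
proof (cases "d = 2")
  case True
  have "((\<lambda>r::real. inverse (ln (1 / r))) \<longlongrightarrow> 0) (at_right 0)" by real_asymp
  then show ?thesis using True by (simp add: cap_def[abs_def])
next
  case False
  assume "2 \<le> d"
  have "((\<lambda>r::real. r ^ (d - 2)) \<longlongrightarrow> 0 ^ (d - 2)) (at_right 0)" by (intro tendsto_intros)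
  then show ?thesis using False \<open>2 \<le> d\<close> by (simp add: cap_def[abs_def])
qed

text \<open>Needed because the spacing satisfies \<open>cap d r = \<kappa> * s ^ d\<close>: the
  bubbles then are small compared with their mutual distances.\<close>

lemma power_div_cap_tendsto: 
  assumes "2 \<le> d" shows "((\<lambda>r. r ^ d / cap d r) \<longlongrightarrow> 0) (at_right 0)"
proof (cases "d = 2")
  case True
  have "((\<lambda>r::real. r ^ 2 / inverse (ln (1 / r))) \<longlongrightarrow> 0) (at_right 0)" by real_asymp
  then show ?thesis using True by (simp add: cap_def)
next
  case False
  have "((\<lambda>r::real. r ^ 2) \<longlongrightarrow> 0 ^ 2) (at_right 0)" by (intro tendsto_intros)
  moreover have "\<forall>\<^sub>F r::real in at_right 0. r ^ 2 = r ^ d / cap d r"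
    using eventually_at_right_less
  proof eventually_elim
    case (elim r)
    have "r ^ d = r ^ 2 * r ^ (d - 2)" by (metis assms le_add_diff_inverse power_add)
    then show ?case using elim False by (simp add: cap_def)
  qed
  ultimately show ?thesis by (subst tendsto_cong[symmetric]) auto
qed

text \<open>In the plane the depth is at most \<open>2 * ln (1 / r) + ln 4 + 1\<close>, since
  \<open>2 * s \<le> 1\<close> makes \<open>ln (4 * s\<^sup>2)\<close> nonpositive;
  \<open>r \<le> exp (- 1)\<close> absorbs the constants into \<open>7 * ln (1 / r)\<close>. In
  higher dimensions \<open>q - 1 \<ge> 1 / 2\<close>, and the truncation at \<open>r / 2\<close>
  costs a power of 2.\<close>

lemma sink_depth:
  assumes d: "2 \<le> d" and r: "0 < r" "r \<le> exp (- 1)" and s: "r < s" "2 * s \<le> 1"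
  shows "- sink_prim (real d / 2) (4 * s\<^sup>2) (r\<^sup>2 / 4) \<le> (2 ^ d + 3) / cap d r"
proof -
  have s0: "0 < s" using r s by simp
  have "r\<^sup>2 \<le> s\<^sup>2" using r s by (intro power_mono) auto
  then have le: "r\<^sup>2 / 4 \<le> 4 * s\<^sup>2" using zero_le_power2[of s] by linarith
  have low: "sink_base (real d / 2) (r\<^sup>2 / 4) - (if real d / 2 = 1 then ln (4 * s\<^sup>2) + 1 else 0) \<le> sink_prim (real d / 2) (4 * s\<^sup>2) (r\<^sup>2 / 4)"
    using r le d by (intro sink_prim_lower) auto
  show ?thesis
  proof (cases "d = 2")
    case True
    have "4 * s\<^sup>2 = (2 * s)\<^sup>2" by (simp add: power_mult_distrib)
    also have "\<dots> \<le> 1" using s s0 by (intro power_le_one) auto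
    finally have "ln (4 * s\<^sup>2) \<le> 0" using s0 by (subst ln_le_zero_iff) auto
    moreover have "ln (r\<^sup>2 / 4) = 2 * ln r - ln 4" using r by (simp add: ln_div ln_realpow)
    moreover have "ln (4::real) \<le> 3" using ln_le_minus_one[of "4::real"] by simp
    moreover have "1 \<le> - ln r" using r ln_mono[of r "exp (-1)"] by simp
    moreover have "1 / cap d r = - ln r" using r True by (simp add: cap_def ln_inverse divide_inverse)
    moreover have "(2 ^ d + 3) / cap d r = 7 * (1 / cap d r)" using True by simp
    ultimately show ?thesis using low True by (simp add: sink_base_def)
  next
    case False
    then have d3: "3 \<le> d" using d by simp
    define q where "q = real d / 2"
    have q: "1 / 2 \<le> q - 1" "q \<noteq> 1" unfolding q_def using d3 by auto
    have e: "(r\<^sup>2 / 4) powr (1 - q) = 2 ^ (d - 2) / r ^ (d - 2)"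
    proof -
      have "r\<^sup>2 / 4 = (r / 2) powr 2" using r by (simp add: power_divide)
      then have "(r\<^sup>2 / 4) powr (1 - q) = (r / 2) powr (- real (d - 2))"
        using d by (simp add: powr_powr q_def of_nat_diff algebra_simps)
      also have "\<dots> = 1 / (r / 2) ^ (d - 2)" using r by (simp add: powr_minus_divide powr_realpow)
      finally show ?thesis by (simp add: power_divide)
    qed
    have "- sink_prim q (4 * s\<^sup>2) (r\<^sup>2 / 4) \<le> (r\<^sup>2 / 4) powr (1 - q) / (q - 1)"
      using low q(2) unfolding q_def[symmetric] by (simp add: sink_base_def)
    also have "\<dots> \<le> (r\<^sup>2 / 4) powr (1 - q) / (1 / 2)" using q by (intro divide_left_mono) auto
    also have "\<dots> = 2 * 2 ^ (d - 2) / r ^ (d - 2)" unfolding e by simp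
    also have "\<dots> \<le> (2 ^ d + 3) / r ^ (d - 2)"
    proof (rule divide_right_mono)
      have "2 * 2 ^ (d - 2) = (2::real) ^ (d - 1)" using d by (simp flip: power_Suc add: Suc_diff_le numeral_2_eq_2)
      also have "\<dots> \<le> 2 ^ d" by (intro power_increasing) auto
      finally show "2 * 2 ^ (d - 2) \<le> (2 ^ d + 3 :: real)" by simp
    qed (use r in auto)
    finally show ?thesis using False by (simp add: cap_def q_def)
  qed
qed

text \<open>The radius determines the spacing \<open>s\<close> here, and not conversely, to treat all dimensions alike.\<close>

lemma choose_scale:
  assumes d: "2 \<le> d" and \<kappa>: "0 < \<kappa>" and s0: "0 < s0" and Q: "\<forall>\<^sub>F r in at_right 0. Q r"
  obtains r s :: real where "0 < r" "2 * r < s" "s < s0" "r \<le> exp (- 1)" "Q r" "cap d r = \<kappa> * s ^ d"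
proof -
  have 1: "\<forall>\<^sub>F r in at_right 0. cap d r < \<kappa> * s0 ^ d"
    using order_tendstoD(2)[OF cap_tendsto[OF d], of "\<kappa> * s0 ^ d"] \<kappa> s0 by simp
  \<comment> \<open>Rewritten, this is \<open>(2 * r) ^ d < cap d r / \<kappa>\<close>, and the
    right side is going to be \<open>s ^ d\<close>.\<close>
  have 2: "\<forall>\<^sub>F r in at_right 0. r ^ d / cap d r < 1 / (\<kappa> * 2 ^ d)"
    using order_tendstoD(2)[OF power_div_cap_tendsto[OF d], of "1 / (\<kappa> * 2 ^ d)"] \<kappa> by simp
  have 3: "\<forall>\<^sub>F r in at_right (0::real). r < exp (- 1)"
    by (rule eventually_at_rightI[of 0 "exp (-1)"]) auto
  have "\<forall>\<^sub>F r in at_right (0::real). cap d r < \<kappa> * s0 ^ d \<and> r ^ d / cap d r < 1 / (\<kappa> * 2 ^ d) \<and> r < exp (- 1) \<and> Q r \<and> 0 < r"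
    using 1 2 3 Q eventually_at_right_less by eventually_elim auto
  then obtain r :: real where r: "cap d r < \<kappa> * s0 ^ d" "r ^ d / cap d r < 1 / (\<kappa> * 2 ^ d)" "r < exp (- 1)" "Q r" "0 < r"
    using eventually_happens'[OF trivial_limit_at_right_real] by blast
  have "exp (- 1) < (1::real)" by simp
  then have r1: "r < 1" using r by linarith
  note c = cap_pos[OF r(5) r1, of d]
  define s where "s = root d (cap d r / \<kappa>)"
  have sd: "s ^ d = cap d r / \<kappa>" unfolding s_def using c \<kappa> d by (intro real_root_pow_pos2) auto
  have s: "0 \<le> s" unfolding s_def using c \<kappa> by (intro real_root_pos_pos_le) auto
  have "s ^ d < s0 ^ d" unfolding sd using r(1) \<kappa> by (simp add: divide_less_eq mult.commute)
  then have "s < s0" using power_less_imp_less_base s0 by (metis less_imp_le)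
  moreover have "(2 * r) ^ d < s ^ d"
    unfolding sd using r(2) c \<kappa> by (simp add: power_mult_distrib field_simps)
  then have "2 * r < s" using power_less_imp_less_base s by blast
  moreover have "cap d r = \<kappa> * s ^ d" unfolding sd using \<kappa> by simp
  ultimately show ?thesis using that r by auto
qed

section \<open>One layer of bubbles\<close>

text \<open>Here \<open>f\<close> is \<epsilon> plus bumps \<open>f1\<close> plus \<beta> times
  sinks \<open>f2\<close>. The factor \<beta> makes one sink cancel the drift of all bumps. The
  ratio \<kappa> makes the overlapping sinks no deeper than \<epsilon>, which gives both
  \<open>0 \<le> f\<close> and \<open>f \<le> \<epsilon>\<close> away from the bumps. As \<kappa> is
  fixed before the radius, the sum over the layer is at most
  \<open>V * \<kappa> * \<bar>w r\<bar>\<close>, with only the last factor still to be made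
  small.\<close>

lemma bubble_layer:
  fixes C :: "'a::euclidean_space set" and w :: "real \<Rightarrow> real"
  assumes d: "DIM('a) \<ge> 2" and C: "compact C" and \<eta>: "0 < \<eta>" and \<epsilon>: "0 < \<epsilon>" and \<delta>: "0 < \<delta>"
    and w: "(w \<longlongrightarrow> 0) (at_right 0)" and Q: "\<forall>\<^sub>F r in at_right 0. Q r"
  obtains X r f S b K where
    "finite X" "0 < r" "Q r" "\<And>x. x \<in> X \<Longrightarrow> \<exists>c\<in>C. dist c x < 3 * \<eta>"
    "\<And>x y. x \<in> X \<Longrightarrow> y \<in> X \<Longrightarrow> x \<noteq> y \<Longrightarrow> 2 * r < dist x y"
    "real (card X) * (cap DIM('a) r * w r) < \<delta>"
    "f \<in> borel_measurable borel" "\<And>x. 0 \<le> f x" "\<And>x. f x \<le> b" "0 \<le> K" "open S" "C \<subseteq> S"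
    "\<And>x. x \<notin> (\<Union>p\<in>X. cball p r) \<Longrightarrow> step_le f x 0 K" "\<And>x. x \<in> S \<Longrightarrow> 1 \<le> f x"
    "\<And>y. (\<And>c. c \<in> C \<Longrightarrow> 3 * \<eta> \<le> dist c y) \<Longrightarrow> f y \<le> \<epsilon>"
proof -
  let ?d = "DIM('a)"
  define q where "q = real ?d / 2"
  have q: "1 \<le> q" unfolding q_def using d by simp
  \<comment> \<open>In squared distance: a bump has support radius \<open>2 * \<eta>\<close>. Up to
    radius \<eta> the difference \<open>R - u\<close> is at least \<open>3 * \<eta>\<^sup>2\<close>,
    whence the normalisation in \<theta>.\<close>
  define R where "R = 4 * \<eta>\<^sup>2"
  have R: "0 < R" unfolding R_def using \<eta> by simp
  have "C \<subseteq> (\<Union>y\<in>C. ball y \<eta>)" using \<eta> by auto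
  then obtain Y where Y: "Y \<subseteq> C" "finite Y" "C \<subseteq> (\<Union>y\<in>Y. ball y \<eta>)"
    using compactE_image[OF C, of C "\<lambda>y. ball y \<eta>"] by auto
  define \<theta> where "\<theta> u = min (cubic_bump R u) (R ^ 3) / (3 * \<eta>\<^sup>2) ^ 3" for u
  have \<theta>m[measurable]: "\<theta> \<in> borel_measurable borel" unfolding \<theta>_def[abs_def] by measurable
  have \<theta>0: "0 \<le> \<theta> u" for u unfolding \<theta>_def cubic_bump_def using R by simp
  have \<theta>z: "\<theta> u = 0" if "R \<le> u" for u unfolding \<theta>_def cubic_bump_def using R that by simp
  have \<theta>1: "1 \<le> \<theta> u" if "u \<le> \<eta>\<^sup>2" for u
  proof -
    have "(3 * \<eta>\<^sup>2) ^ 3 \<le> (max 0 (R - u)) ^ 3" using that by (intro power_mono) (auto simp: R_def)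
    moreover have "(3 * \<eta>\<^sup>2) ^ 3 \<le> R ^ 3" by (intro power_mono) (auto simp: R_def)
    ultimately show ?thesis using \<eta> unfolding \<theta>_def cubic_bump_def by simp
  qed
  define B\<theta> where "B\<theta> = R ^ 3 / (3 * \<eta>\<^sup>2) ^ 3"
  have \<theta>B: "\<theta> u \<le> B\<theta>" for u unfolding \<theta>_def B\<theta>_def by (intro divide_right_mono) auto
  define c1 where "c1 = 12 * R\<^sup>2 / (3 * \<eta>\<^sup>2) ^ 3"
  have c1: "0 < c1" unfolding c1_def using R \<eta> by simp
  obtain K1 where K1: "0 \<le> K1" and \<theta>s: "\<And>x y::'a. step_le (\<lambda>x. \<theta> ((norm (x - y))\<^sup>2)) x (if (norm (x - y))\<^sup>2 < R then c1 else 0) K1"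
  proof -
    obtain K0 where K0: "0 \<le> K0" and s: "\<And>x y::'a. step_le (\<lambda>x. min (cubic_bump R ((norm (x - y))\<^sup>2)) (R ^ 3)) x (if (norm (x - y))\<^sup>2 < R then 12 * R\<^sup>2 else 0) K0"
      using step_le_cubic_bump[OF R, where 'a='a] by blast
    show ?thesis
    proof (rule that)
      show "0 \<le> 1 / (3 * \<eta>\<^sup>2) ^ 3 * K0" using K0 by simp
      show "step_le (\<lambda>x. \<theta> ((norm (x - y))\<^sup>2)) x (if (norm (x - y))\<^sup>2 < R then c1 else 0) (1 / (3 * \<eta>\<^sup>2) ^ 3 * K0)" for x y :: 'a
        using step_le_cmult[OF s[of y x], of "1 / (3 * \<eta>\<^sup>2) ^ 3"] unfolding \<theta>_def c1_def
        by (simp add: if_distrib[of "\<lambda>u. _ * u"] if_distrib[of "\<lambda>u. u / _"] cong: if_cong)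
    qed
  qed
  \<comment> \<open>The drift of all bumps together. The successor keeps \<open>c\<close> positive
    even if \<open>C\<close>, and with it \<open>Y\<close>, is empty.\<close>
  define c where "c = real (Suc (card Y)) * c1"
  have c: "0 < c" unfolding c_def using c1 by simp
  \<comment> \<open>No bump contributes drift outside \<open>L\<close>, so only \<open>L\<close> has
    to be filled with bubbles.\<close>
  define L where "L = (\<Union>y\<in>Y. ball y (2 * \<eta>))"
  have "bounded L" unfolding L_def using Y by (intro bounded_UN) auto
  then obtain R0 where R0: "0 < R0" "L \<subseteq> cball 0 R0"
    using bounded_subset_ballD[of L 0] ball_subset_cball by blast
  \<comment> \<open>This makes the total depth of at most \<open>5 ^ d\<close> overlapping sinks equal to \<open>\<epsilon>\<close>.\<close>
  define \<kappa> where "\<kappa> = 10 ^ ?d * c * (2 ^ ?d + 3) / \<epsilon>"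
  have \<kappa>: "0 < \<kappa>" unfolding \<kappa>_def using c \<epsilon> by (simp add: add_pos_pos)
  \<comment> \<open>Bounds \<open>(2 * R0 + s) ^ d\<close> for every \<open>s \<le> 1\<close>, so it
    is available before \<open>s\<close> is chosen.\<close>
  define V where "V = (2 * R0 + 1) ^ ?d"
  have V: "0 < V" unfolding V_def using R0 by simp
  have "((\<lambda>r. V * \<kappa> * \<bar>w r\<bar>) \<longlongrightarrow> V * \<kappa> * \<bar>0\<bar>) (at_right 0)" using w by (intro tendsto_intros)
  then have "\<forall>\<^sub>F r in at_right 0. V * \<kappa> * \<bar>w r\<bar> < \<delta>" using \<delta> by (intro order_tendstoD) auto
  with Q have ev: "\<forall>\<^sub>F r in at_right 0. Q r \<and> V * \<kappa> * \<bar>w r\<bar> < \<delta>" by eventually_elim auto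
  have "0 < (1 / 2 :: real)" by simp
  from choose_scale[OF d \<kappa> this ev]
  obtain r s where r': "0 < r" "2 * r < s" "s < 1 / 2" "r \<le> exp (- 1)" "Q r \<and> V * \<kappa> * \<bar>w r\<bar> < \<delta>"
    and cs: "cap ?d r = \<kappa> * s ^ ?d" by metis
  then have r: "0 < r" "2 * r < s" "s < 1 / 2" "r \<le> exp (- 1)" "Q r" "V * \<kappa> * \<bar>w r\<bar> < \<delta>" by auto
  have s: "0 < s" using r by linarith
  have rs: "r < s" using r by linarith
  obtain X where X: "finite X" "X \<subseteq> L" and sep: "\<And>x y. x \<in> X \<Longrightarrow> y \<in> X \<Longrightarrow> x \<noteq> y \<Longrightarrow> s \<le> dist x y"
    and cov: "\<And>x. x \<in> L \<Longrightarrow> \<exists>p\<in>X. dist x p < s"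
    using exists_maximal_separated[OF \<open>bounded L\<close> s] by metis
  define \<psi> where "\<psi> = sink q (4 * s\<^sup>2) (r\<^sup>2 / 4)"
  \<comment> \<open>A sink drifts by at most \<open>- ((2 * s) powr - d)\<close> near its centre;
    after scaling by \<beta> this is exactly \<open>- c\<close>.\<close>
  define \<beta> where "\<beta> = c * (2 * s) ^ ?d"
  have \<beta>: "0 < \<beta>" unfolding \<beta>_def using c s by simp
  define m where "m = - sink_prim q (4 * s\<^sup>2) (r\<^sup>2 / 4)"
  have u0: "0 < r\<^sup>2 / 4" "0 < 4 * s\<^sup>2" "r\<^sup>2 / 4 \<le> 4 * s\<^sup>2"
  proof -
    have "r\<^sup>2 \<le> s\<^sup>2" using r rs by (intro power_mono) auto
    then show "r\<^sup>2 / 4 \<le> 4 * s\<^sup>2" using zero_le_power2[of s] by linarith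
  qed (use r s in auto)
  note sb = sink_bounds[OF u0(1,2) q u0(3)]
  have \<psi>0: "\<psi> u \<le> 0" and \<psi>m: "- m \<le> \<psi> u" for u using sb(1,2)[of u] unfolding \<psi>_def m_def by auto
  have \<psi>z: "\<psi> u = 0" if "4 * s\<^sup>2 \<le> u" for u using sb(3)[OF that] unfolding \<psi>_def .
  have \<psi>meas[measurable]: "\<psi> \<in> borel_measurable borel" unfolding \<psi>_def by measurable
  have m0: "0 \<le> m" using \<psi>0[of 0] \<psi>m[of 0] by linarith
  have depth: "5 ^ ?d * (\<beta> * m) \<le> \<epsilon>"
  proof -
    have "m \<le> (2 ^ ?d + 3) / cap ?d r"
      unfolding m_def q_def using r rs by (intro sink_depth d) auto
    then have "5 ^ ?d * (\<beta> * m) \<le> 5 ^ ?d * (\<beta> * ((2 ^ ?d + 3) / cap ?d r))"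
      using \<beta> by (intro mult_left_mono) auto
    also have "\<dots> = 10 ^ ?d * c * (2 ^ ?d + 3) * s ^ ?d / (\<kappa> * s ^ ?d)"
    proof -
      have "(10::real) ^ ?d = 5 ^ ?d * 2 ^ ?d" by (simp flip: power_mult_distrib)
      then show ?thesis unfolding cs \<beta>_def by (simp add: power_mult_distrib mult_ac)
    qed
    also have "\<dots> = \<epsilon>" using s c \<epsilon> unfolding \<kappa>_def by (simp add: add_pos_pos less_imp_neq[symmetric])
    finally show ?thesis .
  qed
  obtain K2 where K2: "0 \<le> K2" and \<psi>s: "\<And>x p::'a. r \<le> norm (x - p) \<Longrightarrow>
     step_le (\<lambda>x. \<psi> ((norm (x - p))\<^sup>2)) x (if norm (x - p) \<le> s then - ((2 * s) powr - ?d) else 0) K2"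
    using step_le_sink[OF d r(1) rs] unfolding \<psi>_def q_def by blast
  define f1 where "f1 x = (\<Sum>y\<in>Y. \<theta> ((norm (x - y))\<^sup>2))" for x
  define f2 where "f2 x = (\<Sum>p\<in>X. \<psi> ((norm (x - p))\<^sup>2))" for x
  define f where "f x = (\<epsilon> + f1 x) + \<beta> * f2 x" for x
  have f1m[measurable]: "f1 \<in> borel_measurable borel" unfolding f1_def[abs_def] by measurable
  have f2m[measurable]: "f2 \<in> borel_measurable borel" unfolding f2_def[abs_def] by measurable
  have f10: "0 \<le> f1 x" for x unfolding f1_def by (intro sum_nonneg \<theta>0)
  have f1B: "f1 x \<le> real (card Y) * B\<theta>" for x unfolding f1_def by (rule sum_bounded_above) (rule \<theta>B)
  have f20: "f2 x \<le> 0" for x unfolding f2_def by (intro sum_nonpos \<psi>0)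
  have f2lo: "- \<epsilon> \<le> \<beta> * f2 x" for x
  proof -
    \<comment> \<open>Only sinks with centre within \<open>2 * s\<close> of \<open>x\<close>
      contribute. Their centres are \<open>s\<close>-separated, so packing leaves at most
      \<open>((4 * s + s) / s) ^ d = 5 ^ d\<close> of them.\<close>
    define P where "P = {p\<in>X. norm (x - p) < 2 * s}"
    have "real (card P) * s ^ ?d \<le> (2 * (2 * s) + s) ^ ?d"
      by (rule card_separated_le[of _ x]) (use X s sep in \<open>auto simp: P_def dist_norm\<close>)
    also have "2 * (2 * s) + s = 5 * s" by simp
    also have "(5 * s) ^ ?d = 5 ^ ?d * s ^ ?d" by (rule power_mult_distrib)
    finally have cP: "real (card P) \<le> 5 ^ ?d" using s by simp
    have "f2 x = (\<Sum>p\<in>P. \<psi> ((norm (x - p))\<^sup>2))"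
      unfolding f2_def
    proof (rule sum.mono_neutral_right)
      show "\<forall>p\<in>X - P. \<psi> ((norm (x - p))\<^sup>2) = 0"
      proof
        fix p assume "p \<in> X - P"
        then have "2 * s \<le> norm (x - p)" by (auto simp: P_def)
        then have "(2 * s)\<^sup>2 \<le> (norm (x - p))\<^sup>2" using s by (intro power_mono) auto
        then show "\<psi> ((norm (x - p))\<^sup>2) = 0" by (intro \<psi>z) (simp add: power_mult_distrib)
      qed
    qed (use X in \<open>auto simp: P_def\<close>)
    also have "\<dots> \<ge> real (card P) * (- m)"
      using sum_bounded_below[of P "- m" "\<lambda>p. \<psi> ((norm (x - p))\<^sup>2)"] \<psi>m by simp
    finally have "real (card P) * (- m) \<le> f2 x" .
    moreover have "real (card P) * m \<le> 5 ^ ?d * m" using cP m0 by (intro mult_right_mono)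
    ultimately have "- (5 ^ ?d * m) \<le> f2 x" by simp
    then have "\<beta> * (- (5 ^ ?d * m)) \<le> \<beta> * f2 x" using \<beta> by (intro mult_left_mono) auto
    then show ?thesis using depth by (simp add: mult.left_commute)
  qed
  have bf1: "\<bar>\<epsilon> + f1 x\<bar> \<le> \<epsilon> + real (card Y) * B\<theta>" for x using f10[of x] f1B[of x] \<epsilon> by linarith
  have bf2: "\<bar>\<beta> * f2 x\<bar> \<le> \<epsilon>" for x using f2lo[of x] mult_nonneg_nonpos[OF less_imp_le[OF \<beta>] f20[of x]] by linarith
  define K where "K = (0 + real (card Y) * K1) + \<beta> * (real (card X) * K2)"
  have step: "step_le f x 0 K" if x: "x \<notin> (\<Union>p\<in>X. cball p r)" for x
  proof -
    have xr: "r \<le> norm (x - p)" if "p \<in> X" for p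
      using x that by (auto simp: dist_norm norm_minus_commute)
    let ?L1 = "\<Sum>y\<in>Y. if (norm (x - y))\<^sup>2 < R then c1 else 0"
    let ?L2 = "\<Sum>p\<in>X. if norm (x - p) \<le> s then - ((2 * s) powr - ?d) else 0"
    have "step_le f1 x ?L1 (\<Sum>y\<in>Y. K1)"
      unfolding f1_def[abs_def]
      by (rule step_le_sum[where B="\<lambda>_. B\<theta>"]) (use Y \<theta>s \<theta>0 \<theta>B in auto)
    then have s1: "step_le (\<lambda>x. \<epsilon> + f1 x) x (0 + ?L1) (0 + real (card Y) * K1)"
      using f10 f1B by (intro step_le_add[where B="\<epsilon>" and B'="real (card Y) * B\<theta>"] step_le_const) (use \<epsilon> in auto)
    have "step_le f2 x ?L2 (\<Sum>p\<in>X. K2)"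
      unfolding f2_def[abs_def]
      by (rule step_le_sum[where B="\<lambda>_. m"]) (use X \<psi>s xr \<psi>0 \<psi>m in \<open>auto simp: abs_le_iff minus_le_iff intro: order_trans[OF \<psi>0 m0]\<close>)
    then have s2: "step_le (\<lambda>x. \<beta> * f2 x) x (\<beta> * ?L2) (\<beta> * (real (card X) * K2))"
      using \<beta> by (intro step_le_cmult) auto
    have s3: "step_le f x ((0 + ?L1) + \<beta> * ?L2) K"
      unfolding f_def[abs_def] K_def by (rule step_le_add[OF s1 s2 _ bf1 _ bf2]) measurable
    \<comment> \<open>On \<open>L\<close> some centre is closer than \<open>s\<close>, and its sink
      alone outweighs all bumps; off \<open>L\<close> there is no bump drift to compensate.\<close>
    have "?L1 + \<beta> * ?L2 \<le> 0"
    proof (cases "x \<in> L")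
      case True
      have "?L1 \<le> (\<Sum>y\<in>Y. c1)" using c1 by (intro sum_mono) auto
      also have "\<dots> \<le> c" unfolding c_def using c1 by simp
      finally have 1: "?L1 \<le> c" .
      obtain p where p: "p \<in> X" "dist x p < s" using cov[OF True] by blast
      have "?L2 = - ((2 * s) powr - ?d) + (\<Sum>p\<in>X - {p}. if norm (x - p) \<le> s then - ((2 * s) powr - ?d) else 0)"
        using p by (subst sum.remove[OF X(1) p(1)]) (simp add: dist_norm)
      also have "\<dots> \<le> - ((2 * s) powr - ?d) + 0" by (intro add_left_mono sum_nonpos) auto
      finally have "?L2 \<le> - ((2 * s) powr - ?d)" by simp
      then have "\<beta> * ?L2 \<le> \<beta> * (- ((2 * s) powr - ?d))" using \<beta> by (intro mult_left_mono) auto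
      also have "\<dots> = - c"
      proof -
        have "(2 * s) powr - ?d = 1 / (2 * s) ^ ?d" using s by (simp add: powr_minus_divide powr_realpow)
        moreover have "c * z * - (1 / z) = - c" if "z \<noteq> 0" for z using that by simp
        moreover have "(2 * s) ^ ?d \<noteq> 0" using s by simp
        ultimately show ?thesis unfolding \<beta>_def by metis
      qed
      finally show ?thesis using 1 by linarith
    next
      case False
      have "?L1 = 0"
      proof (rule sum.neutral, rule ballI)
        fix y assume "y \<in> Y"
        then have "2 * \<eta> \<le> norm (x - y)" using False unfolding L_def by (auto simp: dist_norm norm_minus_commute not_less)
        then have "(2 * \<eta>)\<^sup>2 \<le> (norm (x - y))\<^sup>2" using \<eta> by (intro power_mono) auto
        then show "(if (norm (x - y))\<^sup>2 < R then c1 else 0) = 0" by (simp add: R_def power_mult_distrib)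
      qed
      moreover have "?L2 \<le> 0" by (intro sum_nonpos) auto
      ultimately show ?thesis using \<beta> by (simp add: mult_nonneg_nonpos)
    qed
    then show ?thesis using s3 by (elim step_le_mono) auto
  qed
  show ?thesis
  proof (rule that[of X r f "\<epsilon> + real (card Y) * B\<theta>" K "\<Union>y\<in>Y. ball y \<eta>"])
    show "finite X" "0 < r" "Q r" by fact+
    show "\<exists>c\<in>C. dist c x < 3 * \<eta>" if "x \<in> X" for x
    proof -
      from that X obtain y where "y \<in> Y" "dist y x < 2 * \<eta>" unfolding L_def by auto
      then show ?thesis using Y \<eta> by (intro bexI[of _ y]) auto
    qed
    show "2 * r < dist x y" if "x \<in> X" "y \<in> X" "x \<noteq> y" for x y
      using sep[OF that] r by linarith
    show "real (card X) * (cap ?d r * w r) < \<delta>"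
    proof -
      have "real (card X) * s ^ ?d \<le> (2 * R0 + s) ^ ?d"
        by (rule card_separated_le[of _ 0]) (use X R0 s sep in auto)
      also have "\<dots> \<le> V" unfolding V_def using R0 s r by (intro power_mono) auto
      finally have N: "real (card X) * s ^ ?d \<le> V" .
      have "real (card X) * (cap ?d r * w r) = real (card X) * s ^ ?d * (\<kappa> * w r)" unfolding cs by simp
      also have "\<dots> \<le> real (card X) * s ^ ?d * (\<kappa> * \<bar>w r\<bar>)" using s \<kappa> by (intro mult_left_mono) auto
      also have "\<dots> \<le> V * (\<kappa> * \<bar>w r\<bar>)" using N \<kappa> by (intro mult_right_mono) auto
      also have "\<dots> < \<delta>" using r by (simp add: mult.assoc)
      finally show ?thesis .
    qed
    show "f \<in> borel_measurable borel" unfolding f_def[abs_def] by measurable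
    show "0 \<le> f x" for x unfolding f_def using f10[of x] f2lo[of x] by linarith
    show "f x \<le> \<epsilon> + real (card Y) * B\<theta>" for x
      unfolding f_def using f1B[of x] mult_nonneg_nonpos[OF less_imp_le[OF \<beta>] f20[of x]] by linarith
    show "0 \<le> K" unfolding K_def using K1 K2 \<beta> by simp
    show "open (\<Union>y\<in>Y. ball y \<eta>)" by auto
    show "C \<subseteq> (\<Union>y\<in>Y. ball y \<eta>)" by fact
    show "step_le f x 0 K" if "x \<notin> (\<Union>p\<in>X. cball p r)" for x by (rule step[OF that])
    show "1 \<le> f x" if x: "x \<in> (\<Union>y\<in>Y. ball y \<eta>)" for x
    proof -
      obtain y where y: "y \<in> Y" "dist y x < \<eta>" using x by auto
      have "(norm (x - y))\<^sup>2 \<le> \<eta>\<^sup>2" using y by (intro power_mono) (auto simp: dist_norm norm_minus_commute)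
      then have "1 \<le> \<theta> ((norm (x - y))\<^sup>2)" by (rule \<theta>1)
      also have "\<dots> \<le> f1 x" unfolding f1_def using y Y \<theta>0 by (intro member_le_sum) auto
      finally show ?thesis unfolding f_def using f2lo[of x] by linarith
    qed
    show "f y \<le> \<epsilon>" if y: "\<And>c. c \<in> C \<Longrightarrow> 3 * \<eta> \<le> dist c y" for y
    proof -
      have "f1 y = 0" unfolding f1_def
      proof (rule sum.neutral, rule ballI)
        fix z assume "z \<in> Y"
        then have "2 * \<eta> \<le> norm (y - z)" using y[of z] Y \<eta> by (auto simp: dist_norm norm_minus_commute)
        then have "(2 * \<eta>)\<^sup>2 \<le> (norm (y - z))\<^sup>2" using \<eta> by (intro power_mono) auto
        then show "\<theta> ((norm (y - z))\<^sup>2) = 0" by (intro \<theta>z) (simp add: R_def power_mult_distrib)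
      qed
      then show ?thesis unfolding f_def using mult_nonneg_nonpos[OF less_imp_le[OF \<beta>] f20[of y]] by linarith
    qed
  qed
qed

section \<open>Exit times and harmonic measure\<close>

lemma exit_time_attained:
  fixes \<gamma> :: "real \<Rightarrow> 'a::euclidean_space"
  assumes c: "continuous_on {0..} \<gamma>" and W: "open W" and t: "0 \<le> t" "\<gamma> t \<notin> W"
  shows "0 \<le> exit_time W \<gamma>" "\<gamma> (exit_time W \<gamma>) \<notin> W" "exit_time W \<gamma> \<le> t"
    and "\<And>s. 0 \<le> s \<Longrightarrow> s < exit_time W \<gamma> \<Longrightarrow> \<gamma> s \<in> W"
proof -
  let ?T = "{t. 0 \<le> t \<and> \<gamma> t \<notin> W}"
  have "closed ({0..} \<inter> \<gamma> -` (- W))"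
    by (rule continuous_closed_preimage[OF c]) (use W in auto)
  moreover have "{0..} \<inter> \<gamma> -` (- W) = ?T" by auto
  ultimately have cl: "closed ?T" by simp
  have bdd: "bdd_below ?T" by (intro bdd_belowI[of _ 0]) auto
  have "Inf ?T \<in> ?T" using t bdd cl by (intro closed_contains_Inf) auto
  then show "0 \<le> exit_time W \<gamma>" "\<gamma> (exit_time W \<gamma>) \<notin> W" unfolding exit_time_def by auto
  show "exit_time W \<gamma> \<le> t" unfolding exit_time_def using t bdd by (intro cInf_lower) auto
  show "\<gamma> s \<in> W" if s: "0 \<le> s" "s < exit_time W \<gamma>" for s
  proof (rule ccontr)
    assume "\<gamma> s \<notin> W"
    then have "exit_time W \<gamma> \<le> s" unfolding exit_time_def using s bdd by (intro cInf_lower) auto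
    then show False using s by simp
  qed
qed

text \<open>A statement about single paths. Up to its exit from \<open>V\<close> the path stays in
  \<open>closure V\<close>, hence in \<open>U\<close>, and at that exit it is on
  \<open>frontier V\<close>, so it has met \<open>A\<close> by then. The exit from
  \<open>U - A\<close> thus occurs at a point of \<open>U\<close>, which can only belong to
  \<open>A\<close>.\<close>

lemma exit_point_in_obstacle:
  fixes \<gamma> :: "real \<Rightarrow> 'a::euclidean_space"
  assumes c: "continuous_on {0..} \<gamma>" and V: "open V" "closure V \<subseteq> U" "\<gamma> 0 \<in> V" and W: "open (U - A)"
    and leave: "\<exists>t\<ge>0. \<gamma> t \<notin> V"
    and hit: "\<And>t. 0 \<le> t \<Longrightarrow> \<gamma> t \<in> frontier V \<Longrightarrow> \<exists>s\<in>{0..t}. \<gamma> s \<in> A"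
  shows "\<exists>t\<ge>0. \<gamma> t \<notin> U - A" and "\<gamma> (exit_time (U - A) \<gamma>) \<in> A"
proof -
  obtain t where t: "0 \<le> t" "\<gamma> t \<notin> V" using leave by blast
  define \<tau> where "\<tau> = exit_time V \<gamma>"
  note e = exit_time_attained[OF c V(1) t, folded \<tau>_def]
  have \<tau>0: "0 < \<tau>" using e(1,2) V(3) by (cases "\<tau> = 0") auto
  have clos: "\<gamma> s \<in> closure V" if "s \<in> {0..\<tau>}" for s
  proof -
    have "\<gamma> ` closure {0..<\<tau>} \<subseteq> closure (\<gamma> ` {0..<\<tau>})"
      using c \<tau>0 by (intro image_closure_subset[OF _ closed_closure closure_subset])
        (auto intro: continuous_on_subset)
    moreover have "closure (\<gamma> ` {0..<\<tau>}) \<subseteq> closure V" using e(4) by (intro closure_mono) auto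
    moreover have "closure {0..<\<tau>} = {0..\<tau>}" using \<tau>0 by simp
    ultimately show ?thesis using that by blast
  qed
  have "\<gamma> \<tau> \<in> frontier V"
    unfolding frontier_def using clos[of \<tau>] e(1,2) V(1) by (simp add: interior_open)
  from hit[OF e(1) this] obtain s where s: "s \<in> {0..\<tau>}" "\<gamma> s \<in> A" by blast
  then have s': "0 \<le> s" "\<gamma> s \<notin> U - A" by auto
  then show "\<exists>t\<ge>0. \<gamma> t \<notin> U - A" by blast
  note e2 = exit_time_attained[OF c W s']
  have "\<gamma> (exit_time (U - A) \<gamma>) \<in> closure V" using e2(1,3) s by (intro clos) auto
  then show "\<gamma> (exit_time (U - A) \<gamma>) \<in> A" using e2(2) V(2) by blast
qed

text \<open>The quantifier over \<open>t\<close> is uncountable. By continuity and compactness of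
  \<open>{0..a}\<close>, leaving \<open>W\<close> means that the distance to \<open>- W\<close>
  becomes arbitrarily small along a countable dense set of times. The case \<open>W = UNIV\<close>
  is separate since \<open>infdist\<close> to the empty set is 0.\<close>

lemma exits_before_measurable:
  fixes B :: "real \<Rightarrow> 'w \<Rightarrow> 'a::euclidean_space"
  assumes bm: "brownian_motion y M B" and W: "open W"
  shows "{\<omega> \<in> space M. \<exists>t\<in>{0..a}. B t \<omega> \<notin> W} \<in> sets M"
proof (cases "W = UNIV")
  case False
  then have ne: "- W \<noteq> {}" by auto
  obtain D where D: "countable D" "D \<subseteq> {0..a}" "{0..a} \<subseteq> closure D" by (rule separable)
  have [measurable]: "B t \<in> borel_measurable M" if "t \<in> D" for t
    using brownian_motionD(2)[OF bm] that D by auto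
  have "{\<omega> \<in> space M. \<exists>t\<in>{0..a}. B t \<omega> \<notin> W} =
    {\<omega> \<in> space M. \<forall>n::nat. \<exists>t\<in>D. infdist (B t \<omega>) (- W) < 1 / real (Suc n)}"
  proof (intro Collect_cong conj_cong refl)
    fix \<omega> assume w: "\<omega> \<in> space M"
    have c: "continuous_on {0..a} (\<lambda>t. infdist (B t \<omega>) (- W))"
      using brownian_motionD(4)[OF bm w] by (intro continuous_intros) (auto intro: continuous_on_subset)
    show "(\<exists>t\<in>{0..a}. B t \<omega> \<notin> W) \<longleftrightarrow> (\<forall>n::nat. \<exists>t\<in>D. infdist (B t \<omega>) (- W) < 1 / real (Suc n))"
    proof safe
      fix t n assume t: "t \<in> {0..a}" "B t \<omega> \<notin> W"
      have z: "infdist (B t \<omega>) (- W) = 0" using t by simp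
      have "0 < 1 / real (Suc n)" by simp
      then obtain d where d: "0 < d" "\<And>s. s \<in> {0..a} \<Longrightarrow> dist s t < d \<Longrightarrow> dist (infdist (B s \<omega>) (- W)) (infdist (B t \<omega>) (- W)) < 1 / real (Suc n)"
        using c t(1) unfolding continuous_on_iff by blast
      obtain s where s: "s \<in> D" "dist s t < d"
        using D(3) t(1) d(1) unfolding closure_approachable subset_iff by blast
      then have "infdist (B s \<omega>) (- W) < 1 / real (Suc n)"
        using d(2)[of s] D(2) z by (auto simp: dist_real_def)
      then show "\<exists>t\<in>D. infdist (B t \<omega>) (- W) < 1 / real (Suc n)" using s by blast
    next
      assume n: "\<forall>n. \<exists>t\<in>D. infdist (B t \<omega>) (- W) < 1 / real (Suc n)"
      then have "{0..a} \<noteq> {}" using D(2) by blast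
      then obtain t where t: "t \<in> {0..a}" "\<And>s. s \<in> {0..a} \<Longrightarrow> infdist (B t \<omega>) (- W) \<le> infdist (B s \<omega>) (- W)"
        using continuous_attains_inf[OF compact_Icc _ c] by blast
      have "infdist (B t \<omega>) (- W) \<le> 1 / real (Suc k)" for k
      proof -
        obtain s where "s \<in> D" "infdist (B s \<omega>) (- W) < 1 / real (Suc k)" using n by blast
        then show ?thesis using t(2)[of s] D(2) by force
      qed
      then have "infdist (B t \<omega>) (- W) \<le> 0"
        by (intro LIMSEQ_le_const[OF LIMSEQ_Suc[OF lim_1_over_n]]) auto
      then have "B t \<omega> \<in> - W"
        using in_closed_iff_infdist_zero[of "- W"] W ne infdist_nonneg[of "B t \<omega>" "- W"] by (simp add: closed_Compl)
      then show "\<exists>t\<in>{0..a}. B t \<omega> \<notin> W" using t(1) by auto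
    qed
  qed
  also have "\<dots> \<in> sets M"
  proof (intro sets.sets_Collect_countable_All sets.sets_Collect_countable_Ex'[OF _ D(1)])
    show "{\<omega> \<in> space M. infdist (B t \<omega>) (- W) < 1 / real (Suc n)} \<in> sets M" if "t \<in> D" for t n
    proof -
      have "(\<lambda>x. infdist x (- W)) \<in> borel_measurable borel"
        by (intro borel_measurable_continuous_onI continuous_intros)
      then have [measurable]: "(\<lambda>\<omega>. infdist (B t \<omega>) (- W)) \<in> borel_measurable M" using that by measurable
      show ?thesis by measurable
    qed
  qed
  finally show ?thesis .
qed simp

text \<open>The work lies in measurability of the exit point on the paths that leave
  \<open>W\<close>: only then can the mass of the image measure be computed from the almost sure
  statement.\<close>

lemma harmonic_measure_eq_1:
  fixes B :: "real \<Rightarrow> 'w \<Rightarrow> 'a::euclidean_space"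
  assumes bm: "brownian_motion y M B" and W: "open W" and A: "A \<in> sets borel"
    and AE: "AE \<omega> in M. (\<exists>t\<ge>0. B t \<omega> \<notin> W) \<and> B (exit_time W (\<lambda>t. B t \<omega>)) \<omega> \<in> A"
  shows "measure (harmonic_measure M B W) A = 1"
proof -
  interpret prob_space M by (rule brownian_motionD[OF bm])
  define \<Omega> where "\<Omega> = {\<omega> \<in> space M. \<exists>t\<ge>0. B t \<omega> \<notin> W}"
  define E where "E a = {\<omega> \<in> space M. \<exists>t\<in>{0..a}. B t \<omega> \<notin> W}" for a
  have E[measurable]: "E a \<in> sets M" for a unfolding E_def by (rule exits_before_measurable[OF bm W])
  have "\<Omega> = (\<Union>n. E (real n))"
    unfolding \<Omega>_def E_def using real_arch_simple by fastforce
  then have \<Omega>[measurable]: "\<Omega> \<in> sets M" by auto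
  let ?N = "restrict_space M \<Omega>"
  have sub: "\<Omega> \<subseteq> space M" unfolding \<Omega>_def by auto
  have sp: "space ?N = \<Omega>" using sub by (auto simp: space_restrict_space)
  let ?\<tau> = "\<lambda>\<omega>. exit_time W (\<lambda>t. B t \<omega>)"
  note at = exit_time_attained[OF brownian_motionD(4)[OF bm] W]
  have \<tau>0: "0 \<le> ?\<tau> \<omega>" if w: "\<omega> \<in> \<Omega>" for \<omega>
    using w at(1)[of \<omega>] unfolding \<Omega>_def by blast
  have \<tau>[measurable]: "?\<tau> \<in> borel_measurable ?N"
  proof (rule borel_measurableI_le)
    fix a
    have "{\<omega> \<in> space ?N. ?\<tau> \<omega> \<le> a} = E a"
    proof (intro equalityI subsetI)
      fix \<omega> assume "\<omega> \<in> {\<omega> \<in> space ?N. ?\<tau> \<omega> \<le> a}"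
      then have w: "\<omega> \<in> \<Omega>" "?\<tau> \<omega> \<le> a" by (auto simp: sp)
      then obtain t where "\<omega> \<in> space M" "0 \<le> t" "B t \<omega> \<notin> W" unfolding \<Omega>_def by blast
      from at(1,2)[OF this] show "\<omega> \<in> E a" using w(2) \<open>\<omega> \<in> space M\<close> unfolding E_def by auto
    next
      fix \<omega> assume "\<omega> \<in> E a"
      then obtain t where t: "\<omega> \<in> space M" "0 \<le> t" "B t \<omega> \<notin> W" "t \<le> a" unfolding E_def by auto
      then have "\<omega> \<in> \<Omega>" unfolding \<Omega>_def by auto
      then show "\<omega> \<in> {\<omega> \<in> space ?N. ?\<tau> \<omega> \<le> a}" using at(3)[OF t(1-3)] t(4) by (simp add: sp)
    qed
    moreover have "E a \<subseteq> \<Omega>" unfolding E_def \<Omega>_def by auto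
    ultimately show "{\<omega> \<in> space ?N. ?\<tau> \<omega> \<le> a} \<in> sets ?N"
      using \<Omega> E[of a] sub by (simp add: sets_restrict_space_iff)
  qed
  \<comment> \<open>The exit time is rounded up to a grid of mesh \<open>1 / Suc n\<close>. At such
    countably many times the process is measurable, and by path continuity the sampled values
    converge to the exit point.\<close>
  define k where "k n \<omega> = nat \<lceil>?\<tau> \<omega> * real (Suc n)\<rceil>" for n \<omega>
  have k[measurable]: "k n \<in> measurable ?N (count_space UNIV)" for n
    unfolding k_def[abs_def] by measurable
  let ?X = "\<lambda>\<omega>. B (?\<tau> \<omega>) \<omega>"
  have Xm: "?X \<in> borel_measurable ?N"
  proof (rule borel_measurable_LIMSEQ_metric)
    fix n
    have "(\<lambda>\<omega>. B (real i / real (Suc n)) \<omega>) \<in> borel_measurable ?N" for i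
      using brownian_motionD(2)[OF bm] by (intro measurable_restrict_space1) auto
    from measurable_compose_countable[OF this k[of n]]
    show "(\<lambda>\<omega>. B (real (k n \<omega>) / real (Suc n)) \<omega>) \<in> borel_measurable ?N" .
  next
    fix \<omega> assume "\<omega> \<in> space ?N"
    then have w: "\<omega> \<in> \<Omega>" "\<omega> \<in> space M" using sub by (auto simp: sp)
    have "(\<lambda>n. real (k n \<omega>) / real (Suc n)) \<longlonglongrightarrow> ?\<tau> \<omega>"
    proof (rule tendsto_sandwich)
      show "\<forall>\<^sub>F n in sequentially. ?\<tau> \<omega> \<le> real (k n \<omega>) / real (Suc n)"
        unfolding k_def using real_nat_ceiling_ge[of "?\<tau> \<omega> * real (Suc _)"]
        by (intro always_eventually allI) (simp add: pos_le_divide_eq del: of_nat_Suc)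
      have k_le: "real (k n \<omega>) \<le> ?\<tau> \<omega> * real (Suc n) + 1" for n
      proof -
        have "0 \<le> ?\<tau> \<omega> * real (Suc n)" using \<tau>0[OF w(1)] by simp
        then have "real (k n \<omega>) = real_of_int \<lceil>?\<tau> \<omega> * real (Suc n)\<rceil>"
          unfolding k_def by (intro of_nat_nat) linarith
        then show ?thesis using ceiling_correct[of "?\<tau> \<omega> * real (Suc n)"] by linarith
      qed
      show "\<forall>\<^sub>F n in sequentially. real (k n \<omega>) / real (Suc n) \<le> ?\<tau> \<omega> + 1 / real (Suc n)"
      proof (intro always_eventually allI)
        fix n
        have "real (k n \<omega>) / real (Suc n) \<le> (?\<tau> \<omega> * real (Suc n) + 1) / real (Suc n)"
          by (intro divide_right_mono k_le) auto
        also have "\<dots> = ?\<tau> \<omega> + 1 / real (Suc n)" by (simp add: add_divide_distrib del: of_nat_Suc)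
        finally show "real (k n \<omega>) / real (Suc n) \<le> ?\<tau> \<omega> + 1 / real (Suc n)" .
      qed
      have "(\<lambda>n. ?\<tau> \<omega> + 1 / real (Suc n)) \<longlonglongrightarrow> ?\<tau> \<omega> + 0"
        by (intro tendsto_intros LIMSEQ_Suc[OF lim_1_over_n])
      then show "(\<lambda>n. ?\<tau> \<omega> + 1 / real (Suc n)) \<longlonglongrightarrow> ?\<tau> \<omega>" by simp
    qed simp
    then show "(\<lambda>n. B (real (k n \<omega>) / real (Suc n)) \<omega>) \<longlonglongrightarrow> B (?\<tau> \<omega>) \<omega>"
      by (rule continuous_on_tendsto_compose[OF brownian_motionD(4)[OF bm w(2)]]) (use \<tau>0[OF w(1)] in auto)
  qed
  have S: "?X -` A \<inter> \<Omega> \<in> sets M"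
  proof -
    have "?X -` A \<inter> space ?N \<in> sets ?N" using Xm A by (rule measurable_sets)
    then show ?thesis using \<Omega> sub by (simp add: sp sets_restrict_space_iff)
  qed
  have "measure (harmonic_measure M B W) A = measure ?N (?X -` A \<inter> space ?N)"
    unfolding harmonic_measure_def \<Omega>_def[symmetric] by (rule measure_distr[OF Xm A])
  also have "\<dots> = measure M (?X -` A \<inter> \<Omega>)"
    unfolding sp using \<Omega> sub by (intro measure_restrict_space) auto
  also have "\<dots> = 1"
    using AE S unfolding prob_eq_1[OF S] by (auto simp: \<Omega>_def)
  finally show ?thesis .
qed

text \<open>The Gaussian density at time \<open>T\<close> is at most
  \<open>(2 * pi * T) powr (- d / 2)\<close>, so the probability of being in a fixed ball tends to
  0; integer times are enough.\<close>

lemma brownian_motion_leaves_bounded: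
  fixes B :: "real \<Rightarrow> 'w \<Rightarrow> 'a::euclidean_space"
  assumes bm: "brownian_motion y M B" and V: "bounded V"
  shows "AE \<omega> in M. \<exists>t\<ge>0. B t \<omega> \<notin> V"
proof -
  interpret prob_space M by (rule brownian_motionD[OF bm])
  obtain R where R: "0 < R" "V \<subseteq> cball y R"
    using bounded_subset_ballD[OF V, of y] ball_subset_cball by blast
  have [measurable]: "B (real n) \<in> borel_measurable M" for n using brownian_motionD(2)[OF bm] by simp
  define N where "N = {\<omega> \<in> space M. \<forall>n. B (real n) \<omega> \<in> cball y R}"
  have N[measurable]: "N \<in> sets M"
    unfolding N_def
  proof (intro sets.sets_Collect_countable_All)
    show "{\<omega> \<in> space M. B (real n) \<omega> \<in> cball y R} \<in> sets M" for n
      using measurable_sets[of "B (real n)" M borel "cball y R"] by (simp add: vimage_def Int_def conj_commute)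
  qed
  define v where "v = measure lborel (cball (0::'a) R)"
  have ev: "emeasure lborel (cball (0::'a) R) = ennreal v"
    unfolding v_def using emeasure_bounded_finite[OF bounded_cball] by (intro emeasure_eq_ennreal_measure) (simp add: less_top)
  have bd: "emeasure M N \<le> ennreal ((1 / sqrt (2 * pi * real (Suc n))) ^ DIM('a) * v)" for n
  proof -
    define T where "T = real (Suc n)"
    have T: "0 < T" unfolding T_def by simp
    let ?Z = "\<lambda>\<omega>. B (T) \<omega> - B 0 \<omega>"
    have B0[measurable]: "B 0 \<in> borel_measurable M" using brownian_motionD(2)[OF bm] by simp
    have NT: "B T \<omega> \<in> cball y R" if "\<omega> \<in> N" for \<omega> using that unfolding N_def T_def by blast
    have BT[measurable]: "B T \<in> borel_measurable M" using brownian_motionD(2)[OF bm] T by simp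
    have Z[measurable]: "?Z \<in> borel_measurable M" by measurable
    have "emeasure M N \<le> emeasure M (?Z -` cball 0 R \<inter> space M)"
    proof (rule emeasure_mono)
      show "N \<subseteq> ?Z -` cball 0 R \<inter> space M"
        using NT by (auto simp: N_def brownian_motionD(3)[OF bm] dist_norm norm_minus_commute)
    qed (auto intro!: measurable_sets[OF Z])
    also have "\<dots> = emeasure (gauss (T)) (cball 0 R :: 'a set)"
      using distr_increment[OF bm, of 0 T] emeasure_distr[OF Z, of "cball 0 R"] T by simp
    also have "\<dots> = (\<integral>\<^sup>+x. ennreal (\<Prod>b\<in>Basis. normal_density 0 (sqrt (T)) (x \<bullet> b)) * indicator (cball 0 R) x \<partial>(lborel :: 'a measure))"
      unfolding gauss_def by (subst emeasure_density) auto
    also have "\<dots> \<le> (\<integral>\<^sup>+x. ennreal ((1 / sqrt (2 * pi * T)) ^ DIM('a)) * indicator (cball 0 R) x \<partial>(lborel :: 'a measure))"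
    proof (intro nn_integral_mono mult_right_mono ennreal_leI)
      fix x :: 'a
      have "(\<Prod>b\<in>Basis. normal_density 0 (sqrt (T)) (x \<bullet> b)) \<le> (\<Prod>b\<in>(Basis::'a set). 1 / sqrt (2 * pi * T))"
      proof (intro prod_mono conjI)
        fix b :: 'a
        have "exp (- (x \<bullet> b - 0)\<^sup>2 / (2 * (sqrt (T))\<^sup>2)) \<le> 1" by simp
        then show "normal_density 0 (sqrt (T)) (x \<bullet> b) \<le> 1 / sqrt (2 * pi * T)"
          unfolding normal_density_def using T by (simp add: divide_right_mono)
      qed simp
      then show "(\<Prod>b\<in>Basis. normal_density 0 (sqrt (T)) (x \<bullet> b)) \<le> (1 / sqrt (2 * pi * T)) ^ DIM('a)"
        by simp
    qed simp
    also have "\<dots> = ennreal ((1 / sqrt (2 * pi * T)) ^ DIM('a)) * ennreal v"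
      by (subst nn_integral_cmult_indicator) (auto simp: ev)
    finally show ?thesis unfolding T_def[symmetric] using T by (subst ennreal_mult) (auto simp: v_def)
  qed
  have "(\<lambda>n. (1 / sqrt (2 * pi * real (Suc n))) ^ DIM('a) * v) \<longlonglongrightarrow> 0 ^ DIM('a) * v"
  proof (intro tendsto_mult tendsto_power tendsto_const)
    show "(\<lambda>n. 1 / sqrt (2 * pi * real (Suc n))) \<longlonglongrightarrow> 0" by real_asymp
  qed
  then have "(\<lambda>n. ennreal ((1 / sqrt (2 * pi * real (Suc n))) ^ DIM('a) * v)) \<longlonglongrightarrow> ennreal 0"
    by (intro tendsto_ennrealI) (simp add: zero_power)
  then have "emeasure M N \<le> ennreal 0" by (rule LIMSEQ_le_const) (use bd in auto)
  then have "N \<in> null_sets M" using N by auto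
  then have "AE \<omega> in M. \<omega> \<notin> N" by (rule AE_not_in)
  with AE_space show ?thesis
  proof eventually_elim
    case (elim \<omega>)
    then obtain n where "B (real n) \<omega> \<notin> cball y R" unfolding N_def by blast
    then show ?case using R(2) by (intro exI[of _ "real n"]) auto
  qed
qed

section \<open>Exhaustion of the domain\<close>

lemma iterated_ln_at_top: "filterlim (\<lambda>x::real. (ln ^^ k) x) at_top at_top"
proof (induction k)
  case 0 then show ?case by (simp add: filterlim_ident)
next
  case (Suc k) then show ?case by (auto intro: filterlim_compose[OF ln_at_top])
qed

lemma iterated_ln_inverse_at_top: "filterlim (\<lambda>r::real. (ln ^^ k) (1 / r)) at_top (at_right 0)"
  by (rule filterlim_compose[OF iterated_ln_at_top])
    (simp add: inverse_eq_divide[symmetric] filterlim_inverse_at_top_right)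

lemma eventually_iterated_ln_pos: "\<forall>\<^sub>F r::real in at_right 0. \<forall>k\<in>{1..n}. 0 < (ln ^^ k) (1 / r)"
  by (intro eventually_ball_finite ballI) (auto intro!: filterlim_at_top_dense[THEN iffD1, rule_format] iterated_ln_inverse_at_top)

locale domain_exhaustion =
  fixes U :: "'a::euclidean_space set"
  assumes U_open: "open U"
begin

text \<open>The case distinction is needed because \<open>infdist x {} = 0\<close>.\<close>

definition gap :: "'a \<Rightarrow> real" where
  "gap x = (if U = UNIV then 1 else infdist x (- U))"

text \<open>The successor avoids division by 0. Early sets may be empty, such as \<open>V 0\<close>
  for \<open>U = UNIV\<close>, where \<open>gap\<close> is constantly 1.\<close>

definition V :: "nat \<Rightarrow> 'a set" where
  "V m = {x. norm x < real (Suc m) \<and> 1 / real (Suc m) < gap x}"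

text \<open>One twentieth of \<open>1 / Suc m - 1 / Suc (Suc m)\<close>, the change of the
  \<open>gap\<close> threshold from \<open>V m\<close> to the next set. This leaves room for centres
  displaced by up to \<open>3 * \<eta> m\<close> and for the radii.\<close>

definition \<eta> :: "nat \<Rightarrow> real" where
  "\<eta> m = 1 / (20 * real (Suc m) * real (Suc (Suc m)))"

lemma \<eta>_pos: "0 < \<eta> m" by (simp add: \<eta>_def)

lemma \<eta>_le: "\<eta> m \<le> 1 / (20 * real (Suc m))"
  unfolding \<eta>_def by (intro divide_left_mono) auto

lemma \<eta>_mono: "k \<le> m \<Longrightarrow> \<eta> m \<le> \<eta> k"
  unfolding \<eta>_def by (intro divide_left_mono mult_mono) auto

lemma \<eta>_less_1: "\<eta> m < 1"
  using \<eta>_le[of m] by (rule order_le_less_trans) (simp add: field_simps)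

lemma gap_lipschitz: "gap x \<le> gap y + dist x y"
  unfolding gap_def using infdist_triangle[of x "- U" y] by auto

lemma gap_pos_iff: "0 < gap x \<longleftrightarrow> x \<in> U"
proof (cases "U = UNIV")
  case False
  then have "- U \<noteq> {}" by auto
  then have "infdist x (- U) = 0 \<longleftrightarrow> x \<in> - U"
    using in_closed_iff_infdist_zero[of "- U" x] U_open by (simp add: closed_Compl)
  then show ?thesis using False infdist_nonneg[of x "- U"] unfolding gap_def by (auto simp: less_le)
next
  case True
  then have "gap x = 1" unfolding gap_def by (rule if_P)
  then show ?thesis using True by (metis UNIV_I zero_less_one)
qed

lemma gap_le_dist_frontier: "z \<in> frontier U \<Longrightarrow> gap x \<le> dist x z"
proof -
  assume z: "z \<in> frontier U"
  then have "z \<in> - U" using U_open by (simp add: frontier_def interior_open)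
  then show ?thesis unfolding gap_def using infdist_le[of z "- U" x] by auto
qed

lemma continuous_on_gap: "continuous_on S gap"
  unfolding gap_def by (cases "U = UNIV") (auto intro!: continuous_intros)

lemma open_V: "open (V m)"
  unfolding V_def by (intro open_Collect_conj open_Collect_less continuous_on_gap continuous_intros)

lemma bounded_V: "bounded (V m)"
  by (rule bounded_subset[OF bounded_ball[of 0 "real (Suc m)"]]) (auto simp: V_def)

lemma closure_VD:
  assumes "x \<in> closure (V m)" shows "norm x \<le> real (Suc m)" "1 / real (Suc m) \<le> gap x"
proof -
  have "closed {x. norm x \<le> real (Suc m) \<and> 1 / real (Suc m) \<le> gap x}"
    by (intro closed_Collect_conj closed_Collect_le continuous_on_gap continuous_intros)
  then have "closure (V m) \<subseteq> {x. norm x \<le> real (Suc m) \<and> 1 / real (Suc m) \<le> gap x}"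
    by (intro closure_minimal) (auto simp: V_def)
  then show "norm x \<le> real (Suc m)" "1 / real (Suc m) \<le> gap x" using assms by auto
qed

lemma closure_V_subset: "closure (V m) \<subseteq> U"
proof
  fix x assume "x \<in> closure (V m)"
  from closure_VD(2)[OF this] have "0 < gap x" by (rule less_le_trans[rotated]) simp
  then show "x \<in> U" by (simp add: gap_pos_iff)
qed

lemma compact_frontier_V: "compact (frontier (V m))"
  by (intro compact_frontier_bounded bounded_V)

lemma ex_V: "x \<in> U \<Longrightarrow> \<exists>m. x \<in> V m"
proof -
  assume "x \<in> U"
  then have g: "0 < gap x" by (simp add: gap_pos_iff)
  obtain m where m: "max (norm x) (1 / gap x) < real m" using reals_Archimedean2 by blast
  then have "1 / gap x < real (Suc m)" "norm x < real (Suc m)" by auto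
  then show ?thesis using g unfolding V_def by (intro exI[of _ m]) (simp add: field_simps)
qed

text \<open>A frontier point of the open set \<open>V m\<close> violates one of its two strict
  inequalities, and \<open>norm\<close> and \<open>gap\<close> are 1-Lipschitz. The conditions on
  \<open>y\<close> are closed so that they cover both \<open>V k\<close> and its closure.\<close>

lemma frontier_V_separated:
  assumes c: "c \<in> frontier (V m)" and km: "k < m" and y: "norm y \<le> real (Suc k)" "1 / real (Suc k) \<le> gap y"
  shows "20 * \<eta> k \<le> dist c y"
proof -
  have e: "20 * \<eta> k = 1 / real (Suc k) - 1 / real (Suc (Suc k))"
  proof -
    have "1 / a - 1 / (a + 1) = 1 / (a * (a + 1))" if "0 < a" for a :: real
      using that by (simp add: field_simps)
    moreover have "20 * (1 / (20 * a * b)) = 1 / (a * b)" for a b :: real by simp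
    moreover have "real (Suc (Suc k)) = real (Suc k) + 1" "0 < real (Suc k)" by simp_all
    ultimately show ?thesis unfolding \<eta>_def by metis
  qed
  have "c \<notin> V m" using c open_V[of m] by (simp add: frontier_def interior_open)
  then consider "real (Suc m) \<le> norm c" | "gap c \<le> 1 / real (Suc m)" unfolding V_def by force
  then show ?thesis
  proof cases
    case 1
    have "1 / real (Suc k) \<le> 1" "0 \<le> 1 / real (Suc (Suc k))" by simp_all
    then have "20 * \<eta> k \<le> 1" unfolding e by linarith
    also have "1 \<le> real (Suc m) - real (Suc k)" using km by simp
    also have "\<dots> \<le> norm c - norm y" using 1 y by simp
    also have "\<dots> \<le> dist c y" unfolding dist_norm by (rule norm_triangle_ineq2)
    finally show ?thesis .
  next
    case 2
    have "1 / real (Suc m) \<le> 1 / real (Suc (Suc k))" using km by (intro divide_left_mono) auto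
    then show ?thesis using 2 y gap_lipschitz[of y c] unfolding e by (simp add: dist_commute)
  qed
qed

end

section \<open>Gluing the layers into one champagne subregion\<close>

locale bubble_layers = domain_exhaustion +
  fixes X :: "nat \<Rightarrow> 'a set" and \<rho> :: "nat \<Rightarrow> real"
  assumes X_finite: "finite (X m)"
    and \<rho>_bounds: "0 < \<rho> m" "\<rho> m < \<eta> m"
    and X_near: "x \<in> X m \<Longrightarrow> \<exists>c\<in>frontier (V m). dist c x < 3 * \<eta> m"
    and X_sep: "x \<in> X m \<Longrightarrow> y \<in> X m \<Longrightarrow> x \<noteq> y \<Longrightarrow> 2 * \<rho> m < dist x y"
begin

text \<open>A centre lies within \<open>3 * \<eta> m\<close> of the frontier, which turns the
  separation 20 into 17. If \<open>y\<close> is replaced by a centre of the earlier layer, another 3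
  are lost, hence the 14 in \<open>layers_far\<close>.\<close>

lemma layer_far:
  assumes x: "x \<in> X m" and km: "k < m" and y: "norm y \<le> real (Suc k)" "1 / real (Suc k) \<le> gap y"
  shows "17 * \<eta> k < dist x y"
proof -
  obtain c where c: "c \<in> frontier (V m)" "dist c x < 3 * \<eta> m" using X_near[OF x] by blast
  have "20 * \<eta> k \<le> dist c y" by (rule frontier_V_separated[OF c(1) km y])
  then show ?thesis using c(2) \<eta>_mono[of k m] km dist_triangle[of c y x] by simp
qed

lemma layers_far:
  assumes x: "x \<in> X m" and y: "y \<in> X k" and km: "k < m"
  shows "14 * \<eta> k < dist x y"
proof -
  obtain c where c: "c \<in> frontier (V k)" "dist c y < 3 * \<eta> k" using X_near[OF y] by blast
  have "c \<in> closure (V k)" using c by (simp add: frontier_def)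
  from layer_far[OF x km closure_VD[OF this]] show ?thesis
    using c(2) dist_triangle[of x c y] by (simp add: dist_commute)
qed

lemma layer_unique: "x \<in> X m \<Longrightarrow> x \<in> X k \<Longrightarrow> m = k"
proof (rule ccontr)
  assume x: "x \<in> X m" "x \<in> X k" and ne: "m \<noteq> k"
  then consider "m < k" | "k < m" by linarith
  then show False using layers_far[of x _ x] x \<eta>_pos[of m] \<eta>_pos[of k] by cases fastforce+
qed

definition centres :: "'a set" where "centres = (\<Union>m. X m)"

definition layer :: "'a \<Rightarrow> nat" where "layer x = (THE m. x \<in> X m)"

text \<open>Even off \<open>centres\<close> the value is some \<open>\<rho> m\<close>, so bounds on
  all \<open>\<rho> m\<close> carry over to \<open>radius x\<close> for every
  \<open>x\<close>.\<close>

definition radius :: "'a \<Rightarrow> real" where "radius x = \<rho> (layer x)"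

lemma layer_eq: "x \<in> X m \<Longrightarrow> layer x = m"
  unfolding layer_def using layer_unique by blast

lemma radius_eq: "x \<in> X m \<Longrightarrow> radius x = \<rho> m"
  by (simp add: radius_def layer_eq)

lemma centresD: "x \<in> centres \<Longrightarrow> x \<in> X (layer x)"
  unfolding centres_def using layer_eq by auto

text \<open>The source of local finiteness: inside \<open>V k\<close> only the finitely many bubbles
  of the layers up to \<open>k\<close> are visible. Relative closedness and the absence of
  accumulation points both follow.\<close>

lemma cball_inter_V:
  assumes x: "x \<in> X m" and km: "k < m" shows "cball x (\<rho> m) \<inter> V k = {}"
proof -
  have False if "dist x p \<le> \<rho> m" "p \<in> V k" for p
  proof -
    have "17 * \<eta> k < dist x p" using that by (intro layer_far[OF x km]) (auto simp: V_def)
    then show False using that(1) \<rho>_bounds(2)[of m] \<eta>_mono[of k m] km \<eta>_pos[of k] by simp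
  qed
  then show ?thesis by auto
qed

text \<open>On \<open>closure (V m)\<close> the gap is at least \<open>1 / Suc m\<close>, hence at
  least \<open>20 * \<eta> m\<close>; moving to a centre costs 3. As radii are below
  \<open>\<eta> m\<close>, this places the bubbles in \<open>U\<close> and controls the quotient of
  radius and boundary distance.\<close>

lemma gap_centre: "x \<in> X m \<Longrightarrow> 17 * \<eta> m \<le> gap x"
proof -
  assume x: "x \<in> X m"
  obtain c where c: "c \<in> frontier (V m)" "dist c x < 3 * \<eta> m" using X_near[OF x] by blast
  have "c \<in> closure (V m)" using c by (simp add: frontier_def)
  from closure_VD(2)[OF this] have "20 * (\<eta> m) \<le> gap c"
  proof -
    have "20 * \<eta> m \<le> 20 * (1 / (20 * real (Suc m)))" by (intro mult_left_mono \<eta>_le) simp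
    also have "\<dots> = 1 / real (Suc m)" by (simp del: of_nat_Suc)
    also note \<open>1 / real (Suc m) \<le> gap c\<close>
    finally show ?thesis .
  qed
  then show ?thesis using gap_lipschitz[of c x] c(2) by simp
qed

lemma bubble_subset: "x \<in> X m \<Longrightarrow> cball x (\<rho> m) \<subseteq> U"
proof
  fix p assume x: "x \<in> X m" and p: "p \<in> cball x (\<rho> m)"
  have "gap x \<le> gap p + \<rho> m" using gap_lipschitz[of x p] p by simp
  then have "0 < gap p" using gap_centre[OF x] \<rho>_bounds(2)[of m] \<eta>_pos[of m] by linarith
  then show "p \<in> U" by (simp add: gap_pos_iff)
qed

lemma bubbles_eq: "bubbles centres radius = (\<Union>m. \<Union>x\<in>X m. cball x (\<rho> m))"
  unfolding bubbles_def centres_def using radius_eq by fastforce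

lemma open_complement: "open (U - bubbles centres radius)"
  unfolding open_subopen[of "U - _"]
proof
  fix z assume z: "z \<in> U - bubbles centres radius"
  obtain k where k: "z \<in> V k" using z ex_V by blast
  let ?F = "\<Union>m\<in>{..k}. \<Union>x\<in>X m. cball x (\<rho> m)"
  have "closed ?F" using X_finite by (intro closed_UN) auto
  then have "open (V k - ?F)" using open_V by blast
  moreover have "z \<in> V k - ?F" using z k unfolding bubbles_eq by blast
  moreover have "V k - ?F \<subseteq> U - bubbles centres radius"
  proof
    fix p assume p: "p \<in> V k - ?F"
    have "p \<notin> cball x (\<rho> m)" if "x \<in> X m" for m x
      using cball_inter_V[OF that, of k] p that by (cases "m \<le> k") auto
    then show "p \<in> U - bubbles centres radius"
      using p closure_V_subset[of k] closure_subset[of "V k"] unfolding bubbles_eq by blast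
  qed
  ultimately show "\<exists>T. open T \<and> z \<in> T \<and> T \<subseteq> U - bubbles centres radius" by blast
qed

lemma bubbles_subset: "bubbles centres radius \<subseteq> U"
  unfolding bubbles_eq using bubble_subset by blast

lemma champagne: "champagne_subregion U centres radius"
  unfolding champagne_subregion_def
proof (intro conjI ballI impI)
  show "countable centres" unfolding centres_def using X_finite by (intro countable_UN) (auto intro: countable_finite)
  show "centres \<subseteq> U"
  proof
    fix x assume "x \<in> centres"
    from bubble_subset[OF centresD[OF this]] \<rho>_bounds(1) show "x \<in> U" by (meson centre_in_cball less_imp_le subsetD)
  qed
  show "\<not> z islimpt centres" if "z \<in> U" for z
  proof -
    obtain k where k: "z \<in> V k" using ex_V \<open>z \<in> U\<close> by blast
    have "V k \<inter> centres \<subseteq> (\<Union>m\<in>{..k}. X m)"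
    proof
      fix x assume x: "x \<in> V k \<inter> centres"
      then have l: "x \<in> X (layer x)" by (intro centresD) auto
      have "x \<in> cball x (\<rho> (layer x))" using \<rho>_bounds(1)[of "layer x"] by simp
      then have "layer x \<le> k" using cball_inter_V[OF l, of k] x by (meson IntD1 disjoint_iff not_le)
      then show "x \<in> (\<Union>m\<in>{..k}. X m)" using l by blast
    qed
    then have "finite (V k \<inter> centres)" using X_finite by (elim finite_subset) auto
    then show ?thesis unfolding islimpt_eq_acc_point using k open_V by blast
  qed
  show "0 < radius x" for x unfolding radius_def by (rule \<rho>_bounds)
  show "radius x < 1" for x unfolding radius_def using \<rho>_bounds(2) \<eta>_less_1 less_trans by blast
  show "disjoint_family_on (\<lambda>x. cball x (radius x)) centres"
    unfolding disjoint_family_on_def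
  proof (intro ballI impI)
    fix x y assume xy: "x \<in> centres" "y \<in> centres" "x \<noteq> y"
    have lt: "radius x + radius y < dist x y" if "x \<in> X m" "y \<in> X k" "k < m" for x y m k
    proof -
      have "radius x + radius y < \<eta> m + \<eta> k" using that \<rho>_bounds(2) by (simp add: radius_eq add_strict_mono)
      also have "\<dots> \<le> 14 * \<eta> k" using \<eta>_mono[of k m] that \<eta>_pos[of k] by simp
      finally show ?thesis using layers_far[OF that] by simp
    qed
    have "radius x + radius y < dist x y"
    proof (cases "layer x" "layer y" rule: linorder_cases)
      case less
      then show ?thesis using lt[OF centresD[OF xy(2)] centresD[OF xy(1)]] by (simp add: dist_commute add.commute)
    next
      case equal
      then show ?thesis using X_sep[of x "layer x" y] centresD[OF xy(1)] centresD[OF xy(2)] xy(3) by (simp add: radius_def)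
    next
      case greater
      then show ?thesis using lt[OF centresD[OF xy(1)] centresD[OF xy(2)]] by simp
    qed
    then show "cball x (radius x) \<inter> cball y (radius y) = {}" by (simp add: disjoint_cballI)
  qed
  show "(SUP x\<in>centres. ereal (radius x) / (INF z\<in>frontier U. ereal (dist x z))) < 1"
  proof -
    \<comment> \<open>The supremum must be strictly below 1, so a uniform bound is needed. If
      \<open>frontier U\<close> is empty, the infimum is infinite and the quotient 0.\<close>
    have "ereal (radius x) / (INF z\<in>frontier U. ereal (dist x z)) \<le> ereal (1 / 2)" if x: "x \<in> centres" for x
    proof -
      let ?D = "INF z\<in>frontier U. ereal (dist x z)"
      have g: "17 * \<eta> (layer x) \<le> gap x" by (rule gap_centre[OF centresD[OF x]])
      have r: "0 < radius x" "radius x < \<eta> (layer x)" unfolding radius_def by (rule \<rho>_bounds)+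
      have D: "ereal (2 * radius x) \<le> ?D"
      proof (rule INF_greatest)
        fix z assume "z \<in> frontier U"
        from gap_le_dist_frontier[OF this, of x] show "ereal (2 * radius x) \<le> ereal (dist x z)"
          using g r by simp
      qed
      show ?thesis
      proof (cases ?D)
        case (real D')
        then have "2 * radius x \<le> D'" using D by simp
        then show ?thesis using r unfolding real by (simp add: field_simps)
      next
        case PInf
        then show ?thesis by simp
      next
        case MInf
        then show ?thesis using D by simp
      qed
    qed
    then have "(SUP x\<in>centres. ereal (radius x) / (INF z\<in>frontier U. ereal (dist x z))) \<le> ereal (1 / 2)"
      by (rule SUP_least)
    also have "\<dots> < 1" by (simp add: one_ereal_def)
    finally show ?thesis .
  qed
  show "(radius \<longlongrightarrow> 0) (inf at_infinity (principal centres))"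
  proof (rule tendstoI)
    fix e :: real assume e: "0 < e"
    obtain k where k: "1 / e < real k" using reals_Archimedean2 by blast
    have \<eta>k: "\<eta> k < e"
    proof -
      have "1 / e < 20 * real (Suc k)" using k by simp
      then have "1 / (20 * real (Suc k)) < e" using e by (simp add: field_simps)
      then show ?thesis using \<eta>_le[of k] by simp
    qed
    \<comment> \<open>The first \<open>k\<close> layers hold finitely many centres, so remote
      centres belong to later layers, whose radii are below \<open>\<eta> k\<close>.\<close>
    have "bounded (\<Union>m\<in>{..<k}. X m)" using X_finite by (intro finite_imp_bounded) auto
    then obtain N where N: "\<And>x. x \<in> (\<Union>m\<in>{..<k}. X m) \<Longrightarrow> norm x \<le> N" unfolding bounded_iff by blast
    show "\<forall>\<^sub>F x in inf at_infinity (principal centres). dist (radius x) 0 < e"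
      unfolding eventually_inf_principal eventually_at_infinity
    proof (intro exI[of _ "N + 1"] allI impI)
      fix x assume x: "N + 1 \<le> norm x" "x \<in> centres"
      have "k \<le> layer x" using N[of x] x centresD[OF x(2)] by (force simp: not_less[symmetric])
      then have "radius x < e" unfolding radius_def
        using \<rho>_bounds(2)[of "layer x"] \<eta>_mono[of k "layer x"] \<eta>k by linarith
      then show "dist (radius x) 0 < e" using \<rho>_bounds(1)[of "layer x"] by (simp add: radius_def)
    qed
  qed
qed

text \<open>No independence between layers is needed: a path that fails at all late layers fails at
  layer \<open>m\<close> in particular, which has probability at most \<open>(1 / 2) ^ m\<close>,
  for every late \<open>m\<close>. Almost surely some layer is therefore hit before
  \<open>frontier (V m)\<close>, and \<open>exit_point_in_obstacle\<close> applies with that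
  \<open>V m\<close>.\<close>

lemma unavoidable_bubbles:
  fixes f :: "nat \<Rightarrow> 'a \<Rightarrow> real" and S :: "nat \<Rightarrow> 'a set" and b K :: "nat \<Rightarrow> real"
  assumes f: "\<And>m. f m \<in> borel_measurable borel" "\<And>m x. 0 \<le> f m x" "\<And>m x. f m x \<le> b m" "\<And>m. 0 \<le> K m"
    and S: "\<And>m. open (S m)" "\<And>m. frontier (V m) \<subseteq> S m" "\<And>m x. x \<in> S m \<Longrightarrow> 1 \<le> f m x"
    and step: "\<And>m x. x \<notin> (\<Union>p\<in>X m. cball p (\<rho> m)) \<Longrightarrow> step_le (f m) x 0 (K m)"
    and far: "\<And>m y. (\<And>c. c \<in> frontier (V m) \<Longrightarrow> 3 * \<eta> m \<le> dist c y) \<Longrightarrow> f m y \<le> (1 / 2) ^ m"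
  shows "unavoidable U (bubbles centres radius)"
  unfolding unavoidable_def
proof (intro conjI ballI allI impI)
  let ?A = "bubbles centres radius"
  have "closedin (top_of_set U) (U - (U - ?A))"
    using open_complement by (intro closedin_diff) (auto intro: open_openin_trans simp: openin_open_eq U_open)
  moreover have "U - (U - ?A) = ?A" using bubbles_subset by blast
  ultimately show "closedin (top_of_set U) ?A" by simp
  have borel: "?A \<in> sets borel"
    using X_finite unfolding bubbles_eq by (intro sets.countable_UN' sets.finite_UN borel_closed) auto
  fix y and M :: "(real \<Rightarrow> 'a) measure" and B
  assume y: "y \<in> U - ?A" and bm: "brownian_motion y M B"
  interpret prob_space M by (rule brownian_motionD[OF bm])
  obtain k where k: "y \<in> V k" using ex_V y by blast
  have fy: "f m y \<le> (1 / 2) ^ m" if m: "k < m" for m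
  proof (rule far)
    fix c assume c: "c \<in> frontier (V m)"
    have "20 * \<eta> k \<le> dist c y" using k by (intro frontier_V_separated[OF c m]) (auto simp: V_def)
    then show "3 * \<eta> m \<le> dist c y" using \<eta>_mono[of k m] m \<eta>_pos[of k] by simp
  qed
  have "\<exists>N\<in>sets M. emeasure M N \<le> ennreal (f m y) \<and> (\<forall>\<omega>\<in>space M. \<forall>t\<ge>0. B t \<omega> \<in> S m \<longrightarrow>
      (\<forall>s\<in>{0..t}. B s \<omega> \<notin> (\<Union>p\<in>X m. cball p (\<rho> m))) \<longrightarrow> \<omega> \<in> N)" for m
    by (rule hit_before_bound[OF bm f(1) _ S(1) f(2,3,4) step S(3)]) (use X_finite in \<open>auto intro: closed_UN\<close>)
  then obtain N where N: "\<And>m. N m \<in> sets M" "\<And>m. emeasure M (N m) \<le> ennreal (f m y)"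
    and NH: "\<And>m \<omega> t. \<omega> \<in> space M \<Longrightarrow> 0 \<le> t \<Longrightarrow> B t \<omega> \<in> S m \<Longrightarrow>
      (\<forall>s\<in>{0..t}. B s \<omega> \<notin> (\<Union>p\<in>X m. cball p (\<rho> m))) \<Longrightarrow> \<omega> \<in> N m" by metis
  \<comment> \<open>Only indices beyond \<open>k\<close> enter: for these the starting point is in
    \<open>V m\<close> and far enough from \<open>frontier (V m)\<close> for the bound
    \<open>fy\<close>.\<close>
  define N0 where "N0 = (\<Inter>m\<in>{k<..}. N m)"
  have N0: "N0 \<in> sets M" unfolding N0_def using N(1) by (intro sets.countable_INT') auto
  have "emeasure M N0 \<le> ennreal 0"
  proof (rule LIMSEQ_le_const)
    show "(\<lambda>m. ennreal ((1 / 2) ^ m)) \<longlonglongrightarrow> ennreal 0"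
      by (intro tendsto_ennrealI LIMSEQ_realpow_zero) auto
    have "emeasure M N0 \<le> ennreal ((1 / 2) ^ m)" if "Suc k \<le> m" for m
    proof -
      have "emeasure M N0 \<le> emeasure M (N m)" using that N(1) unfolding N0_def by (intro emeasure_mono) auto
      also have "\<dots> \<le> ennreal (f m y)" by (rule N)
      also have "\<dots> \<le> ennreal ((1 / 2) ^ m)" using that by (intro ennreal_leI fy) auto
      finally show ?thesis .
    qed
    then show "\<exists>j. \<forall>m\<ge>j. emeasure M N0 \<le> ennreal ((1 / 2) ^ m)" by blast
  qed
  then have "N0 \<in> null_sets M" using N0 by auto
  then have AE1: "AE \<omega> in M. \<omega> \<notin> N0" by (rule AE_not_in)
  have AE2: "AE \<omega> in M. \<forall>m. \<exists>t\<ge>0. B t \<omega> \<notin> V m"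
    unfolding AE_all_countable using brownian_motion_leaves_bounded[OF bm bounded_V] by blast
  show "measure (harmonic_measure M B (U - ?A)) ?A = 1"
  proof (rule harmonic_measure_eq_1[OF bm open_complement borel])
    show "AE \<omega> in M. (\<exists>t\<ge>0. B t \<omega> \<notin> U - ?A) \<and> B (exit_time (U - ?A) (\<lambda>t. B t \<omega>)) \<omega> \<in> ?A"
      using AE_space AE1 AE2
    proof eventually_elim
      case (elim \<omega>)
      obtain m where m: "k < m" "\<omega> \<notin> N m" using elim(2) unfolding N0_def by auto
      have VV: "y \<in> V m"
      proof -
        have "1 / real (Suc m) \<le> 1 / real (Suc k)" using m by (intro divide_left_mono) auto
        then show ?thesis using k m unfolding V_def by auto
      qed
      have hit: "\<exists>s\<in>{0..t}. B s \<omega> \<in> ?A" if t: "0 \<le> t" "B t \<omega> \<in> frontier (V m)" for t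
      proof -
        have "B t \<omega> \<in> S m" using t S(2) by blast
        then obtain s where "s \<in> {0..t}" "B s \<omega> \<in> (\<Union>p\<in>X m. cball p (\<rho> m))"
          using NH[OF elim(1) t(1), of m] m(2) by blast
        then show ?thesis unfolding bubbles_eq by blast
      qed
      have y0: "B 0 \<omega> \<in> V m" using VV brownian_motionD(3)[OF bm elim(1)] by simp
      have leave: "\<exists>t\<ge>0. B t \<omega> \<notin> V m" using elim(3) by blast
      from exit_point_in_obstacle[OF brownian_motionD(4)[OF bm elim(1)] open_V closure_V_subset y0 open_complement leave hit]
      show ?case by blast
    qed
  qed
qed

text \<open>Each finite set of centres meets finitely many layers. Bounding all finite partial sums
  by \<open>s\<close> gives summability and the estimate at once.\<close>

lemma sum_centres:
  assumes g: "\<And>m. 0 \<le> g (\<rho> m)" and le: "\<And>m. real (card (X m)) * g (\<rho> m) \<le> a m"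
    and a: "a sums s" "\<And>m. 0 \<le> a m"
  shows "(\<lambda>x. g (radius x)) summable_on centres" "(\<Sum>\<^sub>\<infinity>x\<in>centres. g (radius x)) \<le> s"
proof -
  have bd: "(\<Sum>x\<in>F. g (radius x)) \<le> s" if F: "finite F" "F \<subseteq> centres" for F
  proof -
    obtain n where n: "layer ` F \<subseteq> {..<n}" using F finite_nat_iff_bounded by blast
    have "(\<Sum>x\<in>F. g (radius x)) \<le> (\<Sum>x\<in>(\<Union>m\<in>{..<n}. X m). g (radius x))"
      using F n X_finite centresD g unfolding radius_def by (intro sum_mono2) blast+
    also have "\<dots> = (\<Sum>m<n. \<Sum>x\<in>X m. g (radius x))"
      using X_finite layer_unique by (intro sum.UNION_disjoint) auto
    also have "\<dots> = (\<Sum>m<n. real (card (X m)) * g (\<rho> m))"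
      by (intro sum.cong refl) (simp add: radius_eq)
    also have "\<dots> \<le> (\<Sum>m<n. a m)" by (intro sum_mono le)
    also have "\<dots> \<le> s" using a sum_le_suminf[of a "{..<n}"] sums_unique[OF a(1)] by (auto simp: sums_iff)
    finally show ?thesis .
  qed
  have g0: "0 \<le> g (radius x)" for x unfolding radius_def by (rule g)
  show sm: "(\<lambda>x. g (radius x)) summable_on centres"
    by (rule nonneg_bdd_above_summable_on) (use g0 bd in \<open>auto intro!: bdd_aboveI[of _ s]\<close>)
  show "(\<Sum>\<^sub>\<infinity>x\<in>centres. g (radius x)) \<le> s"
    by (rule infsum_le_finite_sums[OF sm]) (use bd in auto)
qed

end

theorem theorem1p1:
  fixes U :: "'a::euclidean_space set" and n :: nat and \<delta> :: real
  assumes "DIM('a) \<ge> 2"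
    and "open U" and "connected U" and "U \<noteq> {}"
    and "n \<ge> 1" and "\<delta> > 0"
  shows "\<exists>(X :: 'a set) (r :: 'a \<Rightarrow> real).
     champagne_subregion U X r \<and>
     unavoidable U (bubbles X r) \<and>
     (DIM('a) = 2 \<longrightarrow>
        (\<forall>x\<in>X. \<forall>k\<in>{1..n + 1}. 0 < (ln ^^ k) (1 / r x)) \<and>
        (\<lambda>x. inverse (ln (1 / r x)) * inverse ((ln ^^ (n + 1)) (1 / r x))) summable_on X \<and>
        (\<Sum>\<^sub>\<infinity>x\<in>X. inverse (ln (1 / r x)) * inverse ((ln ^^ (n + 1)) (1 / r x))) < \<delta>) \<and>
     (DIM('a) \<ge> 3 \<longrightarrow>
        (\<forall>x\<in>X. \<forall>k\<in>{1..n}. 0 < (ln ^^ k) (1 / r x)) \<and>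
        (\<lambda>x. r x ^ (DIM('a) - 2) * inverse ((ln ^^ n) (1 / r x))) summable_on X \<and>
        (\<Sum>\<^sub>\<infinity>x\<in>X. r x ^ (DIM('a) - 2) * inverse ((ln ^^ n) (1 / r x))) < \<delta>)"
proof -
  interpret domain_exhaustion U by unfold_locales fact
  \<comment> \<open>The dimensions differ only in \<open>cap\<close> and in the depth of the
    iterated logarithm; with \<open>l\<close> and \<open>w\<close> both sums become one.\<close>
  define l where "l = (if DIM('a) = 2 then n + 1 else n)"
  define w :: "real \<Rightarrow> real" where "w r = inverse ((ln ^^ l) (1 / r))" for r
  have w: "(w \<longlongrightarrow> 0) (at_right 0)"
    unfolding w_def[abs_def] by (rule tendsto_inverse_0_at_top[OF iterated_ln_inverse_at_top])
  \<comment> \<open>The demands on the radius beyond the summation bound: room between the layers,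
    and positivity of all iterated logarithms that occur.\<close>
  define Q where "Q m r \<longleftrightarrow> r < \<eta> m \<and> (\<forall>k\<in>{1..l}. 0 < (ln ^^ k) (1 / r))" for m and r :: real
  have Q: "\<forall>\<^sub>F r in at_right 0. Q m r" for m
    unfolding Q_def using \<eta>_pos[of m]
    by (intro eventually_conj eventually_iterated_ln_pos eventually_at_rightI[of 0 "\<eta> m"]) auto
  \<comment> \<open>One predicate for all properties of a layer, so that its six ingredients are
    chosen simultaneously for every \<open>m\<close>.\<close>
  define good where "good m X r f S b K \<longleftrightarrow> finite X \<and> 0 < r \<and> Q m r \<and> (\<forall>x\<in>X. \<exists>c\<in>frontier (V m). dist c x < 3 * \<eta> m) \<and>
    (\<forall>x\<in>X. \<forall>y\<in>X. x \<noteq> y \<longrightarrow> 2 * r < dist x y) \<and>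
    real (card X) * (cap DIM('a) r * w r) < \<delta> / 4 * (1 / 2) ^ m \<and>
    f \<in> borel_measurable borel \<and> (\<forall>x. 0 \<le> f x) \<and> (\<forall>x. f x \<le> b) \<and> 0 \<le> K \<and> open S \<and> frontier (V m) \<subseteq> S \<and>
    (\<forall>x. x \<notin> (\<Union>p\<in>X. cball p r) \<longrightarrow> step_le f x 0 K) \<and> (\<forall>x\<in>S. 1 \<le> f x) \<and>
    (\<forall>y. (\<forall>c\<in>frontier (V m). 3 * \<eta> m \<le> dist c y) \<longrightarrow> f y \<le> (1 / 2) ^ m)" for m X r f S b K
  have "\<exists>X r f S b K. good m X r f S b K" for m
  proof -
    have pos: "0 < (1 / 2 :: real) ^ m" "0 < \<delta> / 4 * (1 / 2) ^ m" using assms by auto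
    show ?thesis
    proof (rule bubble_layer[OF assms(1) compact_frontier_V[of m] \<eta>_pos[of m] pos w Q[of m]], goal_cases)
      case (1 X r f S b K)
      have "good m X r f S b K"
        unfolding good_def by (intro conjI allI ballI impI) (rule 1; blast)+
      then show ?case by blast
    qed
  qed
  then obtain X \<rho> f S b K where good: "\<And>m. good m (X m) (\<rho> m) (f m) (S m) (b m) (K m)" by metis
  note layer = good[unfolded good_def]
  interpret bubble_layers U X \<rho>
    by unfold_locales (use layer in \<open>auto simp: Q_def\<close>)
  have unav: "unavoidable U (bubbles centres radius)"
    by (rule unavoidable_bubbles[of f b K S]) (use layer in blast)+
  have pos: "0 < (ln ^^ k) (1 / radius x)" if "k \<in> {1..l}" for k x
    using layer[of "layer x"] that unfolding Q_def radius_def by blast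
  have l1: "1 \<le> l" unfolding l_def using assms by simp
  define g where "g r = cap DIM('a) r * w r" for r
  have "0 \<le> g (\<rho> m)" for m
  proof -
    have "\<rho> m < 1" using layer[of m] \<eta>_less_1[of m] unfolding Q_def by linarith
    moreover have "0 < (ln ^^ l) (1 / \<rho> m)" using layer[of m] l1 unfolding Q_def by auto
    ultimately show ?thesis
      using cap_pos[of "\<rho> m" "DIM('a)"] \<rho>_bounds(1)[of m] unfolding g_def w_def by simp
  qed
  moreover have "real (card (X m)) * g (\<rho> m) \<le> \<delta> / 4 * (1 / 2) ^ m" for m
    using layer[of m] unfolding g_def by linarith
  \<comment> \<open>The geometric series has sum \<open>\<delta> / 2\<close>; the spare factor
    yields the strict inequality, since a sum of strict bounds passes to the limit only
    weakly.\<close>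
  moreover have "(\<lambda>m. \<delta> / 4 * (1 / 2) ^ m) sums (\<delta> / 4 * (1 / (1 - 1 / 2)))"
    by (intro sums_mult geometric_sums) simp
  moreover have "0 \<le> \<delta> / 4 * (1 / 2) ^ m" for m using assms by simp
  ultimately have sum: "(\<lambda>x. g (radius x)) summable_on centres" "(\<Sum>\<^sub>\<infinity>x\<in>centres. g (radius x)) \<le> \<delta> / 4 * (1 / (1 - 1 / 2))"
    by (rule sum_centres)+
  have less: "(\<Sum>\<^sub>\<infinity>x\<in>centres. g (radius x)) < \<delta>" using sum(2) assms by simp
  show ?thesis
  proof (intro exI[of _ centres] exI[of _ radius] conjI impI)
    assume d: "DIM('a) = 2"
    have l: "l = n + 1" and g: "g = (\<lambda>r. inverse (ln (1 / r)) * inverse ((ln ^^ (n + 1)) (1 / r)))"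
      using d by (auto simp: l_def g_def[abs_def] w_def cap_def)
    show "\<forall>x\<in>centres. \<forall>k\<in>{1..n + 1}. 0 < (ln ^^ k) (1 / radius x)" using pos l by blast
    show "(\<lambda>x. inverse (ln (1 / radius x)) * inverse ((ln ^^ (n + 1)) (1 / radius x))) summable_on centres"
      using sum(1) unfolding g .
    show "(\<Sum>\<^sub>\<infinity>x\<in>centres. inverse (ln (1 / radius x)) * inverse ((ln ^^ (n + 1)) (1 / radius x))) < \<delta>"
      using less unfolding g .
  next
    assume d: "3 \<le> DIM('a)"
    have l: "l = n" and g: "g = (\<lambda>r. r ^ (DIM('a) - 2) * inverse ((ln ^^ n) (1 / r)))"
      using d by (auto simp: l_def g_def[abs_def] w_def cap_def)
    show "\<forall>x\<in>centres. \<forall>k\<in>{1..n}. 0 < (ln ^^ k) (1 / radius x)" using pos l by blast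
    show "(\<lambda>x. radius x ^ (DIM('a) - 2) * inverse ((ln ^^ n) (1 / radius x))) summable_on centres"
      using sum(1) unfolding g .
    show "(\<Sum>\<^sub>\<infinity>x\<in>centres. radius x ^ (DIM('a) - 2) * inverse ((ln ^^ n) (1 / radius x))) < \<delta>"
      using less unfolding g .
  qed (rule champagne unav)+
qed

end
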